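(* Let $u_1,u_2\in C([0,1];H^3(\mathbb R^3))\cap C^1([0,1];L^2(\mathbb R^3))$ be solutions of $\partial_t u+\partial_x\Delta u+u\partial_x u=0$ on $\mathbb R^3\times[0,1]$, and let $v:=u_1-u_2$. Let $\delta>0$, $r\in(0,\tfrac12)$, $Q:=\{(x,y,z,t): \sqrt{x^2+y^2+z^2}\le1,\ t\in[r,1-r]\}$, and suppose $\|v\|_{L^2(Q)}\ge\delta$. For $R>0$ define $$A_R(v):=\Big(\int_0^1\int_{R-1\le\sqrt{x^2+y^2+z^2}\le R}\ \sum_{0\le k+l+n\le2}|\partial_x^k\partial_y^l\partial_z^n v(t)(x,y,z)|^2\,dx\,dy\,dz\,dt\Big)^{1/2}.$$ Then there are constants $\overline C=\overline C(r)>0$, $C>0$ and $R_0\ge2$ such that $$\|v\|_{L^2(Q)}\le C e^{14\overline C R^{3/2}}A_R(v)\qquad\text{for all } R\ge R_0.$$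
   Context: $\Delta=\partial_x^2+\partial_y^2+\partial_z^2$; $k,l,n$ range over nonnegative integers. *)

theory Defs
  imports "HOL-Analysis.Analysis"
begin

definition ex :: "real^3" where "ex = axis 1 1"
definition ey :: "real^3" where "ey = axis 2 1"
definition ez :: "real^3" where "ez = axis 3 1"

definition dirs :: "(real^3) set" where "dirs = {ex, ey, ez}"

fun pd_list :: "(real^3) list \<Rightarrow> (real^3 \<Rightarrow> real) \<Rightarrow> real^3 \<Rightarrow> real" where
  "pd_list [] f = f"
| "pd_list (e # es) f = (\<lambda>x. deriv (\<lambda>s. pd_list es f (x + s *\<^sub>R e)) 0)"

definition test_fun :: "(real^3 \<Rightarrow> real) \<Rightarrow> bool" where
  "test_fun \<phi> \<longleftrightarrow> compact (closure {x. \<phi> x \<noteq> 0}) \<and>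
     (\<forall>es. set es \<subseteq> dirs \<longrightarrow>
        continuous_on UNIV (pd_list es \<phi>) \<and>
        (\<forall>e\<in>dirs. \<forall>x. ((\<lambda>s. pd_list es \<phi> (x + s *\<^sub>R e))
             has_real_derivative pd_list (e # es) \<phi> x) (at 0)))"

definition sq_int :: "(real^3 \<Rightarrow> real) \<Rightarrow> bool" where
  "sq_int f \<longleftrightarrow> f \<in> borel_measurable lborel \<and> integrable lborel (\<lambda>x. (f x)^2)"

definition weak_deriv :: "(real^3) list \<Rightarrow> (real^3 \<Rightarrow> real) \<Rightarrow> (real^3 \<Rightarrow> real) \<Rightarrow> bool" where
  "weak_deriv es f g \<longleftrightarrow> sq_int g \<and>
     (\<forall>\<phi>. test_fun \<phi> \<longrightarrow>
        (\<integral>x. f x * pd_list es \<phi> x \<partial>lborel) = (-1) ^ length es * (\<integral>x. g x * \<phi> x \<partial>lborel))"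

text \<open>A chosen representative of the weak derivative (unique a.e. when it exists).\<close>
definition wd :: "(real^3) list \<Rightarrow> (real^3 \<Rightarrow> real) \<Rightarrow> (real^3 \<Rightarrow> real)" where
  "wd es f = (SOME g. weak_deriv es f g)"

definition mi :: "nat \<Rightarrow> nat \<Rightarrow> nat \<Rightarrow> (real^3) list" where
  "mi k l n = replicate k ex @ replicate l ey @ replicate n ez"

definition l2_cont :: "(real \<Rightarrow> real^3 \<Rightarrow> real) \<Rightarrow> bool" where
  "l2_cont F \<longleftrightarrow> (\<forall>t\<in>{0..1}. ((\<lambda>s. \<integral>x. (F s x - F t x)^2 \<partial>lborel) \<longlongrightarrow> 0) (at t within {0..1}))"

definition zk_solution :: "(real \<Rightarrow> real^3 \<Rightarrow> real) \<Rightarrow> bool" where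
  "zk_solution u \<longleftrightarrow>
     (\<forall>t\<in>{0..1}. sq_int (u t)) \<and>
     (\<forall>es. set es \<subseteq> dirs \<and> length es \<le> 3 \<longrightarrow>
        (\<forall>t\<in>{0..1}. \<exists>g. weak_deriv es (u t) g) \<and> l2_cont (\<lambda>t. wd es (u t))) \<and>
     (\<exists>w. (\<forall>t\<in>{0..1}. sq_int (w t)) \<and> l2_cont w \<and>
        (\<forall>t\<in>{0..1}. ((\<lambda>s. \<integral>x. ((u s x - u t x) / (s - t) - w t x)^2 \<partial>lborel) \<longlongrightarrow> 0)
                      (at t within {0..1})) \<and>
        (\<forall>t\<in>{0..1}. AE x in lborel.
            w t x + wd [ex, ex, ex] (u t) x + wd [ex, ey, ey] (u t) x + wd [ex, ez, ez] (u t) x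
              + u t x * wd [ex] (u t) x = 0))"

definition normQ :: "real \<Rightarrow> (real \<Rightarrow> real^3 \<Rightarrow> real) \<Rightarrow> real" where
  "normQ r v = sqrt (LINT t:{r..1-r}|lborel. (LINT p:cball 0 1|lborel. (v t p)^2))"

definition A_R :: "real \<Rightarrow> (real \<Rightarrow> real^3 \<Rightarrow> real) \<Rightarrow> real" where
  "A_R R v = sqrt (LINT t:{0..1}|lborel.
      (LINT p:{p. R - 1 \<le> norm p \<and> norm p \<le> R}|lborel.
         (\<Sum>k\<le>2. \<Sum>l\<le>2-k. \<Sum>n\<le>2-k-l. (wd (mi k l n) (v t) p)^2)))"

end

(*
With s = x/R + phi(t), where phi = 3 on [r, 1-r] and phi = 0 near t = 0 and t = 1, the weight is
exp (alpha s^2), alpha a large multiple of R^(3/2). It depends on x and t only: conjugating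
P = d_t + d_x Laplace with it gives A + S with A antisymmetric, S symmetric, and the commutator
[S, A] is positive except where the symbol of S itself is large. Pairing P f with
S f + 4 (d_x a) a f, where a = alpha d_x(s^2), therefore controls f and d_x f with constants that grow in R.

The estimate is applied to chi v, where chi cuts off to |p| <= R and to s >= 1; since s <= 1 near
t = 0, 1 no boundary terms in time appear. As v is only in H^3, it is first mollified in space: the
mollification satisfies the linear equation with right-hand side -(N * rho), where
N = u1 d_x u1 - u2 d_x u2, and everything passes to the limit in L^2. Because |N| <= M (|v| + |d_x v|)
by Sobolev's inequality, N is absorbed for large R. On Q the squared weight is at least exp (12.5 alpha).
The cutoff errors live either on the annulus, where it is at most exp (32 alpha) and A_R appears, or
where s <= 2, where it is at most exp (8 alpha); the latter loses against the lower bound delta on Q.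
*)
theory Submission
  imports Defs
begin

section \<open>Directional derivatives and smooth functions\<close>

text \<open>The exponent 3/2 comes from a balance. With h = 1/R the positive zeroth-order part of
  the commutator has size \<alpha>^5 h^6, while the time dependence of the weight produces terms of
  size \<alpha>^3 h^3 |phi'|. The former wins once \<alpha>^2 h^3 exceeds a multiple of |phi'|,
  which forces \<alpha> to be comparable with R^(3/2). For such \<alpha> the gain on d_x v is \<mu>
  = \<alpha>^3 h^4, of order R^(1/2). It is unbounded in R, and this is what absorbs M |d_x v|
  although M is not small. The bounds on phi' and phi'' depend on r alone, hence so does Cbar.

  The plateau value 3 makes s at least 5/2 on Q, strictly above 2. This gap in the exponent beats
  the energy of v on the region s \<le> 2, which is bounded independently of R. Half of 32 - 25/2,
  rounded up, is the final exponent 10 \<alpha>.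

  Positivity of the commutator is obtained from exact divergence identities rather than from a
  Fourier transform, because a, b and their derivatives depend on the point.\<close>

definition dd :: "'a::real_normed_vector \<Rightarrow> ('a \<Rightarrow> real) \<Rightarrow> 'a \<Rightarrow> real" where
  "dd e f x = deriv (\<lambda>s. f (x + s *\<^sub>R e)) 0"

text \<open>\<open>dd\<close> is total because \<open>deriv\<close> is, and its value is arbitrary
  where the derivative along e fails to exist; \<open>has_dd\<close> adds existence
  everywhere.\<close>

definition has_dd :: "'a::real_normed_vector \<Rightarrow> ('a \<Rightarrow> real) \<Rightarrow> ('a \<Rightarrow> real) \<Rightarrow> bool" where
  "has_dd e f g \<longleftrightarrow> (\<forall>x. ((\<lambda>s. f (x + s *\<^sub>R e)) has_real_derivative g x) (at 0))"

text \<open>Differentiability is only required along the directions in \<open>B\<close>: mollifying a solution in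
  space makes it smooth in the space directions, but only once differentiable in time.\<close>

fun ck :: "'a::real_normed_vector set \<Rightarrow> nat \<Rightarrow> ('a \<Rightarrow> real) \<Rightarrow> bool" where
  "ck B 0 f = continuous_on UNIV f"
| "ck B (Suc n) f = (continuous_on UNIV f \<and> (\<forall>e\<in>B. has_dd e f (dd e f) \<and> ck B n (dd e f)))"

definition smooth :: "'a::real_normed_vector set \<Rightarrow> ('a \<Rightarrow> real) \<Rightarrow> bool" where
  "smooth B f \<longleftrightarrow> (\<forall>n. ck B n f)"

definition bsupp :: "('a::real_normed_vector \<Rightarrow> real) \<Rightarrow> bool" where
  "bsupp f \<longleftrightarrow> (\<exists>r. \<forall>x. norm x > r \<longrightarrow> f x = 0)"

lemma has_dd_imp_dd: "has_dd e f g \<Longrightarrow> dd e f = g"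
  unfolding has_dd_def dd_def by (auto intro!: DERIV_imp_deriv)

lemma pd_list_Cons_dd: "pd_list (e # es) f = dd e (pd_list es f)"
  by (simp add: dd_def fun_eq_iff)

lemma has_dd_line:
  assumes "has_dd e f g"
  shows "((\<lambda>s. f (x + s *\<^sub>R e)) has_real_derivative g (x + s0 *\<^sub>R e)) (at s0)"
proof -
  have "((\<lambda>s. f ((x + s0 *\<^sub>R e) + s *\<^sub>R e)) has_real_derivative g (x + s0 *\<^sub>R e)) (at 0)"
    using assms by (simp add: has_dd_def)
  then have "((\<lambda>s. f (x + (s + s0) *\<^sub>R e)) has_real_derivative g (x + s0 *\<^sub>R e)) (at 0)"
    by (simp add: algebra_simps)
  then show ?thesis
    using DERIV_shift[of "\<lambda>s. f (x + s *\<^sub>R e)" "g (x + s0 *\<^sub>R e)" 0 s0] by simp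
qed

lemma has_dd_add: "has_dd e f f' \<Longrightarrow> has_dd e g g' \<Longrightarrow> has_dd e (\<lambda>x. f x + g x) (\<lambda>x. f' x + g' x)"
  unfolding has_dd_def by (auto intro: DERIV_add)

lemma has_dd_diff: "has_dd e f f' \<Longrightarrow> has_dd e g g' \<Longrightarrow> has_dd e (\<lambda>x. f x - g x) (\<lambda>x. f' x - g' x)"
  unfolding has_dd_def by (auto intro: DERIV_diff)

lemma has_dd_const: "has_dd e (\<lambda>x. c) (\<lambda>x. 0)"
  unfolding has_dd_def by auto

lemma has_dd_mult:
  assumes "has_dd e f f'" "has_dd e g g'"
  shows "has_dd e (\<lambda>x. f x * g x) (\<lambda>x. f' x * g x + f x * g' x)"
  unfolding has_dd_def
proof
  fix x
  show "((\<lambda>s. f (x + s *\<^sub>R e) * g (x + s *\<^sub>R e)) has_real_derivative f' x * g x + f x * g' x) (at 0)"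
    using DERIV_mult[OF has_dd_line[OF assms(1), of x 0] has_dd_line[OF assms(2), of x 0]]
    by (simp add: algebra_simps)
qed

lemma has_dd_cmult: "has_dd e f f' \<Longrightarrow> has_dd e (\<lambda>x. c * f x) (\<lambda>x. c * f' x)"
  unfolding has_dd_def by (auto intro: DERIV_cmult)

lemma has_dd_sq: "has_dd e f f' \<Longrightarrow> has_dd e (\<lambda>x. (f x)\<^sup>2) (\<lambda>x. 2 * f x * f' x)"
  using has_dd_mult[of e f f' f f'] by (simp add: power2_eq_square mult.assoc algebra_simps)

lemma has_dd_linear: "bounded_linear L \<Longrightarrow> has_dd e L (\<lambda>x. L e)"
proof -
  assume L: "bounded_linear L"
  then interpret bounded_linear L .
  show ?thesis unfolding has_dd_def
    by (auto simp: add scaleR intro!: derivative_eq_intros)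
qed

lemma has_dd_1: "has_dd (1::real) g g' \<longleftrightarrow> (\<forall>x. (g has_real_derivative g' x) (at x))"
proof
  assume "has_dd (1::real) g g'"
  from has_dd_line[OF this, of 0] show "\<forall>x. (g has_real_derivative g' x) (at x)" by simp
next
  assume *: "\<forall>x. (g has_real_derivative g' x) (at x)"
  show "has_dd 1 g g'" unfolding has_dd_def
  proof
    fix x
    have "((\<lambda>s. g (s + x)) has_real_derivative g' x) (at 0)"
      using * DERIV_shift[of g "g' x" 0 x] by simp
    then show "((\<lambda>s. g (x + s *\<^sub>R 1)) has_real_derivative g' x) (at 0)"
      by (simp add: add.commute)
  qed
qed

lemma has_dd_compose:
  assumes g: "has_dd (1::real) g g'" and f: "has_dd e f f'"
  shows "has_dd e (\<lambda>x. g (f x)) (\<lambda>x. g' (f x) * f' x)"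
  unfolding has_dd_def
proof
  fix x
  have "(g has_real_derivative g' (f (x + 0 *\<^sub>R e))) (at (f (x + 0 *\<^sub>R e)))"
    using g by (simp add: has_dd_1)
  from DERIV_chain2[OF this has_dd_line[OF f, of x 0]]
  show "((\<lambda>s. g (f (x + s *\<^sub>R e))) has_real_derivative g' (f x) * f' x) (at 0)"
    by simp
qed

lemma ck_Suc_D: "ck B (Suc n) f \<Longrightarrow> ck B n f"
proof (induction n arbitrary: f)
  case 0 then show ?case by simp
next
  case (Suc n)
  then show ?case by (metis ck.simps(2))
qed

lemma ck_SucI:
  assumes "continuous_on UNIV f" "\<And>e. e \<in> B \<Longrightarrow> \<exists>g. has_dd e f g \<and> ck B n g"
  shows "ck B (Suc n) f"
  using assms has_dd_imp_dd by fastforce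

lemma ck_SucE:
  assumes "ck B (Suc n) f" "e \<in> B" obtains g where "has_dd e f g" "ck B n g"
  using assms by auto

lemma smooth_cont: "smooth B f \<Longrightarrow> continuous_on UNIV f"
  unfolding smooth_def using ck.simps(1) by blast

lemma smooth_has_dd: "smooth B f \<Longrightarrow> e \<in> B \<Longrightarrow> has_dd e f (dd e f)"
  unfolding smooth_def by (metis ck.simps(2))

lemma smooth_dd: "smooth B f \<Longrightarrow> e \<in> B \<Longrightarrow> smooth B (dd e f)"
  unfolding smooth_def by (metis ck.simps(2))

text \<open>A family closed under differentiation is differentiable to every order, by induction on
  the order. This spares explicit formulas for the higher derivatives of test functions, of
  \<open>exp\<close> and of convolutions.\<close>

lemma smooth_coinduct:
  assumes Q: "Q f" and step: "\<And>f. Q f \<Longrightarrow> continuous_on UNIV f \<and> (\<forall>e\<in>B. \<exists>g. has_dd e f g \<and> Q g)"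
  shows "smooth B f"
proof -
  have "ck B n f" if "Q f" for n f using that
  proof (induction n arbitrary: f)
    case 0 then show ?case using step by simp
  next
    case (Suc n)
    show ?case using step[OF Suc.prems] Suc.IH by (intro ck_SucI) blast+
  qed
  then show ?thesis using Q by (simp add: smooth_def)
qed

lemma smooth_step:
  assumes "continuous_on UNIV f" "\<And>e. e \<in> B \<Longrightarrow> has_dd e f (g e) \<and> smooth B (g e)"
  shows "smooth B f"
  unfolding smooth_def
proof
  fix n
  have "ck B (Suc n) f" using assms by (intro ck_SucI) (auto simp: smooth_def)
  then show "ck B n f" by (rule ck_Suc_D)
qed

section \<open>Closure properties of smooth functions\<close>

lemma ck_const: "ck B n (\<lambda>x. c)"
proof (induction n arbitrary: c)
  case (Suc n) then show ?case by (intro ck_SucI) (auto intro!: exI[of _ "\<lambda>x. 0"] has_dd_const)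
qed auto

lemma ck_add: "ck B n f \<Longrightarrow> ck B n g \<Longrightarrow> ck B n (\<lambda>x. f x + g x)"
proof (induction n arbitrary: f g)
  case 0 then show ?case by (auto intro: continuous_intros)
next
  case (Suc n)
  show ?case
  proof (rule ck_SucI)
    show "continuous_on UNIV (\<lambda>x. f x + g x)" using Suc.prems by (auto intro: continuous_intros)
    fix e assume e: "e \<in> B"
    obtain f' g' where "has_dd e f f'" "ck B n f'" "has_dd e g g'" "ck B n g'"
      using Suc.prems e by (meson ck_SucE)
    then show "\<exists>h. has_dd e (\<lambda>x. f x + g x) h \<and> ck B n h"
      using has_dd_add Suc.IH by blast
  qed
qed

lemma ck_mult: "ck B n f \<Longrightarrow> ck B n g \<Longrightarrow> ck B n (\<lambda>x. f x * g x)"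
proof (induction n arbitrary: f g)
  case 0 then show ?case by (auto intro: continuous_intros)
next
  case (Suc n)
  show ?case
  proof (rule ck_SucI)
    show "continuous_on UNIV (\<lambda>x. f x * g x)" using Suc.prems by (auto intro: continuous_intros)
    fix e assume e: "e \<in> B"
    obtain f' g' where *: "has_dd e f f'" "ck B n f'" "has_dd e g g'" "ck B n g'"
      using Suc.prems e by (meson ck_SucE)
    have "ck B n (\<lambda>x. f' x * g x + f x * g' x)"
      using * Suc.prems ck_Suc_D by (intro ck_add Suc.IH) blast+
    then show "\<exists>h. has_dd e (\<lambda>x. f x * g x) h \<and> ck B n h"
      using has_dd_mult * by blast
  qed
qed

lemma ck_compose:
  assumes "smooth {1::real} g" "ck B n f"
  shows "ck B n (\<lambda>x. g (f x))"
  using assms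
proof (induction n arbitrary: f g)
  case 0 then show ?case
    using smooth_cont continuous_on_compose2[of UNIV g UNIV f] by auto
next
  case (Suc n)
  show ?case
  proof (rule ck_SucI)
    show "continuous_on UNIV (\<lambda>x. g (f x))"
      using Suc.prems smooth_cont continuous_on_compose2[of UNIV g UNIV f] by auto
    fix e assume e: "e \<in> B"
    obtain f' where *: "has_dd e f f'" "ck B n f'" using Suc.prems e by (meson ck_SucE)
    have "smooth {1} (dd 1 g)" using smooth_dd[OF Suc.prems(1)] by simp
    then have "ck B n (\<lambda>x. dd 1 g (f x))" using Suc.IH ck_Suc_D[OF Suc.prems(2)] by blast
    then have "ck B n (\<lambda>x. dd 1 g (f x) * f' x)" using *(2) by (rule ck_mult)
    then show "\<exists>h. has_dd e (\<lambda>x. g (f x)) h \<and> ck B n h"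
      using has_dd_compose[OF smooth_has_dd[OF Suc.prems(1)] *(1)] by blast
  qed
qed

lemma smooth_const: "smooth B (\<lambda>x. c)" by (simp add: smooth_def ck_const)
lemma smooth_add: "smooth B f \<Longrightarrow> smooth B g \<Longrightarrow> smooth B (\<lambda>x. f x + g x)"
  by (simp add: smooth_def ck_add)
lemma smooth_mult: "smooth B f \<Longrightarrow> smooth B g \<Longrightarrow> smooth B (\<lambda>x. f x * g x)"
  by (simp add: smooth_def ck_mult)
lemma smooth_cmult: "smooth B f \<Longrightarrow> smooth B (\<lambda>x. c * f x)"
  by (intro smooth_mult smooth_const)
lemma smooth_diff: "smooth B f \<Longrightarrow> smooth B g \<Longrightarrow> smooth B (\<lambda>x. f x - g x)"
  using smooth_add[of B f "\<lambda>x. (-1) * g x"] smooth_cmult[of B g "-1"] by simp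
lemma smooth_minus: "smooth B f \<Longrightarrow> smooth B (\<lambda>x. - f x)"
  using smooth_cmult[of B f "-1"] by simp
lemma smooth_power: "smooth B f \<Longrightarrow> smooth B (\<lambda>x. f x ^ n)"
  by (induction n) (auto intro: smooth_const smooth_mult)
lemma smooth_compose: "smooth {1::real} g \<Longrightarrow> smooth B f \<Longrightarrow> smooth B (\<lambda>x. g (f x))"
  by (simp add: smooth_def ck_compose)
lemma smooth_linear: "bounded_linear L \<Longrightarrow> smooth B L"
  by (rule smooth_step[where g = "\<lambda>e x. L e"])
     (auto intro: has_dd_linear smooth_const linear_continuous_on)
lemma smooth_id: "smooth {1::real} (\<lambda>x. x)"
  by (rule smooth_linear) (rule bounded_linear_ident)
lemma smooth_exp: "smooth {1::real} exp"
  by (rule smooth_coinduct[where Q = "\<lambda>f. f = exp"])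
     (auto simp: has_dd_1 intro!: continuous_intros)

lemma smooth_subset: "smooth B f \<Longrightarrow> C \<subseteq> B \<Longrightarrow> smooth C f"
  by (rule smooth_coinduct[where Q = "smooth B"])
     (auto intro: smooth_cont smooth_has_dd smooth_dd)

lemmas smooth_intros = smooth_const smooth_add smooth_diff smooth_minus smooth_mult smooth_power

lemma dd_add: "smooth B f \<Longrightarrow> smooth B g \<Longrightarrow> e \<in> B \<Longrightarrow> dd e (\<lambda>x. f x + g x) = (\<lambda>x. dd e f x + dd e g x)"
  by (intro has_dd_imp_dd has_dd_add smooth_has_dd)
lemma dd_diff: "smooth B f \<Longrightarrow> smooth B g \<Longrightarrow> e \<in> B \<Longrightarrow> dd e (\<lambda>x. f x - g x) = (\<lambda>x. dd e f x - dd e g x)"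
  by (intro has_dd_imp_dd has_dd_diff smooth_has_dd)
lemma dd_mult: "smooth B f \<Longrightarrow> smooth B g \<Longrightarrow> e \<in> B \<Longrightarrow>
    dd e (\<lambda>x. f x * g x) = (\<lambda>x. dd e f x * g x + f x * dd e g x)"
  by (intro has_dd_imp_dd has_dd_mult smooth_has_dd)
lemma dd_cmult: "smooth B f \<Longrightarrow> e \<in> B \<Longrightarrow> dd e (\<lambda>x. c * f x) = (\<lambda>x. c * dd e f x)"
  by (intro has_dd_imp_dd has_dd_cmult smooth_has_dd)
lemma dd_const: "dd e (\<lambda>x. c) = (\<lambda>x. 0)"
  by (intro has_dd_imp_dd has_dd_const)

text \<open>For small s the point x + s e stays in U. This is how derivatives of cutoffs are seen to
  vanish off the transition regions.\<close>

lemma dd_locally_const: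
  fixes f :: "'a::real_normed_vector \<Rightarrow> real"
  assumes "open U" "x \<in> U" "\<And>y. y \<in> U \<Longrightarrow> f y = c"
  shows "((\<lambda>s. f (x + s *\<^sub>R e)) has_real_derivative 0) (at 0)"
proof -
  have "open ((\<lambda>s. x + s *\<^sub>R e) -` U)"
    by (rule open_vimage[OF assms(1)]) (auto intro!: continuous_intros)
  moreover have "0 \<in> (\<lambda>s. x + s *\<^sub>R e) -` U" using assms by simp
  moreover have "((\<lambda>s. c) has_real_derivative 0) (at 0)" by simp
  ultimately show ?thesis
    using assms(3) has_field_derivative_transform_within_open[of "\<lambda>s. c" 0 0 "(\<lambda>s. x + s *\<^sub>R e) -` U" "\<lambda>s. f (x + s *\<^sub>R e)"]
    by auto
qed

lemma dd_zero_open: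
  assumes "open U" "x \<in> U" "\<And>y. y \<in> U \<Longrightarrow> f y = c"
  shows "dd e f x = 0"
  unfolding dd_def by (rule DERIV_imp_deriv[OF dd_locally_const[OF assms]])

lemma bsupp_dd: "bsupp f \<Longrightarrow> bsupp (dd e f)"
proof -
  assume "bsupp f"
  then obtain r where r: "\<And>x. norm x > r \<Longrightarrow> f x = 0" by (auto simp: bsupp_def)
  have "open {x::'a. norm x > r}" by (intro open_Collect_less continuous_intros)
  then have "dd e f x = 0" if "norm x > r" for x
    using dd_zero_open[of "{x. norm x > r}" x f 0 e] that r by auto
  then show ?thesis by (auto simp: bsupp_def)
qed

lemma bsupp_mult1: "bsupp f \<Longrightarrow> bsupp (\<lambda>x. f x * g x)"
  and bsupp_mult2: "bsupp g \<Longrightarrow> bsupp (\<lambda>x. f x * g x)"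
  by (auto simp: bsupp_def)
lemma bsupp_add: "bsupp f \<Longrightarrow> bsupp g \<Longrightarrow> bsupp (\<lambda>x. f x + g x)"
  unfolding bsupp_def by (metis add.right_neutral max_less_iff_conj)

lemma bsupp_compact:
  fixes f :: "'a::euclidean_space \<Rightarrow> real"
  shows "bsupp f \<longleftrightarrow> compact (closure {x. f x \<noteq> 0})"
proof
  assume "bsupp f"
  then obtain r where r: "\<And>x. norm x > r \<Longrightarrow> f x = 0" by (auto simp: bsupp_def)
  have "bounded {x. f x \<noteq> 0}"
    by (rule boundedI[of _ r]) (use r in force)
  then show "compact (closure {x. f x \<noteq> 0})" by simp
next
  assume "compact (closure {x. f x \<noteq> 0})"
  then have "bounded {x. f x \<noteq> 0}" by simp
  then obtain r where "\<And>x. f x \<noteq> 0 \<Longrightarrow> norm x \<le> r" by (auto simp: bounded_iff)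
  then show "bsupp f" unfolding bsupp_def by (metis not_less)
qed

lemma smooth_pd_list: "smooth dirs f \<Longrightarrow> set es \<subseteq> dirs \<Longrightarrow> smooth dirs (pd_list es f)"
  by (induction es) (auto simp: pd_list_Cons_dd simp del: pd_list.simps(2) intro: smooth_dd)

text \<open>Connects the given notion of test function with the calculus of \<open>smooth\<close>:
  the iterated derivatives \<open>pd_list es \<phi>\<close> are a family closed under
  differentiation.\<close>

lemma test_fun_iff: "test_fun \<phi> \<longleftrightarrow> bsupp \<phi> \<and> smooth dirs \<phi>"
proof
  assume t: "test_fun \<phi>"
  have "smooth dirs \<phi>"
  proof (rule smooth_coinduct[where Q = "\<lambda>f. \<exists>es. set es \<subseteq> dirs \<and> f = pd_list es \<phi>"])
    show "\<exists>es. set es \<subseteq> dirs \<and> \<phi> = pd_list es \<phi>" by (rule exI[of _ "[]"]) simp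
    fix f assume "\<exists>es. set es \<subseteq> dirs \<and> f = pd_list es \<phi>"
    then obtain es where es: "set es \<subseteq> dirs" "f = pd_list es \<phi>" by blast
    have "has_dd e f (pd_list (e # es) \<phi>)" if "e \<in> dirs" for e
      using t es that unfolding test_fun_def has_dd_def by auto
    moreover have "continuous_on UNIV f" using t es unfolding test_fun_def by auto
    ultimately show "continuous_on UNIV f \<and> (\<forall>e\<in>dirs. \<exists>g. has_dd e f g \<and> (\<exists>es. set es \<subseteq> dirs \<and> g = pd_list es \<phi>))"
      using es by (metis insert_subset list.simps(15))
  qed
  then show "bsupp \<phi> \<and> smooth dirs \<phi>" using t by (auto simp: test_fun_def bsupp_compact)
next
  assume *: "bsupp \<phi> \<and> smooth dirs \<phi>"
  have "has_dd e (pd_list es \<phi>) (pd_list (e # es) \<phi>)" if "e \<in> dirs" "set es \<subseteq> dirs" for e es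
    unfolding pd_list_Cons_dd using * that by (intro smooth_has_dd[where B = dirs] smooth_pd_list) auto
  then show "test_fun \<phi>" unfolding test_fun_def
    using * smooth_cont[OF smooth_pd_list] by (auto simp: bsupp_compact has_dd_def simp del: pd_list.simps)
qed

section \<open>Mean value estimates and symmetry of mixed derivatives\<close>

lemma segment_bound:
  fixes g :: "real \<Rightarrow> real"
  assumes "\<And>s. \<bar>s\<bar> \<le> \<bar>t\<bar> \<Longrightarrow> (g has_real_derivative g' s) (at s)" "\<And>s. \<bar>s\<bar> \<le> \<bar>t\<bar> \<Longrightarrow> \<bar>g' s\<bar> \<le> c"
  shows "\<bar>g t - g 0\<bar> \<le> c * \<bar>t\<bar>"
proof -
  let ?S = "{-\<bar>t\<bar>..\<bar>t\<bar>}"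
  have "norm (g t - g 0) \<le> c * norm (t - 0)"
  proof (rule field_differentiable_bound[where S = ?S and f' = g'])
    fix s assume "s \<in> ?S"
    then have "\<bar>s\<bar> \<le> \<bar>t\<bar>" by auto
    then show "(g has_field_derivative g' s) (at s within ?S)" "norm (g' s) \<le> c"
      using assms(1)[THEN has_field_derivative_at_within] assms(2) by auto
  qed auto
  then show ?thesis by simp
qed

text \<open>Schwarz's theorem from a single mixed derivative. Two mean value estimates compare the
  second difference of f with k t h(x), up to \<epsilon> |t| |k|; dividing by t, letting t tend to 0
  and then dividing by k produces the other mixed derivative. Its existence is a conclusion, as is
  needed for the time derivative of a space derivative.\<close>

lemma has_dd_commute:
  assumes fe: "has_dd e f fe" and fe': "has_dd e' f fe'" and h: "has_dd e fe' h"
    and c: "continuous_on UNIV h"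
  shows "has_dd e' fe h"
  unfolding has_dd_def DERIV_def
proof
  fix x
  show "(\<lambda>k. (fe (x + (0 + k) *\<^sub>R e') - fe (x + 0 *\<^sub>R e')) / k) \<midarrow>0\<rightarrow> h x"
  proof (rule LIM_I)
    fix r :: real assume r: "r > 0"
    define \<epsilon> where "\<epsilon> = r / 2"
    have \<epsilon>: "\<epsilon> > 0" "\<epsilon> < r" using r by (auto simp: \<epsilon>_def)
    obtain d where d: "d > 0" "\<And>y. dist y x < d \<Longrightarrow> dist (h y) (h x) < \<epsilon>"
      using c \<epsilon> unfolding continuous_on_iff by (metis UNIV_I)
    \<comment> \<open>All points x + s e' + t e with |s|, |t| \<le> m then lie within d/2 of x; the
      summand 1 keeps the denominator positive.\<close>
    define m where "m = d / (2 * (norm e + norm e' + 1))"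
    have n: "norm e + norm e' + 1 > 0" by (smt (verit) norm_ge_zero)
    have m: "m > 0" using d n by (simp add: m_def)
    have close: "\<bar>h (x + s *\<^sub>R e' + t *\<^sub>R e) - h x\<bar> \<le> \<epsilon>" if "\<bar>s\<bar> \<le> m" "\<bar>t\<bar> \<le> m" for s t
    proof -
      have "norm (s *\<^sub>R e' + t *\<^sub>R e) \<le> \<bar>s\<bar> * norm e' + \<bar>t\<bar> * norm e"
        by (metis norm_scaleR norm_triangle_ineq real_norm_def)
      also have "\<dots> \<le> m * norm e' + m * norm e"
        using that by (intro add_mono mult_right_mono) auto
      also have "\<dots> \<le> m * (norm e + norm e' + 1)" using m by (simp add: algebra_simps)
      also have "\<dots> = d / 2" unfolding m_def using n by (simp add: nonzero_divide_eq_eq less_imp_neq)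
      also have "\<dots> < d" using d by simp
      finally have "dist (x + s *\<^sub>R e' + t *\<^sub>R e) x < d" by (simp add: dist_norm add.assoc)
      from d(2)[OF this] show ?thesis by (simp add: dist_real_def)
    qed
    have inner: "\<bar>fe' (x + s *\<^sub>R e' + t *\<^sub>R e) - fe' (x + s *\<^sub>R e') - t * h x\<bar> \<le> \<epsilon> * \<bar>t\<bar>"
      if "\<bar>s\<bar> \<le> m" "\<bar>t\<bar> \<le> m" for s t
    proof -
      have "\<bar>(fe' (x + s *\<^sub>R e' + t *\<^sub>R e) - t * h x) - (fe' (x + s *\<^sub>R e' + 0 *\<^sub>R e) - 0 * h x)\<bar> \<le> \<epsilon> * \<bar>t\<bar>"
        by (rule segment_bound[where g' = "\<lambda>t. h (x + s *\<^sub>R e' + t *\<^sub>R e) - h x"])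
           (use that close in \<open>auto intro!: derivative_eq_intros has_dd_line[OF h]\<close>)
      then show ?thesis by (simp add: algebra_simps)
    qed
    have outer: "\<bar>(f (x + k *\<^sub>R e' + t *\<^sub>R e) - f (x + k *\<^sub>R e')) - (f (x + t *\<^sub>R e) - f x) - k * (t * h x)\<bar> \<le> \<epsilon> * \<bar>t\<bar> * \<bar>k\<bar>"
      if "\<bar>k\<bar> \<le> m" "\<bar>t\<bar> \<le> m" for k t
    proof -
      have "((\<lambda>s. f (x + s *\<^sub>R e' + t *\<^sub>R e)) has_real_derivative fe' (x + s *\<^sub>R e' + t *\<^sub>R e)) (at s)" for s
        using has_dd_line[OF fe', of "x + t *\<^sub>R e" s] by (simp add: algebra_simps)
      then have "\<bar>(f (x + k *\<^sub>R e' + t *\<^sub>R e) - f (x + k *\<^sub>R e') - k * (t * h x)) - (f (x + 0 *\<^sub>R e' + t *\<^sub>R e) - f (x + 0 *\<^sub>R e') - 0 * (t * h x))\<bar> \<le> \<epsilon> * \<bar>t\<bar> * \<bar>k\<bar>"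
        by (intro segment_bound[where g' = "\<lambda>s. fe' (x + s *\<^sub>R e' + t *\<^sub>R e) - fe' (x + s *\<^sub>R e') - t * h x"])
           (use that inner in \<open>auto intro!: derivative_eq_intros has_dd_line[OF fe']\<close>)
      then show ?thesis by (simp add: algebra_simps)
    qed
    have main: "\<bar>fe (x + k *\<^sub>R e') - fe x - k * h x\<bar> \<le> \<epsilon> * \<bar>k\<bar>" if k: "\<bar>k\<bar> \<le> m" for k
    proof -
      have l1: "((\<lambda>t. (f (x + k *\<^sub>R e' + t *\<^sub>R e) - f (x + k *\<^sub>R e')) / t) \<longlongrightarrow> fe (x + k *\<^sub>R e')) (at 0)"
        using fe[unfolded has_dd_def, rule_format, of "x + k *\<^sub>R e'"] by (simp add: DERIV_def)
      have l2: "((\<lambda>t. (f (x + t *\<^sub>R e) - f x) / t) \<longlongrightarrow> fe x) (at 0)"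
        using fe[unfolded has_dd_def, rule_format, of x] by (simp add: DERIV_def)
      have l: "((\<lambda>t. \<bar>(f (x + k *\<^sub>R e' + t *\<^sub>R e) - f (x + k *\<^sub>R e')) / t - (f (x + t *\<^sub>R e) - f x) / t - k * h x\<bar>)
          \<longlongrightarrow> \<bar>fe (x + k *\<^sub>R e') - fe x - k * h x\<bar>) (at 0)"
        by (intro tendsto_intros l1 l2)
      have ev: "eventually (\<lambda>t. \<bar>(f (x + k *\<^sub>R e' + t *\<^sub>R e) - f (x + k *\<^sub>R e')) / t - (f (x + t *\<^sub>R e) - f x) / t - k * h x\<bar> \<le> \<epsilon> * \<bar>k\<bar>) (at 0)"
        unfolding eventually_at
      proof (intro exI[of _ m] conjI ballI impI m)
        fix t :: real assume "t \<noteq> 0 \<and> dist t 0 < m"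
        then have t: "t \<noteq> 0" "\<bar>t\<bar> \<le> m" by auto
        have "(f (x + k *\<^sub>R e' + t *\<^sub>R e) - f (x + k *\<^sub>R e')) / t - (f (x + t *\<^sub>R e) - f x) / t - k * h x
          = ((f (x + k *\<^sub>R e' + t *\<^sub>R e) - f (x + k *\<^sub>R e')) - (f (x + t *\<^sub>R e) - f x) - k * (t * h x)) / t"
          using t by (simp add: field_simps)
        then show "\<bar>(f (x + k *\<^sub>R e' + t *\<^sub>R e) - f (x + k *\<^sub>R e')) / t - (f (x + t *\<^sub>R e) - f x) / t - k * h x\<bar> \<le> \<epsilon> * \<bar>k\<bar>"
          using outer[OF k t(2)] t by (simp add: abs_divide pos_divide_le_eq algebra_simps)
      qed
      show ?thesis by (rule tendsto_upperbound[OF l ev]) simp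
    qed
    show "\<exists>s>0. \<forall>k. k \<noteq> 0 \<and> norm (k - 0) < s \<longrightarrow> norm ((fe (x + (0 + k) *\<^sub>R e') - fe (x + 0 *\<^sub>R e')) / k - h x) < r"
    proof (intro exI[of _ m] conjI allI impI m)
      fix k :: real assume k: "k \<noteq> 0 \<and> norm (k - 0) < m"
      have "\<bar>(fe (x + k *\<^sub>R e') - fe x) / k - h x\<bar> = \<bar>fe (x + k *\<^sub>R e') - fe x - k * h x\<bar> / \<bar>k\<bar>"
        using k by (subst abs_divide[symmetric]) (simp add: field_simps)
      also have "\<dots> \<le> \<epsilon>" using main[of k] k by (simp add: pos_divide_le_eq)
      finally show "norm ((fe (x + (0 + k) *\<^sub>R e') - fe (x + 0 *\<^sub>R e')) / k - h x) < r"
        using \<epsilon> by simp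
    qed
  qed
qed

lemma dd_commute:
  assumes "smooth B f" "e \<in> B" "e' \<in> B"
  shows "dd e (dd e' f) = dd e' (dd e f)"
  using has_dd_commute[OF smooth_has_dd[OF assms(1,2)] smooth_has_dd[OF assms(1,3)]
      smooth_has_dd[OF smooth_dd[OF assms(1,3)] assms(2)]
      smooth_cont[OF smooth_dd[OF smooth_dd[OF assms(1,3)] assms(2)]]]
  by (simp add: has_dd_imp_dd)

section \<open>Square-integrable functions and convolution\<close>

definition cc :: "('a::euclidean_space \<Rightarrow> real) \<Rightarrow> bool" where
  "cc f \<longleftrightarrow> continuous_on UNIV f \<and> bsupp f"

lemma cc_integrable: "cc f \<Longrightarrow> integrable lborel f"
proof -
  assume "cc f"
  then obtain r where c: "continuous_on UNIV f" and r: "\<And>x. norm x > r \<Longrightarrow> f x = 0" by (auto simp: bsupp_def cc_def)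
  have "integrable lborel (\<lambda>x. indicator (cball 0 r) x *\<^sub>R f x)"
    by (rule borel_integrable_compact) (auto intro: continuous_on_subset[OF c])
  also have "(\<lambda>x. indicator (cball 0 r) x *\<^sub>R f x) = f"
    by (force simp: indicator_def r)
  finally show ?thesis .
qed

lemma cc_bounded: "cc f \<Longrightarrow> \<exists>C>0. \<forall>x. \<bar>f x\<bar> \<le> C"
proof -
  assume "cc f"
  then obtain r where c: "continuous_on UNIV f" and r: "\<And>x. norm x > r \<Longrightarrow> f x = 0" by (auto simp: bsupp_def cc_def)
  have "compact (f ` cball 0 r)" by (intro compact_continuous_image continuous_on_subset[OF c]) auto
  then have "bounded (f ` cball 0 r)" by (rule compact_imp_bounded)
  then obtain C where C: "\<And>x. norm x \<le> r \<Longrightarrow> \<bar>f x\<bar> \<le> C"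
    unfolding bounded_iff by (metis image_eqI mem_cball_0 real_norm_def)
  have "\<bar>f x\<bar> \<le> max C 1" for x using C[of x] r[of x] by (cases "norm x \<le> r") auto
  then show ?thesis by (intro exI[of _ "max C 1"]) auto
qed

lemma cc_measurable: "cc f \<Longrightarrow> f \<in> borel_measurable borel"
  by (auto simp: cc_def intro: borel_measurable_continuous_onI)

lemma cc_mult1: "cc f \<Longrightarrow> continuous_on UNIV g \<Longrightarrow> cc (\<lambda>x. f x * g x)"
  and cc_mult2: "continuous_on UNIV f \<Longrightarrow> cc g \<Longrightarrow> cc (\<lambda>x. f x * g x)"
  by (auto simp: cc_def intro: bsupp_mult1 bsupp_mult2 continuous_intros)
lemma cc_mult: "cc f \<Longrightarrow> cc g \<Longrightarrow> cc (\<lambda>x. f x * g x)"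
  by (rule cc_mult1) (auto simp: cc_def)
lemma cc_add: "cc f \<Longrightarrow> cc g \<Longrightarrow> cc (\<lambda>x. f x + g x)"
  by (auto simp: cc_def intro: bsupp_add continuous_intros)
lemma cc_cmult: "cc f \<Longrightarrow> cc (\<lambda>x. c * f x)"
  by (rule cc_mult2) auto
lemma cc_minus: "cc f \<Longrightarrow> cc (\<lambda>x. - f x)"
  using cc_cmult[of f "-1"] by simp
lemma cc_diff: "cc f \<Longrightarrow> cc g \<Longrightarrow> cc (\<lambda>x. f x - g x)"
  using cc_add[OF _ cc_minus] by fastforce
lemma cc_power2: "cc f \<Longrightarrow> cc (\<lambda>x. (f x)\<^sup>2)"
  unfolding power2_eq_square by (intro cc_mult)
lemma cc_smooth: "smooth B f \<Longrightarrow> bsupp f \<Longrightarrow> cc f"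
  by (simp add: cc_def smooth_cont)

lemma lborel_integral_affine:
  fixes f :: "'a::euclidean_space \<Rightarrow> real"
  assumes [measurable]: "f \<in> borel_measurable borel" and c: "c \<noteq> 0"
  shows "(\<integral>x. f x \<partial>lborel) = \<bar>c\<bar> ^ DIM('a) * (\<integral>x. f (t + c *\<^sub>R x) \<partial>lborel)"
proof -
  have "lborel = density (distr lborel borel (\<lambda>x. t + c *\<^sub>R x)) (\<lambda>_::'a. ennreal (\<bar>c\<bar> ^ DIM('a)))"
    using lborel_affine[OF c, of t] by (simp add: ennreal_power)
  then have "(\<integral>x. f x \<partial>lborel) = (\<integral>x. f x \<partial>density (distr lborel borel (\<lambda>x. t + c *\<^sub>R x)) (\<lambda>_. ennreal (\<bar>c\<bar> ^ DIM('a))))"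
    by metis
  also have "\<dots> = \<bar>c\<bar> ^ DIM('a) * (\<integral>x. f (t + c *\<^sub>R x) \<partial>lborel)"
    by (subst integral_density) (simp_all add: integral_distr)
  finally show ?thesis .
qed

lemma lborel_nn_integral_affine:
  fixes f :: "'a::euclidean_space \<Rightarrow> ennreal"
  assumes [measurable]: "f \<in> borel_measurable borel" and c: "c \<noteq> 0"
  shows "(\<integral>\<^sup>+x. f x \<partial>lborel) = \<bar>c\<bar> ^ DIM('a) * (\<integral>\<^sup>+x. f (t + c *\<^sub>R x) \<partial>lborel)"
  by (subst lborel_affine[OF c, of t])
     (simp add: nn_integral_density nn_integral_distr nn_integral_cmult flip: ennreal_power)

lemma lborel_translate:
  fixes f :: "'a::euclidean_space \<Rightarrow> real"
  assumes "f \<in> borel_measurable borel"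
  shows "(\<integral>x. f (x + a) \<partial>lborel) = (\<integral>x. f x \<partial>lborel)"
  using lborel_integral_affine[OF assms, of 1 a] by (simp add: add.commute)

lemma tendsto_at0_seq:
  fixes s :: "nat \<Rightarrow> real"
  assumes "(f \<longlongrightarrow> L) (at 0)" "s \<longlonglongrightarrow> 0" "\<And>n. s n \<noteq> 0"
  shows "(\<lambda>n. f (s n)) \<longlonglongrightarrow> L"
  by (rule filterlim_compose[OF assms(1)]) (simp add: filterlim_at assms)

text \<open>Every difference quotient has integral zero by translation invariance, and the quotients
  converge boundedly on a fixed ball. No coordinates enter, so space and time directions are treated
  alike.\<close>

lemma integral_dd_zero:
  fixes f :: "'a::euclidean_space \<Rightarrow> real"
  assumes f: "cc f" and g: "has_dd e f g" "continuous_on UNIV g"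
  shows "(\<integral>x. g x \<partial>lborel) = 0"
proof -
  obtain r where r: "\<And>x. norm x > r \<Longrightarrow> f x = 0" using f by (auto simp: bsupp_def cc_def)
  have "cc g" using g f bsupp_dd[of f e] by (auto simp: cc_def has_dd_imp_dd)
  then obtain C where C: "C > 0" "\<And>x. \<bar>g x\<bar> \<le> C" using cc_bounded by blast
  have [measurable]: "f \<in> borel_measurable borel" "g \<in> borel_measurable borel"
    using f \<open>cc g\<close> by (auto intro: cc_measurable)
  define s where "s n = 1 / real (Suc n)" for n
  have s: "s n > 0" "s n \<le> 1" "s n \<noteq> 0" for n by (auto simp: s_def)
  have s0: "s \<longlonglongrightarrow> 0" unfolding s_def using LIMSEQ_Suc[OF lim_const_over_n[of "1::real"]] by simp
  define q where "q n x = (f (x + s n *\<^sub>R e) - f x) / s n" for n x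
  have [measurable]: "q n \<in> borel_measurable borel" for n unfolding q_def by measurable
  \<comment> \<open>Contains the supports of f and of its translates by s n e, because s n \<le>
    1.\<close>
  let ?K = "cball (0::'a) (r + norm e)"
  have bound: "\<bar>q n x\<bar> \<le> C * indicator ?K x" for n x
  proof (cases "x \<in> ?K")
    case True
    have "\<bar>f (x + s n *\<^sub>R e) - f (x + 0 *\<^sub>R e)\<bar> \<le> C * \<bar>s n\<bar>"
      by (rule segment_bound[where g' = "\<lambda>t. g (x + t *\<^sub>R e)"]) (auto intro: has_dd_line[OF g(1)] C)
    then show ?thesis using True s[of n] by (simp add: q_def abs_divide pos_divide_le_eq)
  next
    case False
    then have n: "norm x > r + norm e" by auto
    have "norm x \<le> norm (x + s n *\<^sub>R e) + norm (s n *\<^sub>R e)"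
      using norm_triangle_ineq4[of "x + s n *\<^sub>R e" "s n *\<^sub>R e"] by simp
    also have "norm (s n *\<^sub>R e) \<le> norm e" using s[of n] by (simp add: mult_left_le_one_le)
    finally have "norm (x + s n *\<^sub>R e) > r" using n by simp
    moreover have "norm x > r" using n norm_ge_zero[of e] by linarith
    ultimately show ?thesis using False by (simp add: q_def r)
  qed
  have lim: "(\<lambda>n. q n x) \<longlonglongrightarrow> g x" for x
  proof -
    have "((\<lambda>h. (f (x + h *\<^sub>R e) - f x) / h) \<longlongrightarrow> g x) (at 0)"
      using g(1)[unfolded has_dd_def, rule_format, of x] by (simp add: DERIV_def)
    then show ?thesis unfolding q_def by (rule tendsto_at0_seq[OF _ s0 s(3)])
  qed
  have "(\<lambda>n. \<integral>x. q n x \<partial>lborel) \<longlonglongrightarrow> (\<integral>x. g x \<partial>lborel)"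
  proof (rule integral_dominated_convergence[where w = "\<lambda>x. C * indicator ?K x"])
    have "emeasure lborel ?K < \<infinity>" by (rule emeasure_lborel_cball_finite)
    then show "integrable lborel (\<lambda>x. C * indicator ?K x)"
      by (intro integrable_mult_right integrable_real_indicator) auto
  qed (simp_all add: lim bound)
  moreover have "(\<integral>x. q n x \<partial>lborel) = 0" for n
  proof -
    have i: "integrable lborel f" using f by (rule cc_integrable)
    have "integrable lborel (\<lambda>x. f (x + s n *\<^sub>R e))"
    proof -
      have "integrable (distr lborel borel ((+) (s n *\<^sub>R e))) f" using i by (simp add: lborel_distr_plus)
      then show ?thesis by (subst (asm) integrable_distr_eq) (auto simp: add.commute)
    qed
    then show ?thesis unfolding q_def using i lborel_translate[of f "s n *\<^sub>R e"]
      by simp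
  qed
  ultimately show ?thesis by (simp add: LIMSEQ_const_iff)
qed

section \<open>Square-integrable functions of the space variable\<close>

abbreviation nsq :: "(real^3 \<Rightarrow> real) \<Rightarrow> real" where "nsq f \<equiv> (\<integral>x. (f x)\<^sup>2 \<partial>lborel)"

lemma sq_int_mult_integrable: "sq_int f \<Longrightarrow> sq_int g \<Longrightarrow> integrable lborel (\<lambda>x. f x * g x)"
proof -
  assume a: "sq_int f" "sq_int g"
  then have [measurable]: "f \<in> borel_measurable borel" "g \<in> borel_measurable borel" by (auto simp: sq_int_def)
  have "\<bar>a * b\<bar> \<le> a\<^sup>2 + b\<^sup>2" for a b :: real
    using sum_squares_bound[of "\<bar>a\<bar>" "\<bar>b\<bar>"] mult_nonneg_nonneg[of "\<bar>a\<bar>" "\<bar>b\<bar>"]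
    unfolding abs_mult power2_abs by linarith
  then show ?thesis
    by - (rule Bochner_Integration.integrable_bound[of lborel "\<lambda>x. (f x)\<^sup>2 + (g x)\<^sup>2"],
       use a in \<open>auto simp: sq_int_def\<close>)
qed

lemma sq_int_measurable: "sq_int f \<Longrightarrow> f \<in> borel_measurable borel" by (auto simp: sq_int_def)

lemma sq_int_add: "sq_int f \<Longrightarrow> sq_int g \<Longrightarrow> sq_int (\<lambda>x. f x + g x)"
  using sq_int_mult_integrable[of f g] unfolding sq_int_def by (auto simp: power2_sum mult.assoc)
lemma sq_int_cmult: "sq_int f \<Longrightarrow> sq_int (\<lambda>x. c * f x)"
  unfolding sq_int_def by (auto simp: power_mult_distrib)
lemma sq_int_minus: "sq_int f \<Longrightarrow> sq_int (\<lambda>x. - f x)"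
  using sq_int_cmult[of f "-1"] by simp
lemma sq_int_diff: "sq_int f \<Longrightarrow> sq_int g \<Longrightarrow> sq_int (\<lambda>x. f x - g x)"
  using sq_int_add[of f "\<lambda>x. - g x"] sq_int_minus[of g] by simp
lemma sq_int_cc: "cc f \<Longrightarrow> sq_int f"
  unfolding sq_int_def using cc_integrable[OF cc_power2] cc_measurable by auto
lemma sq_int_bdd_mult:
  assumes "sq_int f" "m \<in> borel_measurable borel" "\<And>x. \<bar>m x\<bar> \<le> C"
  shows "sq_int (\<lambda>x. m x * f x)"
  unfolding sq_int_def
proof
  have [measurable]: "f \<in> borel_measurable borel" "m \<in> borel_measurable borel" using assms by (auto simp: sq_int_def)
  show "(\<lambda>x. m x * f x) \<in> borel_measurable lborel" by measurable
  have "(m x * f x)\<^sup>2 \<le> C\<^sup>2 * (f x)\<^sup>2" for x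
    using assms(3)[of x] by (simp add: power_mult_distrib abs_le_square_iff[symmetric] mult_right_mono)
  moreover have "integrable lborel (\<lambda>x. C\<^sup>2 * (f x)\<^sup>2)" using assms(1) by (simp add: sq_int_def)
  ultimately show "integrable lborel (\<lambda>x. (m x * f x)\<^sup>2)"
    by - (rule Bochner_Integration.integrable_bound[of lborel "\<lambda>x. C\<^sup>2 * (f x)\<^sup>2"], simp_all)
qed

lemma nsq_nonneg: "0 \<le> nsq f" by simp

lemma cauchy_schwarz: 
  assumes f: "sq_int f" and g: "sq_int g"
  shows "(\<integral>x. f x * g x \<partial>lborel)\<^sup>2 \<le> nsq f * nsq g"
proof -
  let ?P = "\<integral>x. f x * g x \<partial>lborel"
  note [simp] = sq_int_mult_integrable[OF f g]
  have fi: "integrable lborel (\<lambda>x. (f x)\<^sup>2)" "integrable lborel (\<lambda>x. (g x)\<^sup>2)" using f g by (auto simp: sq_int_def)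
  have *: "0 \<le> c\<^sup>2 * nsq f - 2 * c * s * ?P + s\<^sup>2 * nsq g" for s c
  proof -
    have "0 \<le> (\<integral>x. (c * f x - s * g x)\<^sup>2 \<partial>lborel)" by simp
    also have "(\<lambda>x. (c * f x - s * g x)\<^sup>2) = (\<lambda>x. c\<^sup>2 * (f x)\<^sup>2 - (2 * c * s) * (f x * g x) + s\<^sup>2 * (g x)\<^sup>2)"
      by (auto simp: power2_eq_square algebra_simps)
    also have "(\<integral>x. c\<^sup>2 * (f x)\<^sup>2 - (2 * c * s) * (f x * g x) + s\<^sup>2 * (g x)\<^sup>2 \<partial>lborel)
       = c\<^sup>2 * nsq f - 2 * c * s * ?P + s\<^sup>2 * nsq g"
      using fi by simp
    finally show ?thesis .
  qed
  show ?thesis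
  proof (cases "nsq g = 0")
    case True
    have "?P = 0"
    proof (rule ccontr)
      assume "?P \<noteq> 0"
      \<comment> \<open>For nsq g = 0 the quadratic form is affine in s, and this s gives it the
        value -1.\<close>
      then have "0 \<le> nsq f - 2 * ((nsq f + 1) / (2 * ?P)) * ?P" using *[of 1 "(nsq f + 1) / (2 * ?P)"] True by simp
      then show False using \<open>?P \<noteq> 0\<close> by simp
    qed
    then show ?thesis by simp
  next
    case False
    then have "nsq g > 0" using nsq_nonneg[of g] by linarith
    have "0 \<le> (nsq g)\<^sup>2 * nsq f - 2 * nsq g * ?P * ?P + ?P\<^sup>2 * nsq g" using *[of "nsq g" ?P] by simp
    also have "\<dots> = nsq g * (nsq f * nsq g - ?P\<^sup>2)" by (simp add: power2_eq_square algebra_simps)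
    finally show ?thesis using \<open>nsq g > 0\<close> by (simp add: zero_le_mult_iff)
  qed
qed

lemma cauchy_schwarz_abs:
  assumes f: "sq_int f" and g: "sq_int g"
  shows "\<bar>\<integral>x. f x * g x \<partial>lborel\<bar> \<le> sqrt (nsq f) * sqrt (nsq g)"
  using real_sqrt_le_mono[OF cauchy_schwarz[OF assms]] by (simp add: real_sqrt_mult)

lemma nsq_add_le:
  assumes f: "sq_int f" and g: "sq_int g"
  shows "nsq (\<lambda>x. f x + g x) \<le> 2 * nsq f + 2 * nsq g"
proof -
  have fi: "integrable lborel (\<lambda>x. (f x)\<^sup>2)" "integrable lborel (\<lambda>x. (g x)\<^sup>2)" using f g by (auto simp: sq_int_def)
  have "(a + b)\<^sup>2 \<le> 2 * a\<^sup>2 + 2 * b\<^sup>2" for a b :: real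
    using sum_squares_bound[of a b] by (simp add: power2_sum)
  then have "nsq (\<lambda>x. f x + g x) \<le> (\<integral>x. 2 * (f x)\<^sup>2 + 2 * (g x)\<^sup>2 \<partial>lborel)"
    using sq_int_add[OF assms] fi by (intro integral_mono) (auto simp: sq_int_def)
  then show ?thesis using fi by simp
qed

lemma nsq_diff_le:
  assumes f: "sq_int f" and g: "sq_int g"
  shows "nsq (\<lambda>x. f x - g x) \<le> 2 * nsq f + 2 * nsq g"
  using nsq_add_le[OF f sq_int_minus[OF g]] by simp

lemma nsq_mono: "sq_int g \<Longrightarrow> sq_int f \<Longrightarrow> (\<And>x. \<bar>f x\<bar> \<le> \<bar>g x\<bar>) \<Longrightarrow> nsq f \<le> nsq g"
  by (intro integral_mono) (auto simp: sq_int_def abs_le_square_iff)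

section \<open>Convolution with test functions\<close>

definition conv :: "(real^3 \<Rightarrow> real) \<Rightarrow> (real^3 \<Rightarrow> real) \<Rightarrow> real^3 \<Rightarrow> real" where
  "conv g \<phi> p = (\<integral>q. g q * \<phi> (p - q) \<partial>lborel)"

lemma bsupp_reflect: "bsupp \<phi> \<Longrightarrow> bsupp (\<lambda>q. \<phi> (p - q))"
proof -
  assume "bsupp \<phi>"
  then obtain r where r: "\<And>x. norm x > r \<Longrightarrow> \<phi> x = 0" by (auto simp: bsupp_def)
  have "\<phi> (p - q) = 0" if "norm q > r + norm p" for q
    by (rule r) (use that norm_triangle_ineq2[of q p] in \<open>simp add: norm_minus_commute\<close>)
  then show ?thesis by (auto simp: bsupp_def)
qed

lemma cc_reflect: "cc \<phi> \<Longrightarrow> cc (\<lambda>q. \<phi> (p - q))"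
  unfolding cc_def
  by (auto intro!: bsupp_reflect continuous_on_compose2[of UNIV \<phi>] continuous_intros)

lemma has_dd_reflect:
  assumes "has_dd e f g" shows "has_dd e (\<lambda>q. f (p - q)) (\<lambda>q. - g (p - q))"
  unfolding has_dd_def
proof
  fix q
  have "((\<lambda>s. f ((p - q) + s *\<^sub>R e)) has_real_derivative g (p - q)) (at (- 0))"
    using assms by (simp add: has_dd_def)
  moreover have "(uminus has_real_derivative -1) (at (0::real))"
    by (auto intro!: derivative_eq_intros)
  ultimately have "((\<lambda>s. f ((p - q) + (- s) *\<^sub>R e)) has_real_derivative g (p - q) * - 1) (at 0)"
    using DERIV_chain2[where f = "\<lambda>s. f ((p - q) + s *\<^sub>R e)" and g = uminus and x = 0] by blast
  then show "((\<lambda>s. f (p - (q + s *\<^sub>R e))) has_real_derivative - g (p - q)) (at 0)"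
    by (simp add: algebra_simps DERIV_minus)
qed

lemma smooth_reflect: "smooth B f \<Longrightarrow> smooth B (\<lambda>q. f (p - q))"
proof -
  assume f: "smooth B f"
  have "continuous_on UNIV (\<lambda>q. f (p - q))" if "smooth B f" for f :: "'a \<Rightarrow> real"
    using smooth_cont[OF that] by (auto intro!: continuous_on_compose2[of UNIV f] continuous_intros)
  note c = this
  show ?thesis
  proof (rule smooth_coinduct[where Q = "\<lambda>h. \<exists>f. smooth B f \<and> h = (\<lambda>q. f (p - q))"])
    fix h assume "\<exists>f. smooth B f \<and> h = (\<lambda>q. f (p - q))"
    then obtain f where f: "smooth B f" "h = (\<lambda>q. f (p - q))" by blast
    have "has_dd e h (\<lambda>q. (\<lambda>x. - dd e f x) (p - q)) \<and> smooth B (\<lambda>x. - dd e f x)" if "e \<in> B" for e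
      using f that by (auto intro: has_dd_reflect smooth_has_dd smooth_minus smooth_dd)
    then show "continuous_on UNIV h \<and> (\<forall>e\<in>B. \<exists>g. has_dd e h g \<and> (\<exists>f. smooth B f \<and> g = (\<lambda>q. f (p - q))))"
      using c f by blast
  qed (use f in auto)
qed

lemma test_fun_cc: "test_fun \<phi> \<Longrightarrow> cc \<phi>"
  using cc_smooth[of dirs] by (simp add: test_fun_iff)

lemma test_fun_dd: "test_fun \<phi> \<Longrightarrow> e \<in> dirs \<Longrightarrow> test_fun (dd e \<phi>)"
  by (simp add: test_fun_iff smooth_dd bsupp_dd)

lemma test_fun_pd: "test_fun \<phi> \<Longrightarrow> set es \<subseteq> dirs \<Longrightarrow> test_fun (pd_list es \<phi>)"
  by (induction es) (auto simp: pd_list_Cons_dd simp del: pd_list.simps(2) intro: test_fun_dd)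

lemma test_fun_reflect: "test_fun \<phi> \<Longrightarrow> test_fun (\<lambda>q. \<phi> (p - q))"
  by (simp add: test_fun_iff smooth_reflect bsupp_reflect)

lemma pd_list_reflect:
  "smooth dirs \<phi> \<Longrightarrow> set es \<subseteq> dirs \<Longrightarrow> pd_list es (\<lambda>q. \<phi> (p - q)) = (\<lambda>q. (-1) ^ length es * pd_list es \<phi> (p - q))"
proof (induction es)
  case (Cons e es)
  have "has_dd e (\<lambda>q. (-1) ^ length es * pd_list es \<phi> (p - q)) (\<lambda>q. (-1) ^ length es * - dd e (pd_list es \<phi>) (p - q))"
    using Cons.prems by (intro has_dd_cmult has_dd_reflect smooth_has_dd[where B = dirs] smooth_pd_list) auto
  then show ?case using Cons by (simp add: pd_list_Cons_dd has_dd_imp_dd del: pd_list.simps(2))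
qed simp

text \<open>Take q \<mapsto> \<phi>(p - q) as test function: the sign from differentiating the
  reflection cancels the sign in \<open>weak_deriv\<close>. Hence mollification commutes with weak
  derivatives.\<close>

lemma conv_weak_deriv:
  assumes "weak_deriv es f g" "test_fun \<phi>" "set es \<subseteq> dirs"
  shows "conv f (pd_list es \<phi>) = conv g \<phi>"
proof
  fix p
  have "(\<integral>q. f q * pd_list es (\<lambda>q. \<phi> (p - q)) q \<partial>lborel) = (-1) ^ length es * (\<integral>q. g q * \<phi> (p - q) \<partial>lborel)"
    using assms test_fun_reflect unfolding weak_deriv_def by blast
  moreover have "pd_list es (\<lambda>q. \<phi> (p - q)) = (\<lambda>q. (-1) ^ length es * pd_list es \<phi> (p - q))"
    using assms by (intro pd_list_reflect) (auto simp: test_fun_iff)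
  moreover have "(\<integral>q. f q * ((-1) ^ length es * pd_list es \<phi> (p - q)) \<partial>lborel)
     = (-1) ^ length es * (\<integral>q. f q * pd_list es \<phi> (p - q) \<partial>lborel)"
    by (subst integral_mult_right_zero[symmetric]) (simp add: mult.left_commute)
  ultimately have "(-1) ^ length es * conv f (pd_list es \<phi>) p = (-1) ^ length es * conv g \<phi> p"
    by (simp add: conv_def)
  then show "conv f (pd_list es \<phi>) p = conv g \<phi> p" by simp
qed

lemma conv_integrable: "sq_int g \<Longrightarrow> cc \<phi> \<Longrightarrow> integrable lborel (\<lambda>q. g q * \<phi> (p - q))"
  by (rule sq_int_mult_integrable[OF _ sq_int_cc[OF cc_reflect]])

lemma nsq_reflect: "cc \<phi> \<Longrightarrow> nsq (\<lambda>q. \<phi> (p - q)) = nsq \<phi>"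
proof -
  assume "cc \<phi>"
  then have [measurable]: "\<phi> \<in> borel_measurable borel" by (rule cc_measurable)
  have "nsq \<phi> = (\<integral>q. (\<phi> (p + (-1) *\<^sub>R q))\<^sup>2 \<partial>lborel)"
    using lborel_integral_affine[of "\<lambda>x. (\<phi> x)\<^sup>2" "-1" p] by simp
  then show ?thesis by simp
qed

lemma conv_bound: "sq_int g \<Longrightarrow> cc \<phi> \<Longrightarrow> \<bar>conv g \<phi> p\<bar> \<le> sqrt (nsq g) * sqrt (nsq \<phi>)"
  using cauchy_schwarz_abs[of g "\<lambda>q. \<phi> (p - q)"] nsq_reflect[of \<phi> p] cc_reflect[of \<phi> p]
  by (simp add: conv_def sq_int_cc)

lemma conv_diff_left: "sq_int f \<Longrightarrow> sq_int g \<Longrightarrow> cc \<phi> \<Longrightarrow> conv (\<lambda>x. f x - g x) \<phi> p = conv f \<phi> p - conv g \<phi> p"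
  using conv_integrable[of f \<phi> p] conv_integrable[of g \<phi> p] by (simp add: conv_def algebra_simps)
lemma conv_add_left: "sq_int f \<Longrightarrow> sq_int g \<Longrightarrow> cc \<phi> \<Longrightarrow> conv (\<lambda>x. f x + g x) \<phi> p = conv f \<phi> p + conv g \<phi> p"
  using conv_integrable[of f \<phi> p] conv_integrable[of g \<phi> p] by (simp add: conv_def algebra_simps)
lemma conv_diff_right: "sq_int f \<Longrightarrow> cc \<phi> \<Longrightarrow> cc \<psi> \<Longrightarrow> conv f (\<lambda>x. \<phi> x - \<psi> x) p = conv f \<phi> p - conv f \<psi> p"
  using conv_integrable[of f \<phi> p] conv_integrable[of f \<psi> p] by (simp add: conv_def algebra_simps)
lemma conv_add_right: "sq_int f \<Longrightarrow> cc \<phi> \<Longrightarrow> cc \<psi> \<Longrightarrow> conv f (\<lambda>x. \<phi> x + \<psi> x) p = conv f \<phi> p + conv f \<psi> p"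
  using conv_integrable[of f \<phi> p] conv_integrable[of f \<psi> p] by (simp add: conv_def algebra_simps)
lemma conv_cmult_left: "conv (\<lambda>x. c * f x) \<phi> p = c * conv f \<phi> p"
  by (simp add: conv_def mult.assoc)

text \<open>Continuity of translations in L^2, for the kernel: dominated convergence on a ball that
  contains all the shifted supports.\<close>

lemma nsq_translate_continuous:
  fixes \<phi> :: "real^3 \<Rightarrow> real" and h :: "nat \<Rightarrow> real^3" and p :: "real^3"
  assumes "cc \<phi>" and h: "h \<longlonglongrightarrow> p"
  shows "(\<lambda>n. nsq (\<lambda>q. \<phi> (h n - q) - \<phi> (p - q))) \<longlonglongrightarrow> 0"
proof -
  have c: "continuous_on UNIV \<phi>" using assms by (simp add: cc_def)
  obtain r where r: "\<And>x. norm x > r \<Longrightarrow> \<phi> x = 0" using assms by (auto simp: bsupp_def cc_def)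
  obtain C where C: "C > 0" "\<And>x. \<bar>\<phi> x\<bar> \<le> C" using cc_bounded[OF assms(1)] by blast
  obtain b where b: "\<And>n. norm (h n) \<le> b" "b \<ge> norm p"
  proof -
    obtain b where "\<And>n. norm (h n) \<le> b" using h convergent_imp_Bseq[of h] by (auto simp: convergent_def Bseq_def)
    then show ?thesis using that[of "max b (norm p)"] by (simp add: le_max_iff_disj)
  qed
  have [measurable]: "\<phi> \<in> borel_measurable borel" using assms(1) by (rule cc_measurable)
  let ?K = "cball (0::real^3) (r + b)"
  have "(\<lambda>n. \<integral>q. (\<phi> (h n - q) - \<phi> (p - q))\<^sup>2 \<partial>lborel) \<longlonglongrightarrow> integral\<^sup>L (lborel :: (real^3) measure) (\<lambda>q. 0 :: real)"
  proof (rule integral_dominated_convergence[where w = "\<lambda>q. (2 * C)\<^sup>2 * indicator ?K q"])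
    have "emeasure lborel ?K < \<infinity>" by (rule emeasure_lborel_cball_finite)
    then show "integrable lborel (\<lambda>q. (2 * C)\<^sup>2 * indicator ?K q)"
      by (intro integrable_mult_right integrable_real_indicator) auto
    show "AE q in lborel. (\<lambda>n. (\<phi> (h n - q) - \<phi> (p - q))\<^sup>2) \<longlonglongrightarrow> 0"
    proof (rule AE_I2)
      fix q
      have "isCont \<phi> (p - q)" using c by (simp add: continuous_on_eq_continuous_at)
      moreover have "(\<lambda>n. h n - q) \<longlonglongrightarrow> p - q" by (intro tendsto_intros h)
      ultimately have "(\<lambda>n. \<phi> (h n - q)) \<longlonglongrightarrow> \<phi> (p - q)" by (rule isCont_tendsto_compose)
      then have "(\<lambda>n. (\<phi> (h n - q) - \<phi> (p - q))\<^sup>2) \<longlonglongrightarrow> (\<phi> (p - q) - \<phi> (p - q))\<^sup>2" by (intro tendsto_intros)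
      then show "(\<lambda>n. (\<phi> (h n - q) - \<phi> (p - q))\<^sup>2) \<longlonglongrightarrow> 0" by simp
    qed
    fix n show "AE q in lborel. norm ((\<phi> (h n - q) - \<phi> (p - q))\<^sup>2) \<le> (2 * C)\<^sup>2 * indicator ?K q"
    proof (rule AE_I2)
      fix q
      show "norm ((\<phi> (h n - q) - \<phi> (p - q))\<^sup>2) \<le> (2 * C)\<^sup>2 * indicator ?K q"
      proof (cases "q \<in> ?K")
        case True
        have "\<bar>\<phi> (h n - q) - \<phi> (p - q)\<bar> \<le> 2 * C" using C(2)[of "h n - q"] C(2)[of "p - q"] by linarith
        then have "(\<phi> (h n - q) - \<phi> (p - q))\<^sup>2 \<le> (2 * C)\<^sup>2"
          using C by (intro abs_le_square_iff[THEN iffD1]) simp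
        then show ?thesis using True by simp
      next
        case False
        then have n: "norm q > r + b" by auto
        have "norm (h n - q) > r"
          using n b(1)[of n] norm_triangle_ineq2[of q "h n"] norm_minus_commute[of q "h n"] by linarith
        moreover have "norm (p - q) > r"
          using n b(2) norm_triangle_ineq2[of q p] norm_minus_commute[of q p] by linarith
        ultimately have "norm (h n - q) > r" "norm (p - q) > r" by auto
        then show ?thesis using False r by simp
      qed
    qed
  qed auto
  then show ?thesis by simp
qed

text \<open>The derivative falls on the kernel only. Its difference quotients are at most C on a
  fixed ball K, and |g| C 1_K is an integrable majorant because g is square integrable.\<close>

lemma conv_has_dd:
  assumes g: "sq_int g" and t: "test_fun \<phi>" and e: "e \<in> dirs"
  shows "has_dd e (conv g \<phi>) (conv g (dd e \<phi>))"
  unfolding has_dd_def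
proof
  fix p :: "real^3"
  have h: "has_dd e \<phi> (dd e \<phi>)" using t e by (auto simp: test_fun_iff intro: smooth_has_dd)
  have cc: "cc \<phi>" "cc (dd e \<phi>)" using t e test_fun_dd test_fun_cc by blast+
  have m[measurable]: "\<phi> \<in> borel_measurable borel" "dd e \<phi> \<in> borel_measurable borel" "g \<in> borel_measurable borel"
    using cc g by (auto intro: cc_measurable sq_int_measurable)
  obtain r where r: "\<And>x. norm x > r \<Longrightarrow> \<phi> x = 0" using cc by (auto simp: bsupp_def cc_def)
  obtain C where C: "C > 0" "\<And>x. \<bar>dd e \<phi> x\<bar> \<le> C" using cc_bounded[OF cc(2)] by blast
  let ?K = "cball p (r + norm e)"
  have bound: "\<bar>(\<phi> (p - q + s *\<^sub>R e) - \<phi> (p - q)) / s\<bar> \<le> C * indicator ?K q" if s: "\<bar>s\<bar> \<le> 1" "s \<noteq> 0" for s q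
  proof (cases "q \<in> ?K")
    case True
    have "\<bar>\<phi> (p - q + s *\<^sub>R e) - \<phi> (p - q + 0 *\<^sub>R e)\<bar> \<le> C * \<bar>s\<bar>"
      by (rule segment_bound[where g' = "\<lambda>t. dd e \<phi> (p - q + t *\<^sub>R e)"]) (auto intro: has_dd_line[OF h] C)
    then show ?thesis using True s by (simp add: abs_divide pos_divide_le_eq)
  next
    case False
    then have n: "norm (p - q) > r + norm e" by (auto simp: dist_norm)
    have "norm (p - q) \<le> norm (p - q + s *\<^sub>R e) + norm (s *\<^sub>R e)"
      using norm_triangle_ineq4[of "p - q + s *\<^sub>R e" "s *\<^sub>R e"] by simp
    also have "norm (s *\<^sub>R e) \<le> norm e" using s by (simp add: mult_left_le_one_le)
    finally have "norm (p - q + s *\<^sub>R e) > r" using n by simp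
    moreover have "norm (p - q) > r" using n norm_ge_zero[of e] by linarith
    ultimately show ?thesis using False by (simp add: r)
  qed
  have sqK: "sq_int (\<lambda>q. C * indicator ?K q)"
  proof (rule sq_int_cmult)
    have "emeasure lborel ?K < \<infinity>" by (rule emeasure_lborel_cball_finite)
    then show "sq_int (indicator ?K)" unfolding sq_int_def
      by (auto simp: power2_eq_square indicator_inter_arith[symmetric] intro!: integrable_real_indicator borel_measurable_indicator)
  qed
  have "((\<lambda>s. (conv g \<phi> (p + s *\<^sub>R e) - conv g \<phi> p) / s) \<longlongrightarrow> conv g (dd e \<phi>) p) (at 0)"
    unfolding tendsto_at_iff_sequentially
  proof (intro allI impI, unfold o_def)
    fix X :: "nat \<Rightarrow> real" assume X: "\<forall>i. X i \<in> UNIV - {0}" "X \<longlonglongrightarrow> 0"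
    obtain N where N: "\<And>n. n \<ge> N \<Longrightarrow> \<bar>X n\<bar> \<le> 1"
      using X(2) by (metis LIMSEQ_def dist_0_norm dist_commute less_eq_real_def real_norm_def zero_less_one)
    \<comment> \<open>Dropping the first N terms makes every increment at most 1 in absolute value,
      as \<open>bound\<close> requires.\<close>
    define s where "s n = X (n + N)" for n
    have s: "s \<longlonglongrightarrow> 0" "\<And>n. s n \<noteq> 0" "\<And>n. \<bar>s n\<bar> \<le> 1"
      using X N LIMSEQ_ignore_initial_segment[OF X(2), of N] by (auto simp: s_def[abs_def])
    have "(\<lambda>n. \<integral>q. g q * ((\<phi> (p - q + s n *\<^sub>R e) - \<phi> (p - q)) / s n) \<partial>lborel) \<longlonglongrightarrow> (\<integral>q. g q * dd e \<phi> (p - q) \<partial>lborel)"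
    proof (rule integral_dominated_convergence[where w = "\<lambda>q. \<bar>g q * (C * indicator ?K q)\<bar>"])
      show "integrable lborel (\<lambda>q. \<bar>g q * (C * indicator ?K q)\<bar>)"
        by (intro integrable_abs sq_int_mult_integrable g sqK)
      show "AE q in lborel. (\<lambda>n. g q * ((\<phi> (p - q + s n *\<^sub>R e) - \<phi> (p - q)) / s n)) \<longlonglongrightarrow> g q * dd e \<phi> (p - q)"
      proof (intro AE_I2 tendsto_mult tendsto_const)
        fix q
        have "((\<lambda>h. (\<phi> (p - q + h *\<^sub>R e) - \<phi> (p - q)) / h) \<longlongrightarrow> dd e \<phi> (p - q)) (at 0)"
          using h[unfolded has_dd_def, rule_format, of "p - q"] by (simp add: DERIV_def)
        then show "(\<lambda>n. (\<phi> (p - q + s n *\<^sub>R e) - \<phi> (p - q)) / s n) \<longlonglongrightarrow> dd e \<phi> (p - q)"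
          by (rule tendsto_at0_seq[OF _ s(1,2)])
      qed
      fix n show "AE q in lborel. norm (g q * ((\<phi> (p - q + s n *\<^sub>R e) - \<phi> (p - q)) / s n)) \<le> \<bar>g q * (C * indicator ?K q)\<bar>"
      proof (rule AE_I2)
        fix q
        have "\<bar>(\<phi> (p - q + s n *\<^sub>R e) - \<phi> (p - q)) / s n\<bar> \<le> \<bar>C * indicator ?K q\<bar>"
          using bound[OF s(3,2), of q n] by linarith
        then show "norm (g q * ((\<phi> (p - q + s n *\<^sub>R e) - \<phi> (p - q)) / s n)) \<le> \<bar>g q * (C * indicator ?K q)\<bar>"
          unfolding real_norm_def abs_mult[of "g q"] by (rule mult_left_mono) simp
      qed
    qed (auto intro!: borel_measurable_times borel_measurable_divide borel_measurable_diff measurable_compose[OF _ m(1)] measurable_compose[OF _ m(2)])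
    also have "(\<lambda>n. \<integral>q. g q * ((\<phi> (p - q + s n *\<^sub>R e) - \<phi> (p - q)) / s n) \<partial>lborel)
       = (\<lambda>n. (conv g \<phi> (p + s n *\<^sub>R e) - conv g \<phi> p) / s n)"
    proof
      fix n
      have "(\<integral>q. g q * ((\<phi> (p - q + s n *\<^sub>R e) - \<phi> (p - q)) / s n) \<partial>lborel)
        = (\<integral>q. (g q * \<phi> (p + s n *\<^sub>R e - q) - g q * \<phi> (p - q)) / s n \<partial>lborel)"
        by (rule Bochner_Integration.integral_cong) (auto simp: algebra_simps diff_divide_distrib)
      then show "(\<integral>q. g q * ((\<phi> (p - q + s n *\<^sub>R e) - \<phi> (p - q)) / s n) \<partial>lborel) = (conv g \<phi> (p + s n *\<^sub>R e) - conv g \<phi> p) / s n"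
        using conv_integrable[OF g cc(1), of p] conv_integrable[OF g cc(1), of "p + s n *\<^sub>R e"] by (simp add: conv_def)
    qed
    finally have "(\<lambda>n. (conv g \<phi> (p + X (n + N) *\<^sub>R e) - conv g \<phi> p) / X (n + N)) \<longlonglongrightarrow> conv g (dd e \<phi>) p"
      by (simp add: conv_def s_def)
    then show "(\<lambda>n. (conv g \<phi> (p + X n *\<^sub>R e) - conv g \<phi> p) / X n) \<longlonglongrightarrow> conv g (dd e \<phi>) p"
      by (rule LIMSEQ_offset)
  qed
  then show "((\<lambda>s. conv g \<phi> (p + s *\<^sub>R e)) has_real_derivative conv g (dd e \<phi>) p) (at 0)"
    by (simp add: DERIV_def)
qed

section \<open>Convolution in space of time-dependent functions\<close>

definition sdirs :: "(real \<times> (real^3)) set" where "sdirs = Pair 0 ` dirs"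

text \<open>Square integrability is included because the integral of a nonintegrable square is 0 by
  convention, so a small \<open>nsq\<close> alone would not mean closeness.\<close>

definition l2_cont_UNIV :: "(real \<Rightarrow> real^3 \<Rightarrow> real) \<Rightarrow> bool" where
  "l2_cont_UNIV F \<longleftrightarrow> (\<forall>t. sq_int (F t)) \<and> (\<forall>t. ((\<lambda>s. nsq (\<lambda>x. F s x - F t x)) \<longlongrightarrow> 0) (at t))"

definition tconv :: "(real \<Rightarrow> real^3 \<Rightarrow> real) \<Rightarrow> (real^3 \<Rightarrow> real) \<Rightarrow> real \<times> (real^3) \<Rightarrow> real" where
  "tconv F \<phi> z = conv (F (fst z)) \<phi> (snd z)"

text \<open>The increment splits into a change of time with the point fixed and a change of point
  with the time fixed. Cauchy-Schwarz bounds the first by the L^2 continuity of F and the second by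
  the L^2 continuity of translations of \<phi>.\<close>

lemma tconv_continuous:
  assumes F: "l2_cont_UNIV F" and c: "cc \<phi>"
  shows "continuous_on UNIV (tconv F \<phi>)"
  unfolding continuous_on_sequentially
proof (intro allI impI ballI, elim conjE, unfold o_def)
  fix X a assume X: "X \<longlonglongrightarrow> (a::real \<times> (real^3))"
  obtain t p where a: "a = (t, p)" by (cases a)
  have T: "(\<lambda>n. fst (X n)) \<longlonglongrightarrow> t" and P: "(\<lambda>n. snd (X n)) \<longlonglongrightarrow> p"
    using tendsto_fst[OF X] tendsto_snd[OF X] a by auto
  have sq: "sq_int (F t)" for t using F by (simp add: l2_cont_UNIV_def)
  have "((\<lambda>s. nsq (\<lambda>x. F s x - F t x)) \<longlongrightarrow> nsq (\<lambda>x. F t x - F t x)) (at t)"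
    using F by (simp add: l2_cont_UNIV_def)
  then have "isCont (\<lambda>s. nsq (\<lambda>x. F s x - F t x)) t" by (simp add: isCont_def)
  from isCont_tendsto_compose[OF this T]
  have l1: "(\<lambda>n. nsq (\<lambda>x. F (fst (X n)) x - F t x)) \<longlonglongrightarrow> 0" by simp
  have l2: "(\<lambda>n. nsq (\<lambda>q. \<phi> (snd (X n) - q) - \<phi> (p - q))) \<longlonglongrightarrow> 0"
    by (rule nsq_translate_continuous[OF c P])
  have "(\<lambda>n. sqrt (nsq (\<lambda>x. F (fst (X n)) x - F t x)) * sqrt (nsq \<phi>)
        + sqrt (nsq (F t)) * sqrt (nsq (\<lambda>q. \<phi> (snd (X n) - q) - \<phi> (p - q)))) \<longlonglongrightarrow> sqrt 0 * sqrt (nsq \<phi>) + sqrt (nsq (F t)) * sqrt 0"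
    by (intro tendsto_intros l1 l2)
  then have lim: "(\<lambda>n. sqrt (nsq (\<lambda>x. F (fst (X n)) x - F t x)) * sqrt (nsq \<phi>)
        + sqrt (nsq (F t)) * sqrt (nsq (\<lambda>q. \<phi> (snd (X n) - q) - \<phi> (p - q)))) \<longlonglongrightarrow> 0" by simp
  have "(\<lambda>n. tconv F \<phi> (X n) - tconv F \<phi> a) \<longlonglongrightarrow> 0"
  proof (rule Lim_null_comparison[OF _ lim], rule always_eventually, rule allI)
    fix n
    let ?s = "fst (X n)" and ?p = "snd (X n)"
    have "tconv F \<phi> (X n) - tconv F \<phi> a = conv (\<lambda>x. F ?s x - F t x) \<phi> ?p + (conv (F t) \<phi> ?p - conv (F t) \<phi> p)"
      using conv_diff_left[OF sq sq c] by (simp add: tconv_def a)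
    moreover have "\<bar>conv (\<lambda>x. F ?s x - F t x) \<phi> ?p\<bar> \<le> sqrt (nsq (\<lambda>x. F ?s x - F t x)) * sqrt (nsq \<phi>)"
      by (intro conv_bound sq_int_diff sq c)
    moreover have "conv (F t) \<phi> ?p - conv (F t) \<phi> p = (\<integral>q. F t q * (\<phi> (?p - q) - \<phi> (p - q)) \<partial>lborel)"
      using conv_integrable[OF sq c, of t ?p] conv_integrable[OF sq c, of t p] by (simp add: conv_def algebra_simps)
    moreover have "\<bar>\<integral>q. F t q * (\<phi> (?p - q) - \<phi> (p - q)) \<partial>lborel\<bar> \<le> sqrt (nsq (F t)) * sqrt (nsq (\<lambda>q. \<phi> (?p - q) - \<phi> (p - q)))"
      by (intro cauchy_schwarz_abs sq sq_int_cc cc_diff cc_reflect c)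
    ultimately show "norm (tconv F \<phi> (X n) - tconv F \<phi> a) \<le> sqrt (nsq (\<lambda>x. F ?s x - F t x)) * sqrt (nsq \<phi>)
        + sqrt (nsq (F t)) * sqrt (nsq (\<lambda>q. \<phi> (?p - q) - \<phi> (p - q)))"
      by simp
  qed
  then show "(\<lambda>n. tconv F \<phi> (X n)) \<longlonglongrightarrow> tconv F \<phi> a"
    by (rule LIM_zero_cancel)
qed

lemma tconv_has_dd:
  assumes F: "l2_cont_UNIV F" and t: "test_fun \<phi>" and e: "e \<in> dirs"
  shows "has_dd (0, e) (tconv F \<phi>) (tconv F (dd e \<phi>))"
  using conv_has_dd[OF _ t e] F unfolding has_dd_def tconv_def l2_cont_UNIV_def by auto

text \<open>Space derivatives of \<open>tconv F \<phi>\<close> are again of this form, with a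
  differentiated kernel, and therefore jointly continuous. L^2 continuity in time is all that F has
  to provide.\<close>

lemma tconv_smooth:
  assumes F: "l2_cont_UNIV F" and t: "test_fun \<phi>"
  shows "smooth sdirs (tconv F \<phi>)"
  by (rule smooth_coinduct[where Q = "\<lambda>h. \<exists>\<phi>. test_fun \<phi> \<and> h = tconv F \<phi>"])
     (use t in \<open>auto simp: sdirs_def intro!: tconv_continuous F test_fun_cc intro: tconv_has_dd[OF F] test_fun_dd\<close>)

section \<open>The Carleman identity\<close>

type_synonym st = "real \<times> (real^3)"

abbreviation dT :: "(st \<Rightarrow> real) \<Rightarrow> st \<Rightarrow> real" where "dT \<equiv> dd (1, 0)"
abbreviation dX :: "(st \<Rightarrow> real) \<Rightarrow> st \<Rightarrow> real" where "dX \<equiv> dd (0, ex)"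
abbreviation dY :: "(st \<Rightarrow> real) \<Rightarrow> st \<Rightarrow> real" where "dY \<equiv> dd (0, ey)"
abbreviation dZ :: "(st \<Rightarrow> real) \<Rightarrow> st \<Rightarrow> real" where "dZ \<equiv> dd (0, ez)"
abbreviation IT :: "(st \<Rightarrow> real) \<Rightarrow> real" where "IT f \<equiv> (\<integral>z. f z \<partial>lborel)"

definition adirs :: "st set" where "adirs = insert (1, 0) sdirs"

lemma sdirs_in [simp]: "(0, ex) \<in> sdirs" "(0, ey) \<in> sdirs" "(0, ez) \<in> sdirs"
  by (auto simp: sdirs_def dirs_def)
lemma adirs_in [simp]: "(0, ex) \<in> adirs" "(0, ey) \<in> adirs" "(0, ez) \<in> adirs" "(1, 0) \<in> adirs"
  by (auto simp: adirs_def)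
lemma sdirs_adirs: "sdirs \<subseteq> adirs" by (auto simp: adirs_def)

lemma smooth_divide_const: "smooth B f \<Longrightarrow> smooth B (\<lambda>x. f x / c)"
  using smooth_mult[OF _ smooth_const[of _ "inverse c"]] by (simp add: divide_inverse)

lemmas smooth_s_rules = smooth_const smooth_add smooth_diff smooth_minus smooth_mult smooth_power smooth_divide_const

lemma IT_dd_zero: "smooth sdirs f \<Longrightarrow> bsupp f \<Longrightarrow> e \<in> sdirs \<Longrightarrow> IT (dd e f) = 0"
  by (rule integral_dd_zero[of f e]) (auto intro: cc_smooth smooth_has_dd smooth_cont smooth_dd)

text \<open>The regularity of a cut-off solution that is mollified in space only: all space
  derivatives, and one time derivative which again has all space derivatives.\<close>

definition good :: "(st \<Rightarrow> real) \<Rightarrow> bool" where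
  "good f \<longleftrightarrow> smooth sdirs f \<and> bsupp f \<and> has_dd (1, 0) f (dT f) \<and> smooth sdirs (dT f)"

lemma good_dd:
  assumes f: "good f" and e: "e \<in> sdirs"
  shows "good (dd e f)" "dT (dd e f) = dd e (dT f)"
proof -
  have h: "has_dd (1, 0) (dd e f) (dd e (dT f))"
    by (rule has_dd_commute[where fe' = "dT f" and f = f])
       (use assms in \<open>auto simp: good_def intro: smooth_has_dd smooth_dd smooth_cont\<close>)
  then show "dT (dd e f) = dd e (dT f)" by (rule has_dd_imp_dd)
  then show "good (dd e f)" using h f e by (auto simp: good_def intro: smooth_dd bsupp_dd)
qed

lemma dd_power2: "smooth B f \<Longrightarrow> e \<in> B \<Longrightarrow> dd e (\<lambda>x. (f x)\<^sup>2) = (\<lambda>x. 2 * f x * dd e f x)"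
  by (intro has_dd_imp_dd has_dd_sq smooth_has_dd)

lemma dd_divide_const: "smooth B f \<Longrightarrow> e \<in> B \<Longrightarrow> dd e (\<lambda>x. f x / c) = (\<lambda>x. dd e f x / c)"
  using dd_cmult[of B f e "inverse c"] by (simp add: divide_inverse mult.commute)

lemma dd_minus: "smooth B f \<Longrightarrow> e \<in> B \<Longrightarrow> dd e (\<lambda>x. - f x) = (\<lambda>x. - dd e f x)"
  using dd_cmult[of B f e "- 1"] by simp

lemmas dd_rules = dd_add dd_diff dd_minus dd_mult dd_power2 dd_divide_const

text \<open>Abstracts a weight exp \<psi> whose exponent depends on x and t and is quadratic in x: a
  = \<psi>_x, b = \<psi>_t, \<kappa> = \<psi>_xx, \<tau> = \<psi>_xt and \<beta> = \<psi>_tt. The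
  identities below see the weight only through these relations.\<close>

locale carleman_coeffs =
  fixes \<kappa> :: real and a b \<tau> \<beta> :: "st \<Rightarrow> real"
  assumes smooth_a: "smooth adirs a" and smooth_b: "smooth adirs b" and smooth_\<tau>: "smooth adirs \<tau>"
    and dTa: "dT a = \<tau>" and dTb: "dT b = \<beta>"
    and dXa: "dX a = (\<lambda>_. \<kappa>)" and dYa: "dY a = (\<lambda>_. 0)" and dZa: "dZ a = (\<lambda>_. 0)"
    and dXb: "dX b = \<tau>" and dYb: "dY b = (\<lambda>_. 0)" and dZb: "dZ b = (\<lambda>_. 0)"
    and dX\<tau>: "dX \<tau> = (\<lambda>_. 0)"
begin

text \<open>Conjugation replaces d_x by d_x - a and d_t by d_t - b; expanding (d_x - a)^3 and (d_x -
  a)(d_y^2 + d_z^2) and sorting by parity gives \<open>opA\<close> and \<open>opS\<close>. The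
  lower-order terms make the parity exact: 3 \<kappa> a is half of d_x(3 a^2), so 3 a^2 d_x + 3
  \<kappa> a is antisymmetric, and -3 a d_x^2 - 3 \<kappa> d_x = -3 d_x(a d_x) is symmetric.\<close>

definition opA :: "(st \<Rightarrow> real) \<Rightarrow> st \<Rightarrow> real" where
  "opA h = (\<lambda>z. dT h z + dX (dX (dX h)) z + dX (dY (dY h)) z + dX (dZ (dZ h)) z
     + 3 * (a z)\<^sup>2 * dX h z + 3 * \<kappa> * a z * h z)"

definition opS :: "(st \<Rightarrow> real) \<Rightarrow> st \<Rightarrow> real" where
  "opS h = (\<lambda>z. - 3 * a z * dX (dX h) z - 3 * \<kappa> * dX h z - a z * dY (dY h) z - a z * dZ (dZ h) z
     - (a z)^3 * h z - b z * h z)"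

lemma sa: "smooth sdirs a" and sb: "smooth sdirs b" and s\<tau>: "smooth sdirs \<tau>"
  using smooth_a smooth_b smooth_\<tau> smooth_subset[OF _ sdirs_adirs] by auto

text \<open>The difference of the two integrands is the space-time divergence of the flux
  \<open>(FT, FX, FY, FZ)\<close> below.\<close>

lemma opA_pairing:
  assumes h: "good h" and q: "smooth adirs q" and qY: "dY q = (\<lambda>_. 0)" and qZ: "dZ q = (\<lambda>_. 0)"
  shows "IT (\<lambda>z. opA h z * (q z * h z)) = IT (\<lambda>z.
     (- dT q z / 2 - dX (dX (dX q)) z / 2 - 3 / 2 * (a z)\<^sup>2 * dX q z) * (h z)\<^sup>2
     + 3 / 2 * dX q z * (dX h z)\<^sup>2 + dX q z / 2 * ((dY h z)\<^sup>2 + (dZ h z)\<^sup>2))"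
    (is "IT ?L = IT ?R")
proof -
  have s [simp]: "smooth sdirs h" "smooth sdirs (dT h)" "bsupp h" "smooth sdirs q" "smooth sdirs a"
    using h q sa smooth_subset[OF _ sdirs_adirs] by (auto simp: good_def)
  note [simp] = smooth_s_rules smooth_dd
  define FX where "FX = (\<lambda>z. dX (dX h) z * (q z * h z) - 1/2 * (q z * (dX h z)\<^sup>2) - dX q z * (h z * dX h z)
     + 1/2 * (dX (dX q) z * (h z)\<^sup>2) + 3/2 * ((a z)\<^sup>2 * (q z * (h z)\<^sup>2))
     - 1/2 * (q z * ((dY h z)\<^sup>2 + (dZ h z)\<^sup>2)))"
  define FY where "FY = (\<lambda>z. dX (dY h) z * (q z * h z))"
  define FZ where "FZ = (\<lambda>z. dX (dZ h) z * (q z * h z))"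
  define FT where "FT = (\<lambda>z. 1/2 * (q z * (h z)\<^sup>2))"
  have bs: "bsupp FX" "bsupp FY" "bsupp FZ" "bsupp FT"
  proof -
    obtain r where r: "\<And>z. norm z > r \<Longrightarrow> h z = 0" using s(3) by (auto simp: bsupp_def)
    have o: "open {z::st. norm z > r}" by (intro open_Collect_less continuous_intros)
    have "dd e h z = 0" if "norm z > r" for z e using dd_zero_open[OF o, of z h 0 e] r that by auto
    then show "bsupp FX" "bsupp FY" "bsupp FZ" "bsupp FT"
      unfolding bsupp_def FX_def FY_def FZ_def FT_def using r by (auto intro!: exI[of _ r])
  qed
  have smF: "smooth sdirs FX" "smooth sdirs FY" "smooth sdirs FZ" "smooth sdirs FT"
    by (simp_all add: FX_def FY_def FZ_def FT_def)
  have zX: "IT (dX FX) = 0" and zY: "IT (dY FY) = 0" and zZ: "IT (dZ FZ) = 0"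
    using smF bs by (auto intro: IT_dd_zero)
  have hT: "has_dd (1, 0) FT (\<lambda>z. 1/2 * (dT q z * (h z)\<^sup>2 + q z * (2 * h z * dT h z)))"
    unfolding FT_def
    by (intro has_dd_cmult has_dd_mult has_dd_sq smooth_has_dd[OF q]) (use h in \<open>auto simp: good_def\<close>)
  have cT: "continuous_on UNIV (dT FT)"
    unfolding has_dd_imp_dd[OF hT] using smooth_cont[OF s(1)] smooth_cont[OF s(2)] smooth_cont[OF q]
      smooth_cont[OF smooth_dd[OF q, of "(1,0)"]] by (auto intro!: continuous_intros)
  have zT: "IT (dT FT) = 0"
    by (rule integral_dd_zero[of FT "(1,0)"])
       (use hT cT bs smooth_cont[OF smF(4)] in \<open>auto simp: cc_def has_dd_imp_dd[OF hT]\<close>)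
  have cY: "dY (dX h) = dX (dY h)" "dZ (dX h) = dX (dZ h)" "dY (dX (dY h)) = dX (dY (dY h))" "dZ (dX (dZ h)) = dX (dZ (dZ h))"
    by (rule dd_commute[of sdirs]; simp)+
  have "?L z - ?R z = dT FT z + dX FX z + dY FY z + dZ FZ z" for z
    unfolding has_dd_imp_dd[OF hT] opA_def
    by (simp add: FX_def FY_def FZ_def dd_rules[of sdirs] dd_const dXa qY qZ cY)
       (simp add: power2_eq_square field_simps)
  then have eq: "(\<lambda>z. ?L z - ?R z) = (\<lambda>z. dT FT z + dX FX z + dY FY z + dZ FZ z)" by auto
  have ccF: "cc (dX FX)" "cc (dY FY)" "cc (dZ FZ)" "cc (dT FT)"
    using smF bs cT by (simp_all add: cc_def bsupp_dd smooth_cont[of sdirs])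
  note i = ccF[THEN cc_integrable]
  have ccL: "cc ?L" "cc ?R"
  proof -
    have cn: "continuous_on UNIV q" "continuous_on UNIV h" "continuous_on UNIV (dT q)" "continuous_on UNIV (dT h)" "continuous_on UNIV a"
      "continuous_on UNIV (dX h)" "continuous_on UNIV (dY h)" "continuous_on UNIV (dZ h)"
      "continuous_on UNIV (dX q)" "continuous_on UNIV (dX (dX (dX q)))" "continuous_on UNIV (dX (dX (dX h)))"
      "continuous_on UNIV (dX (dY (dY h)))" "continuous_on UNIV (dX (dZ (dZ h)))"
      using smooth_cont[of sdirs] smooth_cont[OF smooth_dd[OF q, of "(1,0)"]] by simp_all
    show "cc ?L" using bsupp_mult2[of h] bsupp_mult2[of "\<lambda>z. q z * h z" "opA h"] cn s
      by (auto simp: cc_def opA_def intro!: continuous_intros)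
    have "bsupp (\<lambda>z. (c z :: real) * (k z)\<^sup>2)" if "bsupp k" for c k :: "st \<Rightarrow> real"
      using that by (auto simp: bsupp_def)
    note bk = this
    show "cc ?R" using cn s unfolding cc_def distrib_left
      by (intro conjI bsupp_add bk bsupp_dd) (auto intro!: continuous_intros)
  qed
  have "IT (\<lambda>z. ?L z - ?R z) = 0"
    unfolding eq using i zX zY zZ zT by simp
  then show ?thesis using ccL[THEN cc_integrable] by simp
qed

text \<open>The coefficients of \<open>opA\<close> are constant in y and z, so only d_x has a
  commutator with it, namely d_x(3 a^2) d_x + d_x(3 \<kappa> a).\<close>

lemma opA_dX:
  assumes f: "good f" shows "dX (opA f) = (\<lambda>z. opA (dX f) z + 6 * \<kappa> * a z * dX f z + 3 * \<kappa>\<^sup>2 * f z)"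
    and "dY (opA f) = opA (dY f)" and "dZ (opA f) = opA (dZ f)"
proof -
  have s [simp]: "smooth sdirs f" "smooth sdirs (dT f)" "smooth sdirs a" using f sa by (auto simp: good_def)
  note [simp] = smooth_s_rules smooth_dd
  have c1: "dY (dX g) = dX (dY g)" "dZ (dX g) = dX (dZ g)" "dY (dZ g) = dZ (dY g)" if "smooth sdirs g" for g
    using that by (auto intro!: dd_commute[of sdirs])
  note g = good_dd(2)[OF f]
  show "dX (opA f) = (\<lambda>z. opA (dX f) z + 6 * \<kappa> * a z * dX f z + 3 * \<kappa>\<^sup>2 * f z)"
    "dY (opA f) = opA (dY f)" "dZ (opA f) = opA (dZ f)"
    unfolding opA_def
    by (simp_all add: fun_eq_iff dd_rules[of sdirs] dd_const dXa dYa dZa g c1 power2_eq_square algebra_simps)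
qed

text \<open>Pair \<open>opA f + opS f\<close> with \<open>opS f + 4 \<kappa> a f\<close>. The multiple \<open>4 \<kappa> a f\<close> turns the symbol
  \<open>\<kappa> ((3 \<xi>\<^sup>2 + m - 3 a\<^sup>2)\<^sup>2 + 36 a\<^sup>2 \<xi>\<^sup>2) / 2\<close> of the commutator (\<open>m\<close> the symbol of
  \<open>-(\<partial>\<^sub>y\<^sup>2 + \<partial>\<^sub>z\<^sup>2)\<close>), which vanishes at \<open>\<xi> = 0\<close>, \<open>m = 3 a\<^sup>2\<close>, into a positive combination of
  \<open>a\<^sup>4\<close>, \<open>a\<^sup>2 \<xi>\<^sup>2\<close>, \<open>a\<^sup>2 m\<close> and nonnegative terms.\<close>

lemma carleman:
  assumes f: "good f" and \<kappa>: "\<kappa> \<ge> 0"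
    and off: "\<And>z e. z \<notin> D \<Longrightarrow> e \<in> sdirs \<Longrightarrow> f z = 0 \<and> dd e f z = 0"
    and c0: "\<And>z. z \<in> D \<Longrightarrow> m0 \<le> \<kappa> * (a z)^4 / 2 + 3 * (a z)\<^sup>2 * \<tau> z - 10 * \<kappa>\<^sup>2 * (a z)\<^sup>2 + \<beta> z / 2 - 2 * \<kappa> * \<tau> z
        - 15 / 2 * \<kappa>^3 - 4 * \<kappa> * a z * b z"
    and c1: "\<And>z. z \<in> D \<Longrightarrow> m1 \<le> 21 * \<kappa> * (a z)\<^sup>2 - 3 * \<tau> z + 6 * \<kappa>\<^sup>2"
    and c2: "\<And>z. z \<in> D \<Longrightarrow> 0 \<le> \<kappa> * (a z)\<^sup>2 - \<tau> z + 2 * \<kappa>\<^sup>2"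
  shows "m0 * IT (\<lambda>z. (f z)\<^sup>2) + m1 * IT (\<lambda>z. (dX f z)\<^sup>2) \<le> 5 / 4 * IT (\<lambda>z. (opA f z + opS f z)\<^sup>2)"
proof -
  have s [simp]: "smooth sdirs f" "smooth sdirs (dT f)" "bsupp f" "smooth sdirs a" "smooth sdirs b" "smooth sdirs \<tau>"
    using f sa sb s\<tau> smooth_subset[OF _ sdirs_adirs] by (auto simp: good_def)
  have s\<beta> [simp]: "smooth sdirs \<beta>"
    using smooth_subset[OF smooth_dd[OF smooth_b] sdirs_adirs, of "(1,0)"] dTb by simp
  note [simp] = smooth_s_rules smooth_dd
  \<comment> \<open>The coefficient of f in the multiplier \<open>Mf\<close> below.\<close>
  define q where "q = (\<lambda>z. - ((a z)\<^sup>2 * a z + b z - 4 * \<kappa> * a z))"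
  have sq: "smooth adirs q" unfolding q_def by (intro smooth_s_rules smooth_a smooth_b)
  have qX: "dX q = (\<lambda>z. - (3 * \<kappa> * (a z)\<^sup>2 + \<tau> z - 4 * \<kappa>\<^sup>2))"
    unfolding q_def by (simp add: dd_rules[of sdirs] dd_const dXa dXb fun_eq_iff power2_eq_square algebra_simps)
  have qXX: "dX (dX q) = (\<lambda>z. - (6 * \<kappa>\<^sup>2 * a z))"
    unfolding qX by (simp add: dd_rules[of sdirs] dd_const dXa dX\<tau> fun_eq_iff power2_eq_square algebra_simps)
  have qXXX: "dX (dX (dX q)) = (\<lambda>z. - (6 * \<kappa>^3))"
    unfolding qXX by (simp add: dd_rules[of sdirs] dd_const dXa fun_eq_iff power2_eq_square power3_eq_cube)
  have qY: "dY q = (\<lambda>_. 0)" and qZ: "dZ q = (\<lambda>_. 0)"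
    unfolding q_def by (simp_all add: dd_rules[of sdirs] dd_const dYa dYb dZa dZb)
  have qT: "dT q = (\<lambda>z. - (3 * (a z)\<^sup>2 * \<tau> z + \<beta> z - 4 * \<kappa> * \<tau> z))"
    unfolding q_def by (simp add: dd_rules[of adirs] dd_const dTa dTb smooth_a smooth_b fun_eq_iff power2_eq_square algebra_simps)
  have aXXX: "dX (dX a) = (\<lambda>_. 0)" "dX (dX (dX a)) = (\<lambda>_. 0)" by (simp_all add: dXa dd_const)
  define R0 where "R0 = (\<lambda>z. (9/2 * \<kappa> * (a z)^4 + 3 * (a z)\<^sup>2 * \<tau> z - 6 * \<kappa>\<^sup>2 * (a z)\<^sup>2 + \<beta> z / 2 - 2 * \<kappa> * \<tau> z + 3 * \<kappa>^3) * (f z)\<^sup>2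
     - (9/2 * \<kappa> * (a z)\<^sup>2 + 3/2 * \<tau> z - 6 * \<kappa>\<^sup>2) * (dX f z)\<^sup>2
     - (3/2 * \<kappa> * (a z)\<^sup>2 + \<tau> z / 2 - 2 * \<kappa>\<^sup>2) * ((dY f z)\<^sup>2 + (dZ f z)\<^sup>2))"
  define R1 where "R1 g = (\<lambda>z. - (\<tau> z / 2 + 3/2 * \<kappa> * (a z)\<^sup>2) * (g z)\<^sup>2
     + 3/2 * \<kappa> * (dX g z)\<^sup>2 + \<kappa> / 2 * ((dY g z)\<^sup>2 + (dZ g z)\<^sup>2))" for g
  define R2 where "R2 = (\<lambda>z. 30 * \<kappa> * (a z)\<^sup>2 * (dX f z)\<^sup>2 + 4 * \<kappa> * (a z)\<^sup>2 * ((dY f z)\<^sup>2 + (dZ f z)\<^sup>2)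
     - (21/2 * \<kappa>^3 + 4 * \<kappa> * (a z)^4 + 4 * \<kappa> * a z * b z) * (f z)\<^sup>2)"
  define L0 where "L0 = (\<lambda>z. opA f z * (q z * f z))"
  define L1 where "L1 g = (\<lambda>z. opA g z * (a z * g z))" for g
  have I0: "IT L0 = IT R0"
    unfolding L0_def opA_pairing[OF f sq qY qZ] R0_def qT qXXX unfolding qX
    by (rule Bochner_Integration.integral_cong) (simp_all add: power2_eq_square power3_eq_cube power4_eq_xxxx field_simps)
  have I1: "IT (L1 g) = IT (R1 g)" if "good g" for g
    unfolding L1_def opA_pairing[OF that smooth_a dYa dZa] R1_def aXXX dTa dXa
    by (rule Bochner_Integration.integral_cong) (simp_all add: field_simps dd_const)
  \<comment> \<open>Fluxes that move one derivative off the second-order part of the multiplier.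
    Pairing \<open>opA f\<close> with -3 d_x(a d_x f) - a (f_yy + f_zz) becomes 3
    \<open>L1 (dX f)\<close> + \<open>L1 (dY f)\<close> + \<open>L1 (dZ f)\<close> plus commutator
    terms from \<open>opA_dX\<close>. The terms with a^2 do the same for 4 \<kappa> a f times
    \<open>opS f\<close>, and the last term of \<open>FX\<close> turns a f f_x into f^2.\<close>
  define FX where "FX = (\<lambda>z. - 3 * (opA f z * (a z * dX f z)) - 12 * \<kappa> * ((a z)\<^sup>2 * (f z * dX f z)) + 21/2 * \<kappa>\<^sup>2 * (a z * (f z)\<^sup>2))"
  define FY where "FY = (\<lambda>z. - (opA f z * (a z * dY f z)) - 4 * \<kappa> * ((a z)\<^sup>2 * (f z * dY f z)))"
  define FZ where "FZ = (\<lambda>z. - (opA f z * (a z * dZ f z)) - 4 * \<kappa> * ((a z)\<^sup>2 * (f z * dZ f z)))"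
  define Pf where "Pf = (\<lambda>z. opA f z + opS f z)"
  define Mf where "Mf = (\<lambda>z. opS f z + 4 * \<kappa> * a z * f z)"
  have sA [simp]: "smooth sdirs (opA g)" if "good g" for g using that by (simp add: opA_def good_def)
  have sS [simp]: "smooth sdirs (opS f)" by (simp add: opS_def)
  have gd: "good (dX f)" "good (dY f)" "good (dZ f)" using good_dd(1)[OF f] by auto
  have sqs [simp]: "smooth sdirs q" using smooth_subset[OF sq sdirs_adirs] .
  have sm: "smooth sdirs FX" "smooth sdirs FY" "smooth sdirs FZ" "smooth sdirs R0" "smooth sdirs R2" "smooth sdirs L0"
    "smooth sdirs Pf" "smooth sdirs Mf" "smooth sdirs (\<lambda>z. Pf z * Mf z)" "smooth sdirs (\<lambda>z. (Pf z)\<^sup>2)"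
    "smooth sdirs (\<lambda>z. (opS f z)\<^sup>2)" "smooth sdirs (\<lambda>z. (f z)\<^sup>2)" "smooth sdirs (\<lambda>z. (dX f z)\<^sup>2)" "smooth sdirs (\<lambda>z. (a z)\<^sup>2 * (f z)\<^sup>2)"
    by (simp_all add: FX_def FY_def FZ_def R0_def R2_def L0_def Pf_def Mf_def f)
  have sm1: "smooth sdirs (L1 g)" "smooth sdirs (R1 g)" if "good g" for g
    using that by (simp_all add: L1_def R1_def good_def)
  obtain r where r: "\<And>z. norm z > r \<Longrightarrow> f z = 0" using s(3) by (auto simp: bsupp_def)
  have o: "open {z::st. norm z > r}" by (intro open_Collect_less continuous_intros)
  have v: "dd e g z = 0" if "\<And>z. norm z > r \<Longrightarrow> g z = 0" "norm z > r" for z :: st and e g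
    using dd_zero_open[OF o, of z g 0 e] that by auto
  have z1: "dd e f z = 0" if "norm z > r" for z :: st and e using v[OF r that] .
  have z2: "dd e (dd e' f) z = 0" if "norm z > r" for z :: st and e e' using v[OF z1 that] .
  have z3: "dd e (dd e' (dd e'' f)) z = 0" if "norm z > r" for z :: st and e e' e'' using v[OF z2 that] .
  have zA: "opA f z = 0" "opS f z = 0" if "norm z > r" for z :: st
    unfolding opA_def opS_def using that r z1 z2 z3 by simp_all
  have bs: "bsupp FX" "bsupp FY" "bsupp FZ" "bsupp R0" "bsupp R2" "bsupp L0" "bsupp (R1 (dX f))" "bsupp (R1 (dY f))" "bsupp (R1 (dZ f))"
    "bsupp (L1 (dX f))" "bsupp (L1 (dY f))" "bsupp (L1 (dZ f))" "bsupp (\<lambda>z. Pf z * Mf z)" "bsupp (\<lambda>z. (Pf z)\<^sup>2)"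
    "bsupp (\<lambda>z. (opS f z)\<^sup>2)" "bsupp (\<lambda>z. (f z)\<^sup>2)" "bsupp (\<lambda>z. (dX f z)\<^sup>2)" "bsupp (\<lambda>z. (a z)\<^sup>2 * (f z)\<^sup>2)"
    unfolding bsupp_def by (intro exI[of _ r] allI impI; simp add: FX_def FY_def FZ_def R0_def R1_def R2_def L0_def L1_def Pf_def Mf_def r z1 z2 zA)+
  note i = cc_integrable[OF cc_smooth[OF sm(4) bs(4)]] cc_integrable[OF cc_smooth[OF sm(5) bs(5)]] cc_integrable[OF cc_smooth[OF sm(6) bs(6)]]
     cc_integrable[OF cc_smooth[OF sm1(2)[OF gd(1)] bs(7)]] cc_integrable[OF cc_smooth[OF sm1(2)[OF gd(2)] bs(8)]] cc_integrable[OF cc_smooth[OF sm1(2)[OF gd(3)] bs(9)]]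
     cc_integrable[OF cc_smooth[OF sm1(1)[OF gd(1)] bs(10)]] cc_integrable[OF cc_smooth[OF sm1(1)[OF gd(2)] bs(11)]] cc_integrable[OF cc_smooth[OF sm1(1)[OF gd(3)] bs(12)]]
     cc_integrable[OF cc_smooth[OF sm(9) bs(13)]] cc_integrable[OF cc_smooth[OF sm(10) bs(14)]] cc_integrable[OF cc_smooth[OF sm(11) bs(15)]]
     cc_integrable[OF cc_smooth[OF sm(12) bs(16)]] cc_integrable[OF cc_smooth[OF sm(13) bs(17)]] cc_integrable[OF cc_smooth[OF sm(14) bs(18)]]
  have iF: "integrable lborel (dX FX)" "integrable lborel (dY FY)" "integrable lborel (dZ FZ)"
    using cc_integrable[OF cc_smooth[OF smooth_dd bsupp_dd]] sm bs by (meson sdirs_in)+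
  have zF: "IT (dX FX) = 0" "IT (dY FY) = 0" "IT (dZ FZ) = 0"
    using sm bs by (auto intro: IT_dd_zero)
  note oA = opA_dX[OF f]
  have "Pf z * Mf z = (opS f z)\<^sup>2 + 3 * L1 (dX f) z + L1 (dY f) z + L1 (dZ f) z + L0 z + R2 z
     + dX FX z + dY FY z + dZ FZ z" for z
  proof -
    have X: "dX FX z = - 3 * (opA (dX f) z + 6 * \<kappa> * a z * dX f z + 3 * \<kappa>\<^sup>2 * f z) * (a z * dX f z)
        - 3 * opA f z * (\<kappa> * dX f z + a z * dX (dX f) z)
        - 12 * \<kappa> * (2 * \<kappa> * a z * f z * dX f z + (a z)\<^sup>2 * ((dX f z)\<^sup>2 + f z * dX (dX f) z))
        + 21/2 * \<kappa>\<^sup>2 * (\<kappa> * (f z)\<^sup>2 + 2 * a z * f z * dX f z)"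
      unfolding FX_def
      by (simp add: dd_rules[of sdirs] dd_const dXa f oA) (simp add: power2_eq_square field_simps)
    have Y: "dY FY z = - opA (dY f) z * (a z * dY f z) - opA f z * (a z * dY (dY f) z)
        - 4 * \<kappa> * ((a z)\<^sup>2 * ((dY f z)\<^sup>2 + f z * dY (dY f) z))"
      unfolding FY_def
      by (simp add: dd_rules[of sdirs] dd_const dYa f oA) (simp add: power2_eq_square field_simps)
    have Z: "dZ FZ z = - opA (dZ f) z * (a z * dZ f z) - opA f z * (a z * dZ (dZ f) z)
        - 4 * \<kappa> * ((a z)\<^sup>2 * ((dZ f z)\<^sup>2 + f z * dZ (dZ f) z))"
      unfolding FZ_def
      by (simp add: dd_rules[of sdirs] dd_const dZa f oA) (simp add: power2_eq_square field_simps)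
    have S: "opS f z = - 3 * a z * dX (dX f) z - 3 * \<kappa> * dX f z - a z * dY (dY f) z - a z * dZ (dZ f) z
     - (a z)^3 * f z - b z * f z" by (simp add: opS_def)
    have M: "Mf z = - 3 * a z * dX (dX f) z - 3 * \<kappa> * dX f z - a z * dY (dY f) z - a z * dZ (dZ f) z + q z * f z"
      by (simp add: Mf_def S q_def power2_eq_square power3_eq_cube field_simps)
    have "Pf z * Mf z = (opS f z)\<^sup>2 + 4 * \<kappa> * a z * f z * opS f z + opA f z * Mf z"
      by (simp add: Pf_def Mf_def power2_eq_square algebra_simps)
    also have "opA f z * Mf z = opA f z * (- 3 * a z * dX (dX f) z - 3 * \<kappa> * dX f z - a z * dY (dY f) z - a z * dZ (dZ f) z) + L0 z"
      unfolding M L0_def by (simp add: algebra_simps)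
    also have "4 * \<kappa> * a z * f z * opS f z = 4 * \<kappa> * a z * f z * (- 3 * a z * dX (dX f) z - 3 * \<kappa> * dX f z - a z * dY (dY f) z - a z * dZ (dZ f) z
     - (a z)^3 * f z - b z * f z)" by (simp add: S)
    finally show ?thesis
      unfolding X Y Z L1_def R2_def by (simp add: power2_eq_square power3_eq_cube power4_eq_xxxx field_simps)
  qed
  then have PM: "IT (\<lambda>z. Pf z * Mf z) = IT (\<lambda>z. (opS f z)\<^sup>2 + 3 * L1 (dX f) z + L1 (dY f) z + L1 (dZ f) z + L0 z + R2 z
     + dX FX z + dY FY z + dZ FZ z)" by simp
  also have "\<dots> = IT (\<lambda>z. (opS f z)\<^sup>2) + 3 * IT (L1 (dX f)) + IT (L1 (dY f)) + IT (L1 (dZ f)) + IT L0 + IT R2"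
    using i iF zF by simp
  also have "\<dots> = IT (\<lambda>z. (opS f z)\<^sup>2) + IT (\<lambda>z. 3 * R1 (dX f) z + R1 (dY f) z + R1 (dZ f) z + R0 z + R2 z)"
    unfolding I0 I1[OF gd(1)] I1[OF gd(2)] I1[OF gd(3)] using i by simp
  finally have 1: "IT (\<lambda>z. Pf z * Mf z) = IT (\<lambda>z. (opS f z)\<^sup>2) + IT (\<lambda>z. 3 * R1 (dX f) z + R1 (dY f) z + R1 (dZ f) z + R0 z + R2 z)" .
  \<comment> \<open>Young's inequality, arranged so that the square of \<open>opS f\<close> appears
    with factor 1 and cancels the one in the identity above.\<close>
  have 2: "IT (\<lambda>z. Pf z * Mf z) \<le> IT (\<lambda>z. 5/4 * (Pf z)\<^sup>2 + (opS f z)\<^sup>2 + 4 * \<kappa>\<^sup>2 * ((a z)\<^sup>2 * (f z)\<^sup>2))"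
  proof (rule integral_mono)
    fix z
    have "0 \<le> (Pf z / 2 - opS f z)\<^sup>2 + (Pf z - 2 * \<kappa> * a z * f z)\<^sup>2" by simp
    then show "Pf z * Mf z \<le> 5/4 * (Pf z)\<^sup>2 + (opS f z)\<^sup>2 + 4 * \<kappa>\<^sup>2 * ((a z)\<^sup>2 * (f z)\<^sup>2)"
      by (simp add: Mf_def power2_eq_square field_simps)
  qed (use i in simp_all)
  have 3: "IT (\<lambda>z. m0 * (f z)\<^sup>2 + m1 * (dX f z)\<^sup>2 + 4 * \<kappa>\<^sup>2 * ((a z)\<^sup>2 * (f z)\<^sup>2)) \<le> IT (\<lambda>z. 3 * R1 (dX f) z + R1 (dY f) z + R1 (dZ f) z + R0 z + R2 z)"
  proof (rule integral_mono)
    fix z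
    \<comment> \<open>The second-order terms. Their coefficients are nonnegative multiples of
      \<kappa>, so the whole group can be discarded.\<close>
    define N where "N = 3 * (3/2 * \<kappa> * (dX (dX f) z)\<^sup>2 + \<kappa> / 2 * ((dY (dX f) z)\<^sup>2 + (dZ (dX f) z)\<^sup>2))
      + (3/2 * \<kappa> * (dX (dY f) z)\<^sup>2 + \<kappa> / 2 * ((dY (dY f) z)\<^sup>2 + (dZ (dY f) z)\<^sup>2))
      + (3/2 * \<kappa> * (dX (dZ f) z)\<^sup>2 + \<kappa> / 2 * ((dY (dZ f) z)\<^sup>2 + (dZ (dZ f) z)\<^sup>2))"
    have N: "N \<ge> 0" unfolding N_def using \<kappa> by (intro add_nonneg_nonneg mult_nonneg_nonneg) auto
    define C0 where "C0 = \<kappa> * (a z)^4 / 2 + 3 * (a z)\<^sup>2 * \<tau> z - 10 * \<kappa>\<^sup>2 * (a z)\<^sup>2 + \<beta> z / 2 - 2 * \<kappa> * \<tau> z - 15 / 2 * \<kappa>^3 - 4 * \<kappa> * a z * b z"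
    have eq: "3 * R1 (dX f) z + R1 (dY f) z + R1 (dZ f) z + R0 z + R2 z =
       N + C0 * (f z)\<^sup>2 + 4 * \<kappa>\<^sup>2 * ((a z)\<^sup>2 * (f z)\<^sup>2) + (21 * \<kappa> * (a z)\<^sup>2 - 3 * \<tau> z + 6 * \<kappa>\<^sup>2) * (dX f z)\<^sup>2
        + (\<kappa> * (a z)\<^sup>2 - \<tau> z + 2 * \<kappa>\<^sup>2) * ((dY f z)\<^sup>2 + (dZ f z)\<^sup>2)"
      unfolding N_def R1_def R0_def R2_def C0_def by (simp add: field_simps)
    have "m0 * (f z)\<^sup>2 \<le> C0 * (f z)\<^sup>2 \<and> m1 * (dX f z)\<^sup>2 \<le> (21 * \<kappa> * (a z)\<^sup>2 - 3 * \<tau> z + 6 * \<kappa>\<^sup>2) * (dX f z)\<^sup>2 \<and>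
        0 \<le> (\<kappa> * (a z)\<^sup>2 - \<tau> z + 2 * \<kappa>\<^sup>2) * ((dY f z)\<^sup>2 + (dZ f z)\<^sup>2)"
    \<comment> \<open>Off D the function and its first space derivatives vanish, hence the three
      inequalities are trivial there; the coefficient bounds are available on D only.\<close>
    proof (cases "z \<in> D")
      case True
      show ?thesis unfolding C0_def using c0[OF True] c1[OF True] c2[OF True]
        by (intro conjI mult_right_mono mult_nonneg_nonneg) auto
    next
      case False
      have "f z = 0" "dX f z = 0" "dY f z = 0" "dZ f z = 0"
        using off[OF False sdirs_in(1)] off[OF False sdirs_in(2)] off[OF False sdirs_in(3)] by auto
      then show ?thesis by simp
    qed
    then show "m0 * (f z)\<^sup>2 + m1 * (dX f z)\<^sup>2 + 4 * \<kappa>\<^sup>2 * ((a z)\<^sup>2 * (f z)\<^sup>2) \<le> 3 * R1 (dX f) z + R1 (dY f) z + R1 (dZ f) z + R0 z + R2 z"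
      unfolding eq using N by linarith
  qed (use i in simp_all)
  show ?thesis using 1 2 3 i unfolding Pf_def by simp
qed

end

section \<open>Mollifiers\<close>

text \<open>The classical flat function exp(-1/x), with powers of 1/x as additional factors: the
  derivative of a member is a linear combination of members, which makes smoothness an induction
  over the whole family.\<close>

definition flatf :: "nat \<Rightarrow> real \<Rightarrow> real" where
  "flatf n x = (if x > 0 then inverse x ^ n * exp (- inverse x) else 0)"

lemma flatf_tendsto_0: "(flatf n \<longlongrightarrow> 0) (at 0)"
proof -
  have "((\<lambda>x. inverse x ^ n / exp (inverse x)) \<longlongrightarrow> (0::real)) (at_right 0)"
    by (rule filterlim_compose[OF tendsto_power_div_exp_0 filterlim_inverse_at_top_right])
  then have r: "(flatf n \<longlongrightarrow> 0) (at_right 0)"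
    by (rule Lim_transform_eventually) (auto simp: flatf_def eventually_at_filter exp_minus divide_inverse)
  have l: "(flatf n \<longlongrightarrow> 0) (at_left 0)"
    by (rule Lim_transform_eventually[OF tendsto_const[of 0]]) (auto simp: flatf_def eventually_at_filter)
  show ?thesis using l r by (simp add: filterlim_at_split)
qed

text \<open>At the critical point 0 the difference quotient of \<open>flatf n\<close> is
  \<open>flatf (n + 1)\<close>, which tends to 0.\<close>

lemma flatf_deriv: "(flatf n has_real_derivative flatf (n + 2) x - real n * flatf (n + 1) x) (at x)"
proof -
  consider "x > 0" | "x < 0" | "x = 0" by linarith
  then show ?thesis
  proof cases
    case 1
    have "((\<lambda>x. inverse x ^ n * exp (- inverse x)) has_real_derivative flatf (n + 2) x - real n * flatf (n + 1) x) (at x)"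
    proof (cases n)
      case 0
      then show ?thesis using 1
        by (auto intro!: derivative_eq_intros simp: flatf_def power2_eq_square)
    next
      case (Suc m)
      then show ?thesis using 1
        by (auto intro!: derivative_eq_intros simp: flatf_def power2_eq_square algebra_simps) (cases m; simp)
    qed
    then show ?thesis
      by (rule has_field_derivative_transform_within_open[where S = "{0<..}"]) (use 1 in \<open>auto simp: flatf_def\<close>)
  next
    case 2
    have "((\<lambda>x. 0) has_real_derivative 0) (at x)" by simp
    then have "(flatf n has_real_derivative 0) (at x)"
      by (rule has_field_derivative_transform_within_open[where S = "{..<0}"]) (use 2 in \<open>auto simp: flatf_def\<close>)
    then show ?thesis using 2 by (simp add: flatf_def)
  next
    case 3
    have "((\<lambda>h. flatf (n + 1) h) \<longlongrightarrow> 0) (at 0)" by (rule flatf_tendsto_0)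
    moreover have "flatf (n + 1) h = (flatf n (0 + h) - flatf n 0) / h" for h
      by (auto simp: flatf_def field_simps)
    ultimately have "(flatf n has_real_derivative 0) (at 0)" unfolding DERIV_def by simp
    then show ?thesis using 3 by (simp add: flatf_def)
  qed
qed

lemma flatf_continuous: "continuous_on UNIV (flatf n)"
  using flatf_deriv by (meson DERIV_isCont continuous_at_imp_continuous_on)

lemma smooth_flatf: "smooth {1} (flatf n)"
proof -
  have "ck {1} k (flatf n)" for k
  proof (induction k arbitrary: n)
    case 0 then show ?case by (simp add: flatf_continuous)
  next
    case (Suc k)
    have "ck {1} k (\<lambda>x. flatf (n + 2) x + (- real n) * flatf (n + 1) x)"
      by (intro ck_add ck_mult ck_const Suc.IH)
    moreover have "has_dd 1 (flatf n) (\<lambda>x. flatf (n + 2) x + (- real n) * flatf (n + 1) x)"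
      using flatf_deriv by (simp add: has_dd_1)
    ultimately show ?case using flatf_continuous by (intro ck_SucI) auto
  qed
  then show ?thesis by (simp add: smooth_def)
qed

section \<open>Bump functions, their primitives and smooth steps\<close>

definition bump :: "real \<Rightarrow> real" where "bump x = flatf 0 (1 - x\<^sup>2)"

lemma bump_nonneg: "0 \<le> bump x" by (simp add: bump_def flatf_def)
lemma bump_even: "bump (- x) = bump x" by (simp add: bump_def)
lemma bump_zero: "\<bar>x\<bar> \<ge> 1 \<Longrightarrow> bump x = 0"
  using abs_le_square_iff[of 1 x] by (simp add: bump_def flatf_def)
lemma bump_pos: "\<bar>x\<bar> < 1 \<Longrightarrow> bump x > 0"
  using abs_square_less_1[of x] by (simp add: bump_def flatf_def)
lemma smooth_bump: "smooth {1} bump"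
  unfolding bump_def[abs_def] by (intro smooth_compose[OF smooth_flatf] smooth_intros smooth_id)

text \<open>The base point \<open>-2\<close> lies to the left of the supports (contained in \<open>[-1, \<infinity>)\<close>), so that the
  junk value \<open>integral {-2..x} g = 0\<close> for \<open>x < -2\<close> is the correct one.\<close>

definition primitive :: "(real \<Rightarrow> real) \<Rightarrow> real \<Rightarrow> real" where
  "primitive g x = integral {-2..x} g"

lemma primitive_zero: "(\<And>x. x \<le> -1 \<Longrightarrow> g x = 0) \<Longrightarrow> x \<le> -1 \<Longrightarrow> primitive g x = 0"
  unfolding primitive_def by (subst integral_cong[where g = "\<lambda>_. 0"]) auto

lemma primitive_deriv:
  assumes c: "continuous_on UNIV g" and z: "\<And>x. x \<le> -1 \<Longrightarrow> g x = 0"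
  shows "(primitive g has_real_derivative g x) (at x)"
proof (cases "x > -2")
  case True
  have "((\<lambda>x. integral {-2..x} g) has_real_derivative g x) (at x within {-2..x+1})"
    by (rule integral_has_real_derivative) (use True in \<open>auto intro: continuous_on_subset[OF c]\<close>)
  moreover have "at x within {-2..x+1} = at x" by (rule at_within_interior) (use True in auto)
  ultimately show ?thesis by (simp add: primitive_def[abs_def])
next
  case False
  have "((\<lambda>x. 0) has_real_derivative 0) (at x)" by simp
  then have "(primitive g has_real_derivative 0) (at x)"
    by (rule has_field_derivative_transform_within_open[where S = "{..<-1}"])
       (use False primitive_zero[of g, OF z] in auto)
  then show ?thesis using z False by simp
qed

lemma smooth_primitive:
  assumes g: "smooth {1} g" and z: "\<And>x. x \<le> -1 \<Longrightarrow> g x = 0"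
  shows "smooth {1} (primitive g)" "has_dd 1 (primitive g) g"
proof -
  have d: "(primitive g has_real_derivative g x) (at x)" for x
    by (rule primitive_deriv[OF smooth_cont[OF g] z])
  then show h: "has_dd 1 (primitive g) g" by (simp add: has_dd_1)
  show "smooth {1} (primitive g)"
    by (rule smooth_step[where g = "\<lambda>_. g"])
       (use d h g in \<open>auto intro: DERIV_isCont continuous_at_imp_continuous_on\<close>)
qed

lemma const_if_deriv0:
  fixes g :: "real \<Rightarrow> real"
  assumes "\<And>x. x \<ge> a \<Longrightarrow> (g has_real_derivative 0) (at x)" "x \<ge> a"
  shows "g x = g a"
proof (cases "x = a")
  case False
  then have "a < x" using assms by simp
  then show ?thesis
    using assms by (intro DERIV_isconst_end) (auto intro!: DERIV_isCont continuous_at_imp_continuous_on)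
qed simp

definition cbump :: "real \<Rightarrow> real" where "cbump = primitive bump"

lemma cbump_deriv: "(cbump has_real_derivative bump x) (at x)"
  unfolding cbump_def by (rule primitive_deriv) (use smooth_cont[OF smooth_bump] bump_zero in auto)
lemma smooth_cbump: "smooth {1} cbump" "has_dd 1 cbump bump"
  unfolding cbump_def using smooth_primitive[OF smooth_bump] bump_zero by auto
lemma cbump_zero: "x \<le> -1 \<Longrightarrow> cbump x = 0"
  unfolding cbump_def by (rule primitive_zero) (use bump_zero in auto)
lemma cbump_one: "x \<ge> 1 \<Longrightarrow> cbump x = cbump 1"
proof (rule const_if_deriv0[where g = cbump])
  fix y :: real assume "y \<ge> 1"
  then show "(cbump has_real_derivative 0) (at y)" using cbump_deriv[of y] bump_zero[of y] by simp
qed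
lemma cbump_mono: "x \<le> y \<Longrightarrow> cbump x \<le> cbump y"
  using DERIV_nonneg_imp_nondecreasing[of x y cbump] cbump_deriv bump_nonneg by blast
lemma cbump_pos: "cbump 1 > 0"
proof -
  have "cbump (-1/2) < cbump (1/2)"
    by (rule DERIV_pos_imp_increasing) (auto intro!: exI conjI cbump_deriv bump_pos)
  then show ?thesis using cbump_mono[of "-1" "-1/2"] cbump_mono[of "1/2" 1] cbump_zero[of "-1"] by simp
qed
lemma cbump_reflect: "cbump x + cbump (- x) = cbump 1"
proof -
  have "((\<lambda>x. cbump x + cbump (- x)) has_real_derivative 0) (at x)" for x
    by (auto intro!: derivative_eq_intros cbump_deriv DERIV_chain2[OF cbump_deriv] simp: bump_even)
  then have "cbump x + cbump (- x) = cbump 1 + cbump (- 1)"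
    using DERIV_isconst_all[of "\<lambda>x. cbump x + cbump (- x)" x 1] by blast
  then show ?thesis using cbump_zero[of "-1"] by simp
qed

definition ramp :: "real \<Rightarrow> real" where "ramp x = cbump (2 * x - 1) / cbump 1"

lemma smooth_ramp: "smooth {1} ramp"
  unfolding ramp_def[abs_def] by (intro smooth_divide_const smooth_compose[OF smooth_cbump(1)] smooth_intros smooth_id)
lemma ramp_zero: "x \<le> 0 \<Longrightarrow> ramp x = 0" by (simp add: ramp_def cbump_zero)
lemma ramp_one: "x \<ge> 1 \<Longrightarrow> ramp x = 1" using cbump_one[of "2 * x - 1"] cbump_pos by (simp add: ramp_def)
lemma ramp_nonneg: "0 \<le> ramp x"
  using cbump_mono[of "min (-1) (2 * x - 1)" "2 * x - 1"] cbump_zero[of "min (-1) (2 * x - 1)"] cbump_pos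
  by (simp add: ramp_def)
lemma ramp_le1: "ramp x \<le> 1"
  using cbump_mono[of "2 * x - 1" "max 1 (2 * x - 1)"] cbump_one[of "max 1 (2 * x - 1)"] cbump_pos
  by (simp add: ramp_def)

text \<open>\<open>qbump\<close> is a compactly supported solution of \<open>qbump'' = bump x - 2 * bump (2 * x)\<close>.\<close>

definition wave :: "real \<Rightarrow> real" where "wave x = cbump x - cbump (2 * x)"
definition qbump :: "real \<Rightarrow> real" where "qbump = primitive wave"

lemma wave_zero: "\<bar>x\<bar> \<ge> 1 \<Longrightarrow> wave x = 0"
  unfolding wave_def using cbump_zero[of x] cbump_zero[of "2 * x"] cbump_one[of x] cbump_one[of "2 * x"]
  by (cases "x \<ge> 0") auto
lemma smooth_wave: "smooth {1} wave"
  unfolding wave_def[abs_def] by (intro smooth_intros smooth_cbump smooth_compose[OF smooth_cbump(1)] smooth_id)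
lemma wave_has_dd: "has_dd 1 wave (\<lambda>x. bump x - 2 * bump (2 * x))"
  unfolding has_dd_1 wave_def[abs_def]
  by (auto intro!: derivative_eq_intros cbump_deriv DERIV_chain2[OF cbump_deriv])
lemma qbump_deriv: "(qbump has_real_derivative wave x) (at x)"
  unfolding qbump_def by (rule primitive_deriv) (use smooth_cont[OF smooth_wave] wave_zero in auto)
lemma smooth_qbump: "smooth {1} qbump" "has_dd 1 qbump wave"
  unfolding qbump_def using smooth_primitive[OF smooth_wave] wave_zero by auto
lemma wave_odd: "wave (- x) = - wave x"
  using cbump_reflect[of x] cbump_reflect[of "2 * x"] by (simp add: wave_def)
lemma qbump_even: "qbump (- x) = qbump x"
proof -
  have "((\<lambda>x. qbump x - qbump (- x)) has_real_derivative 0) (at x)" for x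
    by (auto intro!: derivative_eq_intros qbump_deriv DERIV_chain2[OF qbump_deriv] simp: wave_odd)
  then have "qbump x - qbump (- x) = qbump 0 - qbump (- 0)"
    using DERIV_isconst_all[of "\<lambda>x. qbump x - qbump (- x)" x 0] by blast
  then show ?thesis by simp
qed
text \<open>To the left of -1 nothing has been integrated yet. To the right of 1 the value is the
  total integral of \<open>wave\<close>, which is zero because \<open>wave\<close> is odd; in the
  proof this enters as evenness of \<open>qbump\<close>.\<close>

lemma qbump_zero: "\<bar>x\<bar> \<ge> 1 \<Longrightarrow> qbump x = 0"
proof -
  have *: "qbump x = 0" if "x \<le> -1" for x
    unfolding qbump_def by (rule primitive_zero) (use that wave_zero in auto)
  assume "\<bar>x\<bar> \<ge> 1"
  then show ?thesis using *[of x] *[of "-x"] qbump_even[of x] by (cases "x \<ge> 0") auto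
qed

section \<open>Product kernels and the dyadic mollifiers\<close>

definition tprod :: "(real \<Rightarrow> real) \<Rightarrow> (real \<Rightarrow> real) \<Rightarrow> (real \<Rightarrow> real) \<Rightarrow> real^3 \<Rightarrow> real" where
  "tprod A B C p = A (p $ 1) * B (p $ 2) * C (p $ 3)"

lemma has_dd_nth: "has_dd e (\<lambda>p::real^3. p $ i) (\<lambda>_. e $ i)"
  by (rule has_dd_linear) (rule bounded_linear_vec_nth)
lemma smooth_nth: "smooth B (\<lambda>p::real^3. p $ i)"
  by (rule smooth_linear) (rule bounded_linear_vec_nth)

lemma exyz_nth [simp]: "ex $ 1 = 1" "ex $ 2 = 0" "ex $ 3 = 0" "ey $ 1 = 0" "ey $ 2 = 1" "ey $ 3 = 0"
  "ez $ 1 = 0" "ez $ 2 = 0" "ez $ 3 = 1"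
  by (simp_all add: ex_def ey_def ez_def axis_def)
lemma exyz_dirs [simp]: "ex \<in> dirs" "ey \<in> dirs" "ez \<in> dirs" by (simp_all add: dirs_def)

lemma smooth_tprod:
  assumes "smooth {1} A" "smooth {1} B" "smooth {1} C" shows "smooth S (tprod A B C)"
  unfolding tprod_def[abs_def] using assms[THEN smooth_compose[OF _ smooth_nth]]
  by (intro smooth_mult) auto

lemma dd_tprod:
  shows "has_dd 1 A A' \<Longrightarrow> dd ex (tprod A B C) = tprod A' B C"
    and "has_dd 1 B B' \<Longrightarrow> dd ey (tprod A B C) = tprod A B' C"
    and "has_dd 1 C C' \<Longrightarrow> dd ez (tprod A B C) = tprod A B C'"
proof -
  have k: "has_dd e (\<lambda>p::real^3. g (p $ i)) (\<lambda>p. 0)" if "e $ i = 0" for e i and g :: "real \<Rightarrow> real"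
    unfolding has_dd_def using that by simp
  show "dd ex (tprod A B C) = tprod A' B C" if "has_dd 1 A A'"
    using has_dd_imp_dd[OF has_dd_mult[OF has_dd_mult[OF has_dd_compose[OF that has_dd_nth[of ex 1]] k[of ex 2 B]] k[of ex 3 C]]]
    by (simp add: tprod_def[abs_def])
  show "dd ey (tprod A B C) = tprod A B' C" if "has_dd 1 B B'"
    using has_dd_imp_dd[OF has_dd_mult[OF has_dd_mult[OF k[of ey 1 A] has_dd_compose[OF that has_dd_nth[of ey 2]]] k[of ey 3 C]]]
    by (simp add: tprod_def[abs_def])
  show "dd ez (tprod A B C) = tprod A B C'" if "has_dd 1 C C'"
    using has_dd_imp_dd[OF has_dd_mult[OF has_dd_mult[OF k[of ez 1 A] k[of ez 2 B]] has_dd_compose[OF that has_dd_nth[of ez 3]]]]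
    by (simp add: tprod_def[abs_def])
qed

lemma norm3_le: "norm (p::real^3) \<le> \<bar>p $ 1\<bar> + \<bar>p $ 2\<bar> + \<bar>p $ 3\<bar>"
  using norm_le_l1_cart[of p] by (simp add: sum_3)

lemma tprod_zero:
  assumes "\<And>x. \<bar>x\<bar> \<ge> 1 \<Longrightarrow> A x = 0" "\<And>x. \<bar>x\<bar> \<ge> 1 \<Longrightarrow> B x = 0" "\<And>x. \<bar>x\<bar> \<ge> 1 \<Longrightarrow> C x = 0" "norm p > 3"
  shows "tprod A B C p = 0"
proof -
  have "\<bar>p $ 1\<bar> \<ge> 1 \<or> \<bar>p $ 2\<bar> \<ge> 1 \<or> \<bar>p $ 3\<bar> \<ge> 1" using norm3_le[of p] assms(4) by linarith
  then show ?thesis unfolding tprod_def using assms by auto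
qed

text \<open>Half the width of \<open>bump\<close> and the same integral, so the difference of the
  two has zero mean; it is also even, hence it is the second derivative of a compactly supported
  function, \<open>qbump\<close>.\<close>

definition bump2 :: "real \<Rightarrow> real" where "bump2 x = 2 * bump (2 * x)"
lemma smooth_bump2: "smooth {1} bump2"
  unfolding bump2_def[abs_def] by (intro smooth_mult smooth_compose[OF smooth_bump] smooth_const smooth_id)
lemma bump2_zero: "\<bar>x\<bar> \<ge> 1 \<Longrightarrow> bump2 x = 0"
  using bump_zero[of "2 * x"] by (simp add: bump2_def)

lemma tprod_test_fun:
  assumes "smooth {1} A" "smooth {1} B" "smooth {1} C"
    "\<And>x. \<bar>x\<bar> \<ge> 1 \<Longrightarrow> A x = 0" "\<And>x. \<bar>x\<bar> \<ge> 1 \<Longrightarrow> B x = 0" "\<And>x. \<bar>x\<bar> \<ge> 1 \<Longrightarrow> C x = 0"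
  shows "test_fun (tprod A B C)"
  unfolding test_fun_iff bsupp_def using smooth_tprod[OF assms(1-3)] tprod_zero[of A B C] assms(4-6) by blast

definition mass :: real where "mass = (\<integral>p. tprod bump bump bump p \<partial>lborel)"

lemma tprod_bump_test: "test_fun (tprod bump bump bump)"
  by (intro tprod_test_fun smooth_bump bump_zero)

lemma mass_pos: "mass > 0"
proof -
  let ?f = "tprod bump bump bump"
  have i: "integrable lborel ?f" by (intro cc_integrable test_fun_cc tprod_bump_test)
  have nn: "?f p \<ge> 0" for p by (simp add: tprod_def bump_nonneg)
  have "mass \<noteq> 0"
  proof
    assume "mass = 0"
    then have "AE p in lborel. ?f p = 0"
      using integral_nonneg_eq_0_iff_AE[OF i] nn by (simp add: mass_def)
    have "?f p > 0" if "p \<in> ball 0 1" for p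
    proof -
      have "\<bar>p $ i\<bar> < 1" for i using component_le_norm_cart[of p i] that by simp
      then show ?thesis by (simp add: tprod_def bump_pos)
    qed
    note pos = this
    have "AE p in lborel. p \<notin> ball (0::real^3) 1"
      using \<open>AE p in lborel. ?f p = 0\<close>
    proof (rule eventually_mono)
      fix p assume "?f p = 0"
      then show "p \<notin> ball 0 1" using pos[of p] by (metis less_irrefl)
    qed
    then have "emeasure lborel (ball 0 1 :: (real^3) set) = 0"
      by (subst (asm) AE_iff_measurable[where N = "ball 0 1"]) auto
    then show False using emeasure_lborel_ball_finite content_ball_pos[of 1 "0::real^3"] by (simp add: measure_def)
  qed
  moreover have "mass \<ge> 0" unfolding mass_def using nn by (simp add: Bochner_Integration.integral_nonneg)
  ultimately show ?thesis by simp
qed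

text \<open>The factor 8^k compensates the scaling by 2^k in three dimensions. Dyadic scales are
  used because the Sobolev bound telescopes over k.\<close>

definition moll :: "nat \<Rightarrow> real^3 \<Rightarrow> real" where
  "moll k p = 8 ^ k * tprod bump bump bump (2 ^ k *\<^sub>R p) / mass"

lemma has_dd_scale: "has_dd e f g \<Longrightarrow> has_dd e (\<lambda>p. f (c *\<^sub>R p)) (\<lambda>p. c * g (c *\<^sub>R p))"
  unfolding has_dd_def
proof
  fix x
  assume "\<forall>x. ((\<lambda>s. f (x + s *\<^sub>R e)) has_real_derivative g x) (at 0)"
  then have "((\<lambda>s. f (c *\<^sub>R x + s *\<^sub>R e)) has_real_derivative g (c *\<^sub>R x)) (at (c * 0))" by simp
  moreover have "((\<lambda>s. c * s) has_real_derivative c) (at (0::real))"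
    by (auto intro!: derivative_eq_intros)
  ultimately have "((\<lambda>s. f (c *\<^sub>R x + (c * s) *\<^sub>R e)) has_real_derivative g (c *\<^sub>R x) * c) (at 0)"
    using DERIV_chain2[where f = "\<lambda>s. f (c *\<^sub>R x + s *\<^sub>R e)" and g = "\<lambda>s. c * s" and x = 0] by blast
  then show "((\<lambda>s. f (c *\<^sub>R (x + s *\<^sub>R e))) has_real_derivative c * g (c *\<^sub>R x)) (at 0)"
    by (simp add: scaleR_add_right mult.commute)
qed

lemma smooth_scale:
  fixes f :: "'a::real_normed_vector \<Rightarrow> real"
  assumes "smooth B f" shows "smooth B (\<lambda>p. f (c *\<^sub>R p))"
proof -
  have "ck B n (\<lambda>p. f (c *\<^sub>R p))" if "smooth B f" for n and f :: "'a \<Rightarrow> real" using that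
  proof (induction n arbitrary: f)
    case 0 then show ?case using smooth_cont[of B f]
      by (auto intro!: continuous_on_compose2[of UNIV f] continuous_intros)
  next
    case (Suc n)
    show ?case
    proof (rule ck_SucI)
      show "continuous_on UNIV (\<lambda>p. f (c *\<^sub>R p))" using smooth_cont[OF Suc.prems]
        by (auto intro!: continuous_on_compose2[of UNIV f] continuous_intros)
      fix e assume e: "e \<in> B"
      have "ck B n (\<lambda>p. dd e f (c *\<^sub>R p))" by (rule Suc.IH[OF smooth_dd[OF Suc.prems e]])
      then show "\<exists>g. has_dd e (\<lambda>p. f (c *\<^sub>R p)) g \<and> ck B n g"
        using has_dd_scale[OF smooth_has_dd[OF Suc.prems e]] ck_mult[OF ck_const] by blast
    qed
  qed
  then show ?thesis using assms by (simp add: smooth_def)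
qed

lemma test_fun_scale: "test_fun f \<Longrightarrow> c \<noteq> 0 \<Longrightarrow> test_fun (\<lambda>p. f (c *\<^sub>R p))"
proof -
  assume f: "test_fun f" and c: "c \<noteq> 0"
  then obtain r where r: "\<And>x. norm x > r \<Longrightarrow> f x = 0" by (auto simp: test_fun_iff bsupp_def)
  have "f (c *\<^sub>R p) = 0" if "norm p > r / \<bar>c\<bar>" for p
    by (rule r) (use that c in \<open>simp add: field_simps\<close>)
  then show ?thesis using f smooth_scale by (auto simp: test_fun_iff bsupp_def)
qed

lemma test_fun_cmult: "test_fun f \<Longrightarrow> test_fun (\<lambda>p. c * f p)"
  by (auto simp: test_fun_iff bsupp_def smooth_cmult)

lemma moll_test: "test_fun (moll k)"
  using test_fun_cmult[OF test_fun_scale[OF tprod_bump_test, of "2 ^ k"], of "8 ^ k / mass"]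
  by (simp add: moll_def[abs_def])
lemma moll_nonneg: "moll k p \<ge> 0"
  using mass_pos by (simp add: moll_def tprod_def bump_nonneg)
lemma moll_zero: "norm p > 3 / 2 ^ k \<Longrightarrow> moll k p = 0"
  using tprod_zero[of bump bump bump "2 ^ k *\<^sub>R p"] bump_zero by (simp add: moll_def field_simps)
lemma moll_integral: "(\<integral>p. moll k p \<partial>lborel) = 1"
proof -
  have "mass = \<bar>2 ^ k\<bar> ^ DIM(real^3) * (\<integral>p. tprod bump bump bump (0 + 2 ^ k *\<^sub>R p) \<partial>lborel)"
    unfolding mass_def
    by (rule lborel_integral_affine) (auto intro: cc_measurable test_fun_cc tprod_bump_test)
  then have "mass = 8 ^ k * (\<integral>p. tprod bump bump bump (2 ^ k *\<^sub>R p) \<partial>lborel)"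
    by (simp flip: power_mult add: mult.commute[of k] ) (simp add: power_mult)
  then show ?thesis using mass_pos by (simp add: moll_def[abs_def])
qed

section \<open>Mollification in L^2\<close>

lemma conv_continuous:
  assumes "sq_int g" "cc \<phi>" shows "continuous_on UNIV (conv g \<phi>)"
proof -
  have "l2_cont_UNIV (\<lambda>_. g)" using assms by (simp add: l2_cont_UNIV_def)
  from tconv_continuous[OF this assms(2)] have "continuous_on UNIV (\<lambda>p. tconv (\<lambda>_. g) \<phi> (0, p))"
    by (rule continuous_on_compose2) (auto intro: continuous_intros)
  then show ?thesis by (simp add: tconv_def)
qed

text \<open>Write g \<phi> as (g sqrt \<phi>) times sqrt \<phi>. Since \<phi> has mass 1,
  Cauchy-Schwarz bounds the square of the convolution by the convolution of g^2 with \<phi>, and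
  integrating in p first gives the claim.\<close>

lemma young:
  assumes g: "sq_int g" and c: "cc \<phi>" and nn: "\<And>p. \<phi> p \<ge> 0" and one: "(\<integral>p. \<phi> p \<partial>lborel) = 1"
  shows "sq_int (conv g \<phi>)" "nsq (conv g \<phi>) \<le> nsq g"
proof -
  have m[measurable]: "g \<in> borel_measurable borel" "\<phi> \<in> borel_measurable borel"
    using g c by (auto intro: cc_measurable sq_int_measurable)
  have mc[measurable]: "conv g \<phi> \<in> borel_measurable borel"
    by (rule borel_measurable_continuous_onI[OF conv_continuous[OF g c]])
  obtain C where C: "C > 0" "\<And>x. \<bar>\<phi> x\<bar> \<le> C" using cc_bounded[OF c] by blast
  have r1: "(\<integral>q. \<phi> (p - q) \<partial>lborel) = 1" for p
    using lborel_integral_affine[of \<phi> "-1" p] one by simp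
  have cs: "cc (\<lambda>q. sqrt (\<phi> (p - q)))" for p
  proof -
    have "cc (\<lambda>q. \<phi> (p - q))" by (rule cc_reflect[OF c])
    then show ?thesis by (auto simp: cc_def bsupp_def intro!: continuous_intros)
  qed
  have sg: "sq_int (\<lambda>q. sqrt (\<phi> (p - q)) * g q)" for p
  proof (rule sq_int_bdd_mult[OF g])
    show "\<bar>sqrt (\<phi> (p - x))\<bar> \<le> sqrt C" for x using C(2)[of "p - x"] nn by simp
  qed (use cs cc_measurable in auto)
  have pw: "(conv g \<phi> p)\<^sup>2 \<le> (\<integral>q. (g q)\<^sup>2 * \<phi> (p - q) \<partial>lborel)" for p
  proof -
    have "(\<integral>q. (sqrt (\<phi> (p - q)) * g q) * sqrt (\<phi> (p - q)) \<partial>lborel)\<^sup>2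
      \<le> nsq (\<lambda>q. sqrt (\<phi> (p - q)) * g q) * nsq (\<lambda>q. sqrt (\<phi> (p - q)))"
      by (rule cauchy_schwarz[OF sg sq_int_cc[OF cs]])
    moreover have "(\<lambda>q. (sqrt (\<phi> (p - q)) * g q) * sqrt (\<phi> (p - q))) = (\<lambda>q. g q * \<phi> (p - q))"
      using nn by (auto simp: fun_eq_iff mult.assoc mult.left_commute real_sqrt_mult_self)
    moreover have "nsq (\<lambda>q. sqrt (\<phi> (p - q))) = 1" using nn r1 by simp
    moreover have "nsq (\<lambda>q. sqrt (\<phi> (p - q)) * g q) = (\<integral>q. (g q)\<^sup>2 * \<phi> (p - q) \<partial>lborel)"
      using nn by (simp add: power_mult_distrib mult.commute)
    ultimately show ?thesis by (simp add: conv_def)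
  qed
  have i2: "integrable lborel (\<lambda>q. (g q)\<^sup>2 * \<phi> (p - q))" for p
    using sg[of p] nn by (simp add: sq_int_def power_mult_distrib mult.commute)
  have "(\<integral>\<^sup>+p. ennreal ((conv g \<phi> p)\<^sup>2) \<partial>lborel) \<le> (\<integral>\<^sup>+p. (\<integral>\<^sup>+q. ennreal ((g q)\<^sup>2 * \<phi> (p - q)) \<partial>lborel) \<partial>lborel)"
  proof (rule nn_integral_mono)
    fix p
    have "(\<integral>\<^sup>+q. ennreal ((g q)\<^sup>2 * \<phi> (p - q)) \<partial>lborel) = ennreal (\<integral>q. (g q)\<^sup>2 * \<phi> (p - q) \<partial>lborel)"
      by (rule nn_integral_eq_integral[OF i2]) (simp add: nn)
    then show "ennreal ((conv g \<phi> p)\<^sup>2) \<le> (\<integral>\<^sup>+q. ennreal ((g q)\<^sup>2 * \<phi> (p - q)) \<partial>lborel)"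
      using pw[of p] by (simp add: ennreal_leI)
  qed
  also have "\<dots> = (\<integral>\<^sup>+q. (\<integral>\<^sup>+p. ennreal ((g q)\<^sup>2 * \<phi> (p - q)) \<partial>lborel) \<partial>lborel)"
    by (rule lborel_pair.Fubini') measurable
  also have "\<dots> = (\<integral>\<^sup>+q. ennreal ((g q)\<^sup>2) \<partial>lborel)"
  proof (rule nn_integral_cong)
    fix q
    have "(\<integral>\<^sup>+p. ennreal ((g q)\<^sup>2 * \<phi> (p - q)) \<partial>lborel) = ennreal ((g q)\<^sup>2) * (\<integral>\<^sup>+p. ennreal (\<phi> (p - q)) \<partial>lborel)"
      using nn by (simp add: ennreal_mult nn_integral_cmult)
    also have "(\<integral>\<^sup>+p. ennreal (\<phi> (p - q)) \<partial>lborel) = (\<integral>\<^sup>+p. ennreal (\<phi> p) \<partial>lborel)"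
      using lborel_nn_integral_affine[of "\<lambda>p. ennreal (\<phi> p)" 1 "- q"] by simp
    also have "\<dots> = 1" using nn_integral_eq_integral[OF cc_integrable[OF c]] nn one by simp
    finally show "(\<integral>\<^sup>+p. ennreal ((g q)\<^sup>2 * \<phi> (p - q)) \<partial>lborel) = ennreal ((g q)\<^sup>2)" by simp
  qed
  also have "\<dots> = ennreal (nsq g)"
    by (rule nn_integral_eq_integral) (use g in \<open>auto simp: sq_int_def\<close>)
  finally have *: "(\<integral>\<^sup>+p. ennreal ((conv g \<phi> p)\<^sup>2) \<partial>lborel) \<le> ennreal (nsq g)" .
  then have i: "integrable lborel (\<lambda>p. (conv g \<phi> p)\<^sup>2)"
    by (intro integrableI_bounded) (auto intro: le_less_trans)
  then show "sq_int (conv g \<phi>)" by (simp add: sq_int_def)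
  show "nsq (conv g \<phi>) \<le> nsq g"
    using * nn_integral_eq_integral[OF i] by (simp add: ennreal_le_iff)
qed

lemma moll_cc: "cc (moll k)" by (rule test_fun_cc[OF moll_test])
lemmas young_moll = young[OF _ moll_cc moll_nonneg moll_integral]

lemma nsq_tendsto_0:
  fixes s :: "nat \<Rightarrow> real^3 \<Rightarrow> real"
  assumes "\<And>n. s n \<in> borel_measurable borel" "AE x in lborel. (\<lambda>n. s n x) \<longlonglongrightarrow> 0"
    "sq_int w" "\<And>n x. \<bar>s n x\<bar> \<le> \<bar>w x\<bar>"
  shows "(\<lambda>n. nsq (s n)) \<longlonglongrightarrow> 0"
proof -
  have "(\<lambda>n. nsq (s n)) \<longlonglongrightarrow> integral\<^sup>L (lborel :: (real^3) measure) (\<lambda>x. 0 :: real)"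
  proof (rule integral_dominated_convergence[where w = "\<lambda>x. (w x)\<^sup>2"])
    show "AE x in lborel. (\<lambda>n. (s n x)\<^sup>2) \<longlonglongrightarrow> 0"
      using assms(2) by (rule eventually_mono) (metis tendsto_power zero_power2)
    show "AE x in lborel. norm ((s n x)\<^sup>2) \<le> (w x)\<^sup>2" for n
      using assms(4)[of n] by (auto simp: abs_le_square_iff)
  qed (use assms in \<open>auto simp: sq_int_def\<close>)
  then show ?thesis by simp
qed

text \<open>Two approximations, each by dominated convergence: g is truncated in space by \<theta>
  and in value by \<open>cl\<close>, and the truncated function is then approximated by continuous
  ones.\<close>

lemma cc_dense:
  assumes g: "sq_int g" and \<epsilon>: "\<epsilon> > 0"
  shows "\<exists>c. cc c \<and> nsq (\<lambda>x. g x - c x) < \<epsilon>"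
proof -
  have m[measurable]: "g \<in> borel_measurable borel" using g by (rule sq_int_measurable)
  define \<theta> :: "nat \<Rightarrow> real^3 \<Rightarrow> real" where "\<theta> m x = max 0 (min 1 (real m + 1 - norm x))" for m x
  have \<theta>: "0 \<le> \<theta> m x" "\<theta> m x \<le> 1" "norm x \<le> real m \<Longrightarrow> \<theta> m x = 1" "norm x > real m + 1 \<Longrightarrow> \<theta> m x = 0" for m x
    by (auto simp: \<theta>_def)
  have \<theta>c: "continuous_on UNIV (\<theta> m)" for m unfolding \<theta>_def by (intro continuous_intros)
  have [measurable]: "\<theta> m \<in> borel_measurable borel" for m by (rule borel_measurable_continuous_onI[OF \<theta>c])
  define cl where "cl m y = max (- real m) (min (real m) y)" for m and y :: real
  have cl: "\<bar>cl m y\<bar> \<le> \<bar>y\<bar>" "\<bar>cl m y\<bar> \<le> real m" "\<bar>y\<bar> \<le> real m \<Longrightarrow> cl m y = y" for m y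
    by (auto simp: cl_def)
  have clc: "continuous_on UNIV (cl m)" for m unfolding cl_def by (intro continuous_intros)
  have [measurable]: "cl m \<in> borel_measurable borel" for m by (rule borel_measurable_continuous_onI[OF clc])
  define gm where "gm m x = \<theta> m x * cl m (g x)" for m x
  have [measurable]: "gm m \<in> borel_measurable borel" for m unfolding gm_def by measurable
  have gm_le: "\<bar>gm m x\<bar> \<le> \<bar>g x\<bar>" for m x
    unfolding gm_def abs_mult using \<theta>(1,2)[of m x] cl(1)[of m "g x"]
    by (metis abs_ge_zero abs_of_nonneg mult_left_le_one_le order_trans)
  have l1: "(\<lambda>m. nsq (\<lambda>x. g x - gm m x)) \<longlonglongrightarrow> 0"
  proof (rule nsq_tendsto_0[where w = "\<lambda>x. 2 * g x"])
    show "AE x in lborel. (\<lambda>m. g x - gm m x) \<longlonglongrightarrow> 0"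
    proof (rule AE_I2)
      fix x
      obtain N where N: "real N \<ge> max (norm x) \<bar>g x\<bar>" using real_arch_simple by blast
      have "eventually (\<lambda>m. g x - gm m x = 0) sequentially"
        unfolding eventually_sequentially
      proof (intro exI[of _ N] allI impI)
        fix m assume "N \<le> m"
        then have "norm x \<le> real m" "\<bar>g x\<bar> \<le> real m" using N by auto
        then show "g x - gm m x = 0" by (simp add: gm_def \<theta> cl)
      qed
      then show "(\<lambda>m. g x - gm m x) \<longlonglongrightarrow> 0" by (rule tendsto_eventually)
    qed
    show "\<bar>g x - gm m x\<bar> \<le> \<bar>2 * g x\<bar>" for m x using gm_le[of m x] by linarith
  qed (use g sq_int_cmult in auto)
  then obtain m where m: "nsq (\<lambda>x. g x - gm m x) < \<epsilon> / 4"
    using order_tendstoD(2)[OF l1, of "\<epsilon> / 4"] \<epsilon> by (auto simp: eventually_sequentially)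
  \<comment> \<open>Measurability yields continuous functions converging to g off a negligible set.
    They may be unbounded, so they are truncated exactly as g was; this gives the common majorant 2
    m \<theta>.\<close>
  have "g \<in> borel_measurable lebesgue" by (simp add: measurable_completion)
  then have "g measurable_on UNIV" by (rule lebesgue_measurable_imp_measurable_on) simp
  then obtain N h where N: "negligible N" and h: "\<And>n. continuous_on UNIV (h n)"
    "\<And>x. x \<notin> N \<Longrightarrow> (\<lambda>n. h n x) \<longlonglongrightarrow> g x"
    unfolding measurable_on_def by auto
  define c where "c n x = \<theta> m x * cl m (h n x)" for n x
  have cn: "continuous_on UNIV (c n)" for n unfolding c_def
    by (intro continuous_on_mult \<theta>c continuous_on_compose2[OF clc h(1)]) auto
  have cc: "cc (c n)" for n
    unfolding cc_def bsupp_def using cn \<theta>(4)[of m] by (auto simp: c_def intro!: exI[of _ "real m + 1"])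
  have c\<theta>: "cc (\<lambda>x. 2 * real m * \<theta> m x)"
    unfolding cc_def bsupp_def using \<theta>(4)[of m] by (auto intro!: exI[of _ "real m + 1"] continuous_intros \<theta>c)
  have l2: "(\<lambda>n. nsq (\<lambda>x. gm m x - c n x)) \<longlonglongrightarrow> 0"
  proof (rule nsq_tendsto_0[where w = "\<lambda>x. 2 * real m * \<theta> m x"])
    show "(\<lambda>x. gm m x - c n x) \<in> borel_measurable borel" for n
      using cc_measurable[OF cc] by measurable
    have "AE x in lebesgue. (\<lambda>n. gm m x - c n x) \<longlonglongrightarrow> 0"
    proof (rule AE_I')
      show "N \<in> null_sets lebesgue" using N by (simp add: negligible_iff_null_sets)
      show "{x \<in> space lebesgue. \<not> (\<lambda>n. gm m x - c n x) \<longlonglongrightarrow> 0} \<subseteq> N"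
      proof (rule ccontr, clarsimp simp: subset_iff)
        fix x assume x: "x \<notin> N" "\<not> (\<lambda>n. gm m x - c n x) \<longlonglongrightarrow> 0"
        have "isCont (cl m) (g x)" using clc by (simp add: continuous_on_eq_continuous_at)
        then have "(\<lambda>n. cl m (h n x)) \<longlonglongrightarrow> cl m (g x)" by (rule isCont_tendsto_compose) (rule h(2)[OF x(1)])
        then have "(\<lambda>n. gm m x - c n x) \<longlonglongrightarrow> gm m x - \<theta> m x * cl m (g x)"
          unfolding c_def by (intro tendsto_intros)
        then show False using x(2) by (simp add: gm_def)
      qed
    qed
    then show "AE x in lborel. (\<lambda>n. gm m x - c n x) \<longlonglongrightarrow> 0" by (simp add: AE_completion_iff)
    show "sq_int (\<lambda>x. 2 * real m * \<theta> m x)" by (rule sq_int_cc[OF c\<theta>])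
    fix n x
    have "\<bar>gm m x - c n x\<bar> = \<theta> m x * \<bar>cl m (g x) - cl m (h n x)\<bar>"
      using \<theta>(1)[of m x] by (simp add: gm_def c_def abs_mult flip: right_diff_distrib)
    also have "\<dots> \<le> \<theta> m x * (2 * real m)"
      using cl(2)[of m "g x"] cl(2)[of m "h n x"] \<theta>(1)[of m x] by (intro mult_left_mono) linarith+
    finally show "\<bar>gm m x - c n x\<bar> \<le> \<bar>2 * real m * \<theta> m x\<bar>" using \<theta>(1)[of m x] by (simp add: mult.commute abs_mult)
  qed
  then obtain n where n: "nsq (\<lambda>x. gm m x - c n x) < \<epsilon> / 4"
    using order_tendstoD(2)[OF l2, of "\<epsilon> / 4"] \<epsilon> by (auto simp: eventually_sequentially)
  have sgm: "sq_int (gm m)"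
    unfolding sq_int_def using gm_le[of m] g
    by (auto simp: sq_int_def abs_le_square_iff intro!: Bochner_Integration.integrable_bound[of lborel "\<lambda>x. (g x)\<^sup>2" "\<lambda>x. (gm m x)\<^sup>2"])
  have "nsq (\<lambda>x. (g x - gm m x) + (gm m x - c n x)) \<le> 2 * nsq (\<lambda>x. g x - gm m x) + 2 * nsq (\<lambda>x. gm m x - c n x)"
    by (intro nsq_add_le sq_int_diff g sgm sq_int_cc cc)
  then have "nsq (\<lambda>x. g x - c n x) < \<epsilon>" using m n by simp
  then show ?thesis using cc by blast
qed

text \<open>The convolution averages c over a ball of radius 3 / 2^k, so it converges wherever c is
  continuous, that is everywhere. The differences are bounded by 2 C and supported in one ball,
  hence dominated convergence applies.\<close>

lemma conv_moll_cc:
  assumes c: "cc c"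
  shows "(\<lambda>k. nsq (\<lambda>p. conv c (moll k) p - c p)) \<longlonglongrightarrow> 0"
proof -
  obtain r where r: "\<And>x. norm x > r \<Longrightarrow> c x = 0" using c by (auto simp: bsupp_def cc_def)
  obtain C where C: "C > 0" "\<And>x. \<bar>c x\<bar> \<le> C" using cc_bounded[OF c] by blast
  have sc: "sq_int c" by (rule sq_int_cc[OF c])
  let ?K = "cball (0::real^3) (r + 3)"
  have one: "(\<integral>q. moll k (p - q) \<partial>lborel) = 1" for k p
    using lborel_integral_affine[of "moll k" "-1" p] cc_measurable[OF moll_cc] moll_integral[of k] by simp
  have im: "integrable lborel (\<lambda>q. moll k (p - q))" for k p
    by (rule cc_integrable[OF cc_reflect[OF moll_cc]])
  have diff: "\<bar>conv c (moll k) p - c p\<bar> \<le> \<delta>"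
    if "\<And>q. norm (p - q) \<le> 3 / 2 ^ k \<Longrightarrow> \<bar>c q - c p\<bar> \<le> \<delta>" "\<delta> \<ge> 0" for k p \<delta>
  proof -
    have "conv c (moll k) p - c p = (\<integral>q. (c q - c p) * moll k (p - q) \<partial>lborel)"
      using conv_integrable[OF sc moll_cc, of k p] im[of k p] one[of k p]
      by (simp add: conv_def left_diff_distrib)
    also have "\<bar>\<dots>\<bar> \<le> (\<integral>q. \<bar>(c q - c p) * moll k (p - q)\<bar> \<partial>lborel)"
      by (rule integral_abs_bound)
    also have "\<dots> \<le> (\<integral>q. \<delta> * moll k (p - q) \<partial>lborel)"
    proof (rule integral_mono)
      show "integrable lborel (\<lambda>q. \<bar>(c q - c p) * moll k (p - q)\<bar>)"
        using conv_integrable[OF sc moll_cc, of k p] im[of k p] by (simp add: left_diff_distrib)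
      fix q show "\<bar>(c q - c p) * moll k (p - q)\<bar> \<le> \<delta> * moll k (p - q)"
        using that(1)[of q] moll_nonneg[of k "p - q"] moll_zero[of k "p - q"]
        by (cases "norm (p - q) \<le> 3 / 2 ^ k") (auto simp: abs_mult intro: mult_right_mono)
    qed (use im in simp)
    also have "\<dots> = \<delta>" using one by simp
    finally show ?thesis .
  qed
  have supp: "conv c (moll k) p - c p = 0" if "norm p > r + 3" for k p
  proof -
    have "3 / 2 ^ k \<le> (3::real)" by (simp add: divide_le_eq)
    then have "\<bar>c q - c p\<bar> \<le> 0" if "norm (p - q) \<le> 3 / 2 ^ k" for q
      using that \<open>norm p > r + 3\<close> norm_triangle_ineq2[of p q] r[of q] r[of p] by force
    from diff[OF this] show ?thesis by simp
  qed
  show ?thesis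
  proof (rule nsq_tendsto_0[where w = "\<lambda>p. 2 * C * indicator ?K p"])
    show "(\<lambda>p. conv c (moll k) p - c p) \<in> borel_measurable borel" for k
      using conv_continuous[OF sc moll_cc, of k] c by (auto simp: cc_def intro!: borel_measurable_continuous_onI continuous_intros)
    show "AE p in lborel. (\<lambda>k. conv c (moll k) p - c p) \<longlonglongrightarrow> 0"
    proof (rule AE_I2, rule LIMSEQ_I)
      fix p and \<epsilon> :: real assume \<epsilon>: "\<epsilon> > 0"
      obtain d where d: "d > 0" "\<And>q. dist q p < d \<Longrightarrow> dist (c q) (c p) < \<epsilon> / 2"
        using c \<epsilon> unfolding cc_def continuous_on_iff by (metis UNIV_I half_gt_zero)
      have "(\<lambda>k. 3 * (1/2) ^ k) \<longlonglongrightarrow> 3 * (0::real)" by (intro tendsto_intros LIMSEQ_power_zero) simp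
      from order_tendstoD(2)[OF this, of d] have "eventually (\<lambda>k. 3 * (1/2) ^ k < d) sequentially" using d by simp
      then obtain N where N: "\<And>k. k \<ge> N \<Longrightarrow> 3 / 2 ^ k < d" by (auto simp: eventually_sequentially power_one_over)
      have "norm (conv c (moll k) p - c p - 0) < \<epsilon>" if "k \<ge> N" for k
      proof -
        have "\<bar>c q - c p\<bar> \<le> \<epsilon> / 2" if "norm (p - q) \<le> 3 / 2 ^ k" for q
          using d(2)[of q] N[OF \<open>k \<ge> N\<close>] that by (simp add: dist_norm norm_minus_commute)
        then have "\<bar>conv c (moll k) p - c p\<bar> \<le> \<epsilon> / 2" by (rule diff) (use \<epsilon> in auto)
        then show ?thesis using \<epsilon> by simp
      qed
      then show "\<exists>N. \<forall>k\<ge>N. norm (conv c (moll k) p - c p - 0) < \<epsilon>" by blast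
    qed
    have "emeasure lborel ?K < \<infinity>" by (rule emeasure_lborel_cball_finite)
    then show "sq_int (\<lambda>p. 2 * C * indicator ?K p)"
      by (intro sq_int_cmult) (auto simp: sq_int_def power2_eq_square indicator_inter_arith[symmetric] intro!: integrable_real_indicator borel_measurable_indicator)
    fix k p
    have b: "\<bar>conv c (moll k) p - c p\<bar> \<le> 2 * C"
    proof (rule diff)
      show "\<bar>c q - c p\<bar> \<le> 2 * C" for q using C(2)[of q] C(2)[of p] by linarith
    qed (use C in simp)
    show "\<bar>conv c (moll k) p - c p\<bar> \<le> \<bar>2 * C * indicator ?K p\<bar>"
      using b supp[of p k] C by (cases "p \<in> ?K") auto
  qed
qed

theorem conv_moll_tendsto:
  assumes g: "sq_int g"
  shows "(\<lambda>k. nsq (\<lambda>p. conv g (moll k) p - g p)) \<longlonglongrightarrow> 0"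
proof (rule LIMSEQ_I)
  fix \<epsilon> :: real assume \<epsilon>: "\<epsilon> > 0"
  \<comment> \<open>The triangle inequalities for squares below give a total below 8 \<epsilon> / 12
    + 2 \<epsilon> / 8 < \<epsilon>.\<close>
  obtain c where c: "cc c" "nsq (\<lambda>x. g x - c x) < \<epsilon> / 12" using cc_dense[OF g, of "\<epsilon> / 12"] \<epsilon> by auto
  have sc: "sq_int c" by (rule sq_int_cc[OF c(1)])
  obtain N where N: "\<And>k. k \<ge> N \<Longrightarrow> nsq (\<lambda>p. conv c (moll k) p - c p) < \<epsilon> / 8"
    using order_tendstoD(2)[OF conv_moll_cc[OF c(1)], of "\<epsilon> / 8"] \<epsilon> by (auto simp: eventually_sequentially)
  have "norm (nsq (\<lambda>p. conv g (moll k) p - g p) - 0) < \<epsilon>" if "k \<ge> N" for k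
  proof -
    have sd: "sq_int (\<lambda>x. g x - c x)" by (intro sq_int_diff g sc)
    have s1: "sq_int (conv (\<lambda>x. g x - c x) (moll k))" by (rule young_moll[OF sd])
    have s2: "sq_int (\<lambda>p. conv c (moll k) p - c p)" by (intro sq_int_diff young_moll sc)
    have eq: "(\<lambda>p. conv g (moll k) p - g p) = (\<lambda>p. (conv (\<lambda>x. g x - c x) (moll k) p - (g p - c p)) + (conv c (moll k) p - c p))"
      using conv_diff_left[OF g sc moll_cc] by auto
    have "nsq (\<lambda>p. conv g (moll k) p - g p) = nsq (\<lambda>p. (conv (\<lambda>x. g x - c x) (moll k) p - (g p - c p)) + (conv c (moll k) p - c p))"
      by (rule arg_cong[where f = nsq, OF eq])
    also have "\<dots> \<le> 2 * nsq (\<lambda>p. conv (\<lambda>x. g x - c x) (moll k) p - (g p - c p)) + 2 * nsq (\<lambda>p. conv c (moll k) p - c p)"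
      by (rule nsq_add_le[OF sq_int_diff[OF s1 sd] s2])
    finally have "nsq (\<lambda>p. conv g (moll k) p - g p) \<le> 2 * nsq (\<lambda>p. conv (\<lambda>x. g x - c x) (moll k) p - (g p - c p)) + 2 * nsq (\<lambda>p. conv c (moll k) p - c p)" .
    moreover have "nsq (\<lambda>p. conv (\<lambda>x. g x - c x) (moll k) p - (g p - c p)) \<le> 2 * nsq (conv (\<lambda>x. g x - c x) (moll k)) + 2 * nsq (\<lambda>x. g x - c x)"
      by (rule nsq_diff_le[OF s1 sd])
    moreover have "nsq (conv (\<lambda>x. g x - c x) (moll k)) \<le> nsq (\<lambda>x. g x - c x)" by (rule young_moll(2)[OF sd])
    ultimately have "nsq (\<lambda>p. conv g (moll k) p - g p) < \<epsilon>" using c(2) N[OF that] \<epsilon> by linarith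
    then show ?thesis by simp
  qed
  then show "\<exists>N. \<forall>k\<ge>N. norm (nsq (\<lambda>p. conv g (moll k) p - g p) - 0) < \<epsilon>" by blast
qed

lemma nsq_zero_AE: "sq_int f \<Longrightarrow> nsq f = 0 \<Longrightarrow> AE x in lborel. f x = 0"
  using integral_nonneg_eq_0_iff_AE[of lborel "\<lambda>x. (f x)\<^sup>2"] by (simp add: sq_int_def)

text \<open>Both functions are the L^2 limit of the same mollifications. The consequence is
  uniqueness of weak derivatives, which makes integrals of the arbitrarily chosen \<open>wd\<close>
  meaningful.\<close>

lemma conv_moll_inj:
  assumes g: "sq_int g" and h: "sq_int h" and e: "\<And>k. conv g (moll k) = conv h (moll k)"
  shows "AE x in lborel. g x = h x"
proof -
  have sg: "sq_int (\<lambda>p. conv g (moll k) p - g p)" for k by (intro sq_int_diff young_moll g)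
  have sh: "sq_int (\<lambda>p. conv g (moll k) p - h p)" for k by (intro sq_int_diff young_moll g h)
  have "nsq (\<lambda>p. g p - h p) \<le> 2 * nsq (\<lambda>p. conv g (moll k) p - h p) + 2 * nsq (\<lambda>p. conv g (moll k) p - g p)" for k
    using nsq_diff_le[OF sh[of k] sg[of k]] by simp
  moreover have "(\<lambda>k. 2 * nsq (\<lambda>p. conv g (moll k) p - h p) + 2 * nsq (\<lambda>p. conv g (moll k) p - g p)) \<longlonglongrightarrow> 2 * 0 + 2 * 0"
    using conv_moll_tendsto[OF h] by (intro tendsto_intros conv_moll_tendsto g) (simp add: e)
  ultimately have "nsq (\<lambda>p. g p - h p) \<le> 0"
    by (intro LIMSEQ_le_const[where X = "\<lambda>k. 2 * nsq (\<lambda>p. conv g (moll k) p - h p) + 2 * nsq (\<lambda>p. conv g (moll k) p - g p)"]) auto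
  then have "nsq (\<lambda>p. g p - h p) = 0" using nsq_nonneg[of "\<lambda>p. g p - h p"] by linarith
  from nsq_zero_AE[OF sq_int_diff[OF g h] this] show ?thesis by simp
qed

lemma weak_deriv_unique:
  assumes "weak_deriv es f g" "weak_deriv es f h" "set es \<subseteq> dirs"
  shows "AE x in lborel. g x = h x"
  by (rule conv_moll_inj)
     (use assms in \<open>auto simp: weak_deriv_def conv_weak_deriv[OF assms(1) moll_test assms(3), symmetric] conv_weak_deriv[OF assms(2) moll_test assms(3)]\<close>)

text \<open>Consecutive dyadic mollifiers differ by second derivatives of kernels whose \<open>L\<^sup>2\<close> norms decay
  geometrically. Summing up, \<open>u * moll k\<close> is bounded by \<open>u\<close> and its pure second derivatives in \<open>L\<^sup>2\<close>;
  this is the embedding of \<open>H\<^sup>2\<close> into \<open>L\<^sup>\<infinity>\<close>.\<close>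

lemma sobolev_kernels:
  obtains F :: "nat \<Rightarrow> real^3 \<Rightarrow> real^3 \<Rightarrow> real" and K where
    "\<And>k e. e \<in> dirs \<Longrightarrow> test_fun (F k e)" "K \<ge> 0" "\<And>k e. e \<in> dirs \<Longrightarrow> nsq (F k e) \<le> K * (1/2) ^ k"
    "\<And>k p. moll k p - moll (Suc k) p = dd ex (dd ex (F k ex)) p + dd ey (dd ey (F k ey)) p + dd ez (dd ez (F k ez)) p"
proof -
  \<comment> \<open>Telescoping of a product of three factors: B B B - B2 B2 B2 = (B - B2) B B + B2
    (B - B2) B + B2 B2 (B - B2), with B = \<open>bump\<close>, B2 = \<open>bump2\<close>, and B - B2
    the second derivative of \<open>qbump\<close>.\<close>
  define G where "G e = (if e = ex then tprod qbump bump bump else if e = ey then tprod bump2 qbump bump else tprod bump2 bump2 qbump)" for e :: "real^3"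
  have ne: "ex \<noteq> ey" "ex \<noteq> ez" "ey \<noteq> ez" by (metis exyz_nth zero_neq_one)+
  have Gt: "test_fun (G e)" for e
    unfolding G_def by (auto intro!: tprod_test_fun smooth_bump smooth_bump2 smooth_qbump(1) bump_zero bump2_zero qbump_zero)
  \<comment> \<open>Two derivatives contribute 4^k, so the prefactor 2^k reproduces the 8^k of
    \<open>moll\<close>. The squared L^2 norm scales as 4^k / 8^k = 2^-k.\<close>
  define F where "F k e = (\<lambda>p. 2 ^ k / mass * G e (2 ^ k *\<^sub>R p))" for k :: nat and e
  have Ft: "test_fun (F k e)" for k e
    unfolding F_def by (intro test_fun_cmult test_fun_scale Gt) simp
  define L where "L = (\<lambda>x. bump x - bump2 x)"
  have hw: "has_dd 1 wave L" using wave_has_dd by (simp add: L_def bump2_def)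
  have D: "dd e (dd e (F k e)) = (\<lambda>p. 8 ^ k / mass * dd e (dd e (G e)) (2 ^ k *\<^sub>R p))" if "e \<in> dirs" for k e
  proof -
    have s: "smooth dirs (G e)" using Gt by (simp add: test_fun_iff)
    have "has_dd e (F k e) (\<lambda>p. 2 ^ k / mass * (2 ^ k * dd e (G e) (2 ^ k *\<^sub>R p)))"
      unfolding F_def by (intro has_dd_cmult has_dd_scale smooth_has_dd[OF s that])
    moreover have "has_dd e (\<lambda>p. 2 ^ k / mass * (2 ^ k * dd e (G e) (2 ^ k *\<^sub>R p))) (\<lambda>p. 2 ^ k / mass * (2 ^ k * (2 ^ k * dd e (dd e (G e)) (2 ^ k *\<^sub>R p))))"
      by (intro has_dd_cmult has_dd_scale smooth_has_dd[OF smooth_dd[OF s that] that])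
    moreover have "(8::real) ^ k = 2 ^ k * 2 ^ k * 2 ^ k" by (simp flip: power_mult_distrib)
    ultimately show ?thesis by (simp add: has_dd_imp_dd mult.assoc)
  qed
  have E: "dd ex (dd ex (G ex)) = tprod L bump bump" "dd ey (dd ey (G ey)) = tprod bump2 L bump" "dd ez (dd ez (G ez)) = tprod bump2 bump2 L"
    using ne by (simp_all add: G_def dd_tprod[OF smooth_qbump(2)] dd_tprod[OF hw] not_sym[OF ne(1)] not_sym[OF ne(2)] not_sym[OF ne(3)])
  have dec: "moll k p - moll (Suc k) p = dd ex (dd ex (F k ex)) p + dd ey (dd ey (F k ey)) p + dd ez (dd ez (F k ez)) p" for k p
    unfolding D[OF exyz_dirs(1)] D[OF exyz_dirs(2)] D[OF exyz_dirs(3)] E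
    using mass_pos by (simp add: moll_def tprod_def L_def bump2_def field_simps)
  define K where "K = (nsq (G ex) + nsq (G ey) + nsq (G ez)) / mass\<^sup>2"
  have "nsq (F k e) \<le> K * (1/2) ^ k" if "e \<in> dirs" for k e
  proof -
    have "nsq (G e) = \<bar>2 ^ k\<bar> ^ DIM(real^3) * (\<integral>p. (G e (0 + 2 ^ k *\<^sub>R p))\<^sup>2 \<partial>lborel)"
      by (rule lborel_integral_affine) (use cc_measurable[OF test_fun_cc[OF Gt[of e]]] in measurable)
    then have "nsq (G e) = 8 ^ k * (\<integral>p. (G e (2 ^ k *\<^sub>R p))\<^sup>2 \<partial>lborel)"
      by (simp flip: power_mult add: mult.commute[of k]) (simp add: power_mult)
    moreover have "nsq (F k e) = 4 ^ k / mass\<^sup>2 * (\<integral>p. (G e (2 ^ k *\<^sub>R p))\<^sup>2 \<partial>lborel)"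
      unfolding F_def power_mult_distrib power_divide
      by (simp flip: power_mult add: mult.commute[of k]) (simp add: power_mult)
    moreover have "(8::real) ^ k = 4 ^ k * 2 ^ k" by (simp flip: power_mult_distrib)
    ultimately have "nsq (F k e) = nsq (G e) / mass\<^sup>2 * (1/2) ^ k"
      using mass_pos by (simp add: field_simps power_one_over)
    also have "\<dots> \<le> K * (1/2) ^ k"
    proof (intro mult_right_mono)
      show "nsq (G e) / mass\<^sup>2 \<le> K" unfolding K_def
        using that nsq_nonneg[of "G ex"] nsq_nonneg[of "G ey"] nsq_nonneg[of "G ez"]
        by (intro divide_right_mono) (auto simp: dirs_def)
    qed simp
    finally show ?thesis .
  qed
  moreover have "K \<ge> 0" unfolding K_def by (intro divide_nonneg_nonneg add_nonneg_nonneg nsq_nonneg) simp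
  ultimately show ?thesis using that[of F K] Ft dec by blast
qed

theorem sobolev_conv:
  "\<exists>S\<ge>0. \<forall>u g k p. sq_int u \<and> (\<forall>e\<in>dirs. weak_deriv [e, e] u (g e)) \<longrightarrow>
     \<bar>conv u (moll k) p\<bar> \<le> S * (sqrt (nsq u) + sqrt (nsq (g ex)) + sqrt (nsq (g ey)) + sqrt (nsq (g ez)))"
proof -
  obtain F K where F: "\<And>k e. e \<in> dirs \<Longrightarrow> test_fun (F k e)" and K: "K \<ge> 0" "\<And>k e. e \<in> dirs \<Longrightarrow> nsq (F k e) \<le> K * (1/2) ^ k"
    and dec: "\<And>k p. moll k p - moll (Suc k) p = dd ex (dd ex (F k ex)) p + dd ey (dd ey (F k ey)) p + dd ez (dd ez (F k ez)) p"
    using sobolev_kernels by blast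
  \<comment> \<open>The squared norms of the kernels decay like 2^-k, so the norms decay like
    \<rho>^k and the telescoping sum is bounded by a geometric series, uniformly in k and p.\<close>
  define \<rho> where "\<rho> = sqrt (1/2)"
  have \<rho>: "0 < \<rho>" "\<rho> < 1" by (auto simp: \<rho>_def)
  define S where "S = sqrt (nsq (moll 0)) + sqrt K / (1 - \<rho>)"
  have S: "S \<ge> 0" "sqrt (nsq (moll 0)) \<le> S" "sqrt K / (1 - \<rho>) \<le> S" using \<rho> K by (auto simp: S_def)
  show ?thesis
  proof (intro exI[of _ S] conjI allI impI S(1), elim conjE)
    fix u g k p assume u: "sq_int u" and w: "\<forall>e\<in>dirs. weak_deriv [e, e] u (g e)"
    define H where "H = sqrt (nsq (g ex)) + sqrt (nsq (g ey)) + sqrt (nsq (g ez))"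
    have H: "H \<ge> 0" by (simp add: H_def)
    have t: "\<bar>conv u (dd e (dd e (F j e))) p\<bar> \<le> sqrt (nsq (g e)) * (sqrt K * \<rho> ^ j)" if "e \<in> dirs" for e j
    proof -
      have "conv u (pd_list [e, e] (F j e)) = conv (g e) (F j e)"
        using w that F by (intro conv_weak_deriv) auto
      moreover have "pd_list [e, e] (F j e) = dd e (dd e (F j e))" by (simp add: pd_list_Cons_dd del: pd_list.simps(2))
      moreover have "\<bar>conv (g e) (F j e) p\<bar> \<le> sqrt (nsq (g e)) * sqrt (nsq (F j e))"
        using w that by (intro conv_bound test_fun_cc F) (auto simp: weak_deriv_def)
      moreover have "sqrt (nsq (F j e)) \<le> sqrt (K * (1/2) ^ j)" using K(2)[OF that] by simp
      then have "sqrt (nsq (F j e)) \<le> sqrt K * \<rho> ^ j" by (simp add: real_sqrt_mult \<rho>_def real_sqrt_power)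
      then have "sqrt (nsq (g e)) * sqrt (nsq (F j e)) \<le> sqrt (nsq (g e)) * (sqrt K * \<rho> ^ j)" by (intro mult_left_mono) simp_all
      ultimately show ?thesis by simp
    qed
    have st: "\<bar>conv u (moll (Suc j)) p - conv u (moll j) p\<bar> \<le> H * sqrt K * \<rho> ^ j" for j
    proof -
      have tc: "cc (dd e (dd e (F j e)))" if "e \<in> dirs" for e using that F by (intro test_fun_cc test_fun_dd) auto
      have "conv u (moll j) p - conv u (moll (Suc j)) p = conv u (\<lambda>x. moll j x - moll (Suc j) x) p"
        by (rule conv_diff_right[symmetric, OF u moll_cc moll_cc])
      also have "\<dots> = conv u (\<lambda>x. dd ex (dd ex (F j ex)) x + dd ey (dd ey (F j ey)) x + dd ez (dd ez (F j ez)) x) p"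
        by (simp add: dec)
      also have "\<dots> = conv u (dd ex (dd ex (F j ex))) p + conv u (dd ey (dd ey (F j ey))) p + conv u (dd ez (dd ez (F j ez))) p"
        by (simp add: conv_add_right u tc cc_add)
      finally have "\<bar>conv u (moll j) p - conv u (moll (Suc j)) p\<bar> \<le> \<bar>conv u (dd ex (dd ex (F j ex))) p\<bar> + \<bar>conv u (dd ey (dd ey (F j ey))) p\<bar> + \<bar>conv u (dd ez (dd ez (F j ez))) p\<bar>"
        by linarith
      also have "\<dots> \<le> H * (sqrt K * \<rho> ^ j)"
        using t[OF exyz_dirs(1), of j] t[OF exyz_dirs(2), of j] t[OF exyz_dirs(3), of j] unfolding H_def distrib_right by linarith
      finally show ?thesis by (simp add: abs_minus_commute mult.assoc)
    qed
    have gs: "\<bar>conv u (moll k) p - conv u (moll 0) p\<bar> \<le> H * sqrt K * (\<Sum>j<k. \<rho> ^ j)"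
    proof (induction k)
      case (Suc k)
      then show ?case using st[of k] by (simp add: distrib_left)
    qed simp
    have "(\<Sum>j<k. \<rho> ^ j) \<le> 1 / (1 - \<rho>)"
    proof -
      have "(\<Sum>j<k. \<rho> ^ j) = (1 - \<rho> ^ k) / (1 - \<rho>)" using \<rho> by (subst sum_gp_strict) auto
      then show ?thesis using \<rho> by (simp add: divide_right_mono)
    qed
    then have "H * sqrt K * (\<Sum>j<k. \<rho> ^ j) \<le> H * sqrt K * (1 / (1 - \<rho>))"
      using H K by (intro mult_left_mono mult_nonneg_nonneg) auto
    then have "\<bar>conv u (moll k) p - conv u (moll 0) p\<bar> \<le> H * (sqrt K / (1 - \<rho>))" using gs by simp
    also have "\<dots> \<le> H * S" by (intro mult_left_mono S H)
    finally have "\<bar>conv u (moll k) p - conv u (moll 0) p\<bar> \<le> H * S" .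
    moreover have "\<bar>conv u (moll 0) p\<bar> \<le> sqrt (nsq u) * S"
      using conv_bound[OF u moll_cc, of 0 p] mult_left_mono[OF S(2), of "sqrt (nsq u)"] by simp
    ultimately have "\<bar>conv u (moll k) p\<bar> \<le> sqrt (nsq u) * S + H * S" by linarith
    then show "\<bar>conv u (moll k) p\<bar> \<le> S * (sqrt (nsq u) + sqrt (nsq (g ex)) + sqrt (nsq (g ey)) + sqrt (nsq (g ez)))"
      by (simp add: H_def algebra_simps)
  qed
qed

text \<open>The excess w of |u| over M is at most the distance between u and any of its
  mollifications, and that distance tends to 0 in L^2. This avoids extracting a subsequence that
  converges almost everywhere.\<close>

lemma bounded_of_conv_bounded:
  assumes u: "sq_int u" and M: "\<And>k p. \<bar>conv u (moll k) p\<bar> \<le> M"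
  shows "AE x in lborel. \<bar>u x\<bar> \<le> M"
proof -
  define w where "w x = max 0 (\<bar>u x\<bar> - M)" for x
  have M0: "M \<ge> 0" using M[of 0 0] by linarith
  have [measurable]: "u \<in> borel_measurable borel" using u by (rule sq_int_measurable)
  have mw [measurable]: "w \<in> borel_measurable borel" unfolding w_def by measurable
  have sw: "sq_int w"
    unfolding sq_int_def
  proof
    have "\<bar>w x\<bar> \<le> \<bar>u x\<bar>" for x using M0 by (auto simp: w_def)
    then have "(w x)\<^sup>2 \<le> (u x)\<^sup>2" for x by (simp add: abs_le_square_iff)
    moreover have "integrable lborel (\<lambda>x. (u x)\<^sup>2)" using u by (simp add: sq_int_def)
    ultimately show "integrable lborel (\<lambda>x. (w x)\<^sup>2)"
      by - (rule Bochner_Integration.integrable_bound[of lborel "\<lambda>x. (u x)\<^sup>2"], simp_all)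
  qed simp
  have "nsq w \<le> nsq (\<lambda>p. conv u (moll k) p - u p)" for k
  proof (rule nsq_mono)
    show "sq_int (\<lambda>p. conv u (moll k) p - u p)" by (intro sq_int_diff young_moll u)
    show "\<bar>w x\<bar> \<le> \<bar>conv u (moll k) x - u x\<bar>" for x
      using M[of k x] by (auto simp: w_def)
  qed (rule sw)
  then have "nsq w \<le> 0"
    using LIMSEQ_le_const[OF conv_moll_tendsto[OF u]] by blast
  then have "nsq w = 0" using nsq_nonneg[of w] by linarith
  from nsq_zero_AE[OF sw this] show ?thesis
    by (rule eventually_mono) (auto simp: w_def max_def split: if_splits)
qed

section \<open>Pairs of solutions\<close>

text \<open>Freezing a solution outside \<open>[0, 1]\<close> makes it \<open>L\<^sup>2\<close>-continuous on the whole line. It is not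
  differentiable in time at 0 and 1, but all cutoffs vanish near these points.\<close>

definition clamp01 :: "real \<Rightarrow> real" where "clamp01 t = max 0 (min 1 t)"

lemma clamp01_in: "clamp01 t \<in> {0..1}" by (auto simp: clamp01_def)
lemma clamp01_id: "t \<in> {0..1} \<Longrightarrow> clamp01 t = t" by (auto simp: clamp01_def)
lemma clamp01_cont: "isCont clamp01 t"
  unfolding clamp01_def[abs_def] by (intro continuous_intros)

lemma l2_cont_clamp:
  assumes "l2_cont F" "\<And>t. t \<in> {0..1} \<Longrightarrow> sq_int (F t)"
  shows "l2_cont_UNIV (\<lambda>t. F (clamp01 t))"
  unfolding l2_cont_UNIV_def
proof (intro conjI allI)
  fix t show "sq_int (F (clamp01 t))" using assms(2)[OF clamp01_in] .
  let ?h = "\<lambda>s. nsq (\<lambda>x. F s x - F (clamp01 t) x)"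
  have "continuous (at (clamp01 t) within {0..1}) ?h"
    using assms(1) clamp01_in[of t] by (simp add: continuous_within l2_cont_def)
  moreover have "(clamp01 \<longlongrightarrow> clamp01 t) (at t)" using clamp01_cont[of t] by (simp add: isCont_def)
  ultimately have "((\<lambda>s. ?h (clamp01 s)) \<longlongrightarrow> ?h (clamp01 t)) (at t)"
    using continuous_within_tendsto_compose'[of "clamp01 t" "{0..1}" ?h clamp01 "at t"] clamp01_in by blast
  then show "((\<lambda>s. nsq (\<lambda>x. F (clamp01 s) x - F (clamp01 t) x)) \<longlongrightarrow> 0) (at t)" by simp
qed

lemma l2_cont_UNIV_diff:
  assumes F: "l2_cont_UNIV F" and G: "l2_cont_UNIV G"
  shows "l2_cont_UNIV (\<lambda>t x. F t x - G t x)"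
  unfolding l2_cont_UNIV_def
proof (intro conjI allI)
  have s: "sq_int (F t)" "sq_int (G t)" for t using F G by (auto simp: l2_cont_UNIV_def)
  fix t show "sq_int (\<lambda>x. F t x - G t x)" by (intro sq_int_diff s)
  have "((\<lambda>\<sigma>. 2 * nsq (\<lambda>x. F \<sigma> x - F t x) + 2 * nsq (\<lambda>x. G \<sigma> x - G t x)) \<longlongrightarrow> 2 * 0 + 2 * 0) (at t)"
    using F G by (intro tendsto_intros) (auto simp: l2_cont_UNIV_def)
  then have l: "((\<lambda>\<sigma>. 2 * nsq (\<lambda>x. F \<sigma> x - F t x) + 2 * nsq (\<lambda>x. G \<sigma> x - G t x)) \<longlongrightarrow> 0) (at t)" by simp
  show "((\<lambda>\<sigma>. nsq (\<lambda>x. F \<sigma> x - G \<sigma> x - (F t x - G t x))) \<longlongrightarrow> 0) (at t)"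
  proof (rule Lim_null_comparison[OF _ l], rule always_eventually, rule allI)
    fix \<sigma>
    have "nsq (\<lambda>x. (F \<sigma> x - F t x) - (G \<sigma> x - G t x)) \<le> 2 * nsq (\<lambda>x. F \<sigma> x - F t x) + 2 * nsq (\<lambda>x. G \<sigma> x - G t x)"
      by (intro nsq_diff_le sq_int_diff s)
    moreover have "nsq (\<lambda>x. (F \<sigma> x - F t x) - (G \<sigma> x - G t x)) = nsq (\<lambda>x. F \<sigma> x - G \<sigma> x - (F t x - G t x))"
      by (rule arg_cong[where f = nsq]) auto
    ultimately show "norm (nsq (\<lambda>x. F \<sigma> x - G \<sigma> x - (F t x - G t x))) \<le> 2 * nsq (\<lambda>x. F \<sigma> x - F t x) + 2 * nsq (\<lambda>x. G \<sigma> x - G t x)"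
      by simp
  qed
qed

lemma l2_cont_UNIV_minus: "l2_cont_UNIV F \<Longrightarrow> l2_cont_UNIV (\<lambda>t x. - F t x)"
  unfolding l2_cont_UNIV_def
  by (auto intro: sq_int_minus simp: power2_commute)

lemma l2_cont_UNIV_add:
  assumes F: "l2_cont_UNIV F" and G: "l2_cont_UNIV G"
  shows "l2_cont_UNIV (\<lambda>t x. F t x + G t x)"
  using l2_cont_UNIV_diff[OF F l2_cont_UNIV_minus[OF G]] by simp

text \<open>Follows from s^2 - f^2 = (s - f)^2 + 2 f (s - f) and Cauchy-Schwarz. The filter is
  arbitrary since the result serves limits in time as well as limits of mollifications.\<close>

lemma weighted_nsq_tendsto:
  assumes s: "\<And>n. sq_int (s n)" and f: "sq_int f" and m[measurable]: "m \<in> borel_measurable borel"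
    and C: "\<And>x. \<bar>m x\<bar> \<le> C" and lim: "((\<lambda>n. nsq (\<lambda>x. s n x - f x)) \<longlongrightarrow> 0) F"
  shows "((\<lambda>n. \<integral>x. m x * (s n x)\<^sup>2 \<partial>lborel) \<longlongrightarrow> (\<integral>x. m x * (f x)\<^sup>2 \<partial>lborel)) F"
proof -
  have mf: "sq_int (\<lambda>x. m x * f x)" by (rule sq_int_bdd_mult[OF f m C])
  have sd: "sq_int (\<lambda>x. s n x - f x)" for n by (intro sq_int_diff s f)
  have msd: "sq_int (\<lambda>x. m x * (s n x - f x))" for n by (rule sq_int_bdd_mult[OF sd m C])
  have C0: "C \<ge> 0" using C[of 0] by linarith
  have "((\<lambda>n. C * nsq (\<lambda>x. s n x - f x) + 2 * (sqrt (nsq (\<lambda>x. m x * f x)) * sqrt (nsq (\<lambda>x. s n x - f x)))) \<longlongrightarrow>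
      C * 0 + 2 * (sqrt (nsq (\<lambda>x. m x * f x)) * sqrt 0)) F"
    by (intro tendsto_intros lim)
  then have l: "((\<lambda>n. C * nsq (\<lambda>x. s n x - f x) + 2 * (sqrt (nsq (\<lambda>x. m x * f x)) * sqrt (nsq (\<lambda>x. s n x - f x)))) \<longlongrightarrow> 0) F" by simp
  have "((\<lambda>n. (\<integral>x. m x * (s n x)\<^sup>2 \<partial>lborel) - (\<integral>x. m x * (f x)\<^sup>2 \<partial>lborel)) \<longlongrightarrow> 0) F"
  proof (rule Lim_null_comparison[OF _ l], rule always_eventually, rule allI)
    fix n
    have i1: "integrable lborel (\<lambda>x. m x * (s n x - f x) * (s n x - f x))" by (rule sq_int_mult_integrable[OF msd sd])
    have i2: "integrable lborel (\<lambda>x. m x * f x * (s n x - f x))" by (rule sq_int_mult_integrable[OF mf sd])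
    have i3: "integrable lborel (\<lambda>x. m x * f x * f x)" by (rule sq_int_mult_integrable[OF mf f])
    have "(\<lambda>x. m x * (s n x)\<^sup>2) = (\<lambda>x. m x * (s n x - f x) * (s n x - f x) + 2 * (m x * f x * (s n x - f x)) + m x * f x * f x)"
      by (auto simp: power2_eq_square algebra_simps)
    then have "(\<integral>x. m x * (s n x)\<^sup>2 \<partial>lborel) = (\<integral>x. m x * (s n x - f x) * (s n x - f x) \<partial>lborel)
        + 2 * (\<integral>x. m x * f x * (s n x - f x) \<partial>lborel) + (\<integral>x. m x * f x * f x \<partial>lborel)"
      using i1 i2 i3 by simp
    moreover have "(\<integral>x. m x * (f x)\<^sup>2 \<partial>lborel) = (\<integral>x. m x * f x * f x \<partial>lborel)" by (simp add: power2_eq_square mult.assoc)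
    moreover have "\<bar>\<integral>x. m x * f x * (s n x - f x) \<partial>lborel\<bar> \<le> sqrt (nsq (\<lambda>x. m x * f x)) * sqrt (nsq (\<lambda>x. s n x - f x))"
      by (rule cauchy_schwarz_abs[OF mf sd])
    moreover have "\<bar>\<integral>x. m x * (s n x - f x) * (s n x - f x) \<partial>lborel\<bar> \<le> C * nsq (\<lambda>x. s n x - f x)"
    proof -
      have "\<bar>\<integral>x. m x * (s n x - f x) * (s n x - f x) \<partial>lborel\<bar> \<le> (\<integral>x. \<bar>m x * (s n x - f x) * (s n x - f x)\<bar> \<partial>lborel)"
        by (rule integral_abs_bound)
      also have "\<dots> \<le> (\<integral>x. C * (s n x - f x)\<^sup>2 \<partial>lborel)"
      proof (rule integral_mono)
        show "\<bar>m x * (s n x - f x) * (s n x - f x)\<bar> \<le> C * (s n x - f x)\<^sup>2" for x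
          using mult_right_mono[OF C[of x], of "(s n x - f x)\<^sup>2"] by (simp add: abs_mult power2_eq_square mult.assoc)
      qed (use i1 sd[of n] in \<open>auto simp: sq_int_def\<close>)
      finally show ?thesis by simp
    qed
    ultimately show "norm ((\<integral>x. m x * (s n x)\<^sup>2 \<partial>lborel) - (\<integral>x. m x * (f x)\<^sup>2 \<partial>lborel))
      \<le> C * nsq (\<lambda>x. s n x - f x) + 2 * (sqrt (nsq (\<lambda>x. m x * f x)) * sqrt (nsq (\<lambda>x. s n x - f x)))"
      by simp
  qed
  then show ?thesis by (rule LIM_zero_cancel)
qed

lemma l2_cont_nsq_bounded:
  assumes F: "l2_cont_UNIV F" shows "\<exists>B\<ge>0. \<forall>t\<in>{0..1}. nsq (F t) \<le> B"
proof -
  have s: "sq_int (F t)" for t using F by (simp add: l2_cont_UNIV_def)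
  have "isCont (\<lambda>t. nsq (F t)) t" for t
    unfolding isCont_def using F weighted_nsq_tendsto[of F "F t" "\<lambda>_. 1" 1 "at t"] s by (simp add: l2_cont_UNIV_def)
  then have "continuous_on {0..1} (\<lambda>t. nsq (F t))" by (simp add: continuous_at_imp_continuous_on)
  then have "compact ((\<lambda>t. nsq (F t)) ` {0..1})" by (intro compact_continuous_image) auto
  then have "bounded ((\<lambda>t. nsq (F t)) ` {0..1})" by (rule compact_imp_bounded)
  then obtain B where "\<And>t. t \<in> {0..1} \<Longrightarrow> \<bar>nsq (F t)\<bar> \<le> B" unfolding bounded_iff real_norm_def by blast
  then show ?thesis by (intro exI[of _ "max 0 B"]) (auto simp: le_max_iff_disj abs_le_iff)
qed

text \<open>An iterated integral, as in \<open>normQ\<close> and \<open>A_R\<close>: F is only a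
  curve in L^2, and joint measurability in time and space is not among its properties.\<close>

abbreviation stint :: "(st \<Rightarrow> real) \<Rightarrow> (real \<Rightarrow> real^3 \<Rightarrow> real) \<Rightarrow> real" where
  "stint m F \<equiv> (\<integral>t. (\<integral>p. m (t, p) * (F t p)\<^sup>2 \<partial>lborel) \<partial>lborel)"

text \<open>A mollification is jointly continuous, so Fubini applies to it. At each fixed time the
  inner integrals converge, with the common bound C B on [0, 1]; dominated convergence in t finishes
  the proof. Measurability in t of the limiting inner integral is obtained from that
  convergence.\<close>

lemma tconv_weighted_tendsto:
  fixes m :: "st \<Rightarrow> real"
  assumes F: "l2_cont_UNIV F" and m[measurable]: "m \<in> borel_measurable borel"
    and C: "\<And>z. \<bar>m z\<bar> \<le> C" and supp: "\<And>t p. m (t, p) \<noteq> 0 \<Longrightarrow> t \<in> {0..1} \<and> norm p \<le> R"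
  shows "\<And>k. integrable lborel (\<lambda>z. m z * (tconv F (moll k) z)\<^sup>2)"
    and "(\<lambda>k. IT (\<lambda>z. m z * (tconv F (moll k) z)\<^sup>2)) \<longlonglongrightarrow> stint m F"
    and "integrable lborel (\<lambda>t. \<integral>p. m (t, p) * (F t p)\<^sup>2 \<partial>lborel)"
proof -
  have s: "sq_int (F t)" for t using F by (simp add: l2_cont_UNIV_def)
  obtain B where B: "B \<ge> 0" "\<And>t. t \<in> {0..1} \<Longrightarrow> nsq (F t) \<le> B" using l2_cont_nsq_bounded[OF F] by blast
  have C0: "C \<ge> 0" using C[of 0] by linarith
  have tm[measurable]: "tconv F (moll k) \<in> borel_measurable borel" for k
    by (rule borel_measurable_continuous_onI[OF tconv_continuous[OF F moll_cc]])
  let ?K = "{0..1::real} \<times> cball (0::real^3) R"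
  show int: "integrable lborel (\<lambda>z. m z * (tconv F (moll k) z)\<^sup>2)" for k
  proof -
    define c where "c = C * (B * nsq (moll k))"
    have "bounded ?K" by (intro bounded_Times) auto
    moreover have "?K \<in> sets borel" by (intro borel_closed closed_Times) auto
    ultimately have "integrable lborel (\<lambda>z. c * indicator ?K z)"
      using emeasure_bounded_finite[of ?K] by (intro integrable_mult_right integrable_real_indicator) auto
    moreover have bd: "norm (m z * (tconv F (moll k) z)\<^sup>2) \<le> c * indicator ?K z" for z
    proof (cases "z \<in> ?K")
      case True
      have "\<bar>tconv F (moll k) z\<bar> \<le> sqrt (nsq (F (fst z))) * sqrt (nsq (moll k))"
        unfolding tconv_def by (rule conv_bound[OF s moll_cc])
      then have "\<bar>tconv F (moll k) z\<bar> \<le> sqrt (nsq (F (fst z)) * nsq (moll k))" by (simp add: real_sqrt_mult)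
      then have "(tconv F (moll k) z)\<^sup>2 \<le> nsq (F (fst z)) * nsq (moll k)"
        using sqrt_ge_absD by blast
      also have "\<dots> \<le> B * nsq (moll k)" using B(2)[of "fst z"] True by (intro mult_right_mono) auto
      finally have "\<bar>m z\<bar> * (tconv F (moll k) z)\<^sup>2 \<le> C * (B * nsq (moll k))"
        using C[of z] C0 by (intro mult_mono) auto
      then show ?thesis using True by (simp add: c_def abs_mult)
    next
      case False
      then have "m z = 0" using supp[of "fst z" "snd z"] by (cases z) auto
      then show ?thesis using False by simp
    qed
    moreover have "(\<lambda>z. m z * (tconv F (moll k) z)\<^sup>2) \<in> borel_measurable lborel" by measurable
    ultimately have *: "integrable lborel (\<lambda>z. c * indicator ?K z)" "(\<lambda>z. m z * (tconv F (moll k) z)\<^sup>2) \<in> borel_measurable lborel"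
      by blast+
    show ?thesis
    proof (rule Bochner_Integration.integrable_bound[OF *])
      have "norm (m z * (tconv F (moll k) z)\<^sup>2) \<le> norm (c * indicator ?K z)" for z
        using bd[of z] unfolding real_norm_def by linarith
      then show "AE z in lborel. norm (m z * (tconv F (moll k) z)\<^sup>2) \<le> norm (c * indicator ?K z)"
        by (rule AE_I2)
    qed
  qed
  define h where "h k t = (\<integral>p. m (t, p) * (conv (F t) (moll k) p)\<^sup>2 \<partial>lborel)" for k t
  have h: "integrable lborel (h k)" "IT (\<lambda>z. m z * (tconv F (moll k) z)\<^sup>2) = (\<integral>t. h k t \<partial>lborel)" for k
  proof -
    have "integrable (lborel \<Otimes>\<^sub>M lborel) (\<lambda>z. m z * (tconv F (moll k) z)\<^sup>2)" using int[of k] by (simp add: lborel_prod)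
    from lborel_pair.integrable_fst'[OF this] lborel_pair.integral_fst'[OF this]
    show "integrable lborel (h k)" "IT (\<lambda>z. m z * (tconv F (moll k) z)\<^sup>2) = (\<integral>t. h k t \<partial>lborel)"
      by (simp_all add: h_def[abs_def] tconv_def lborel_prod)
  qed
  have m2[measurable]: "(\<lambda>p. m (t, p)) \<in> borel_measurable borel" for t by measurable
  have lim: "(\<lambda>k. h k t) \<longlonglongrightarrow> (\<integral>p. m (t, p) * (F t p)\<^sup>2 \<partial>lborel)" for t
    unfolding h_def by (rule weighted_nsq_tendsto[OF _ s m2 C conv_moll_tendsto[OF s]]) (rule young_moll[OF s])
  have bd: "\<bar>h k t\<bar> \<le> C * B * indicator {0..1} t" for k t
  proof (cases "t \<in> {0..1}")
    case True
    have "\<bar>h k t\<bar> \<le> (\<integral>p. \<bar>m (t, p) * (conv (F t) (moll k) p)\<^sup>2\<bar> \<partial>lborel)" unfolding h_def by (rule integral_abs_bound)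
    also have "\<dots> \<le> (\<integral>p. C * (conv (F t) (moll k) p)\<^sup>2 \<partial>lborel)"
    proof (rule integral_mono)
      have "integrable lborel (\<lambda>p. (m (t, p) * conv (F t) (moll k) p) * conv (F t) (moll k) p)"
        by (intro sq_int_mult_integrable sq_int_bdd_mult[OF _ m2 C] young_moll s)
      then show "integrable lborel (\<lambda>p. \<bar>m (t, p) * (conv (F t) (moll k) p)\<^sup>2\<bar>)" 
        by (intro integrable_abs) (simp add: power2_eq_square mult.assoc)
      show "integrable lborel (\<lambda>p. C * (conv (F t) (moll k) p)\<^sup>2)" using young_moll(1)[OF s] by (simp add: sq_int_def)
      show "\<bar>m (t, p) * (conv (F t) (moll k) p)\<^sup>2\<bar> \<le> C * (conv (F t) (moll k) p)\<^sup>2" for p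
        using mult_right_mono[OF C[of "(t, p)"], of "(conv (F t) (moll k) p)\<^sup>2"] by (simp add: abs_mult)
    qed
    also have "\<dots> = C * nsq (conv (F t) (moll k))" by simp
    also have "\<dots> \<le> C * B" using young_moll(2)[OF s, of t k] B(2)[OF True] C0 by (intro mult_left_mono) auto
    finally show ?thesis using True by simp
  next
    case False
    then have "m (t, p) = 0" for p using supp by blast
    then show ?thesis using False by (simp add: h_def)
  qed
  have hm: "h k \<in> borel_measurable lborel" for k using h(1) by (rule borel_measurable_integrable)
  have lm: "(\<lambda>t. \<integral>p. m (t, p) * (F t p)\<^sup>2 \<partial>lborel) \<in> borel_measurable lborel"
    by (rule borel_measurable_LIMSEQ_real[OF _ hm]) (rule lim)
  have wi: "integrable lborel (\<lambda>t. C * B * indicator {0..1::real} t)" by (intro integrable_mult_right integrable_real_indicator) auto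
  show "(\<lambda>k. IT (\<lambda>z. m z * (tconv F (moll k) z)\<^sup>2)) \<longlonglongrightarrow> stint m F"
    unfolding h(2)
    by (rule integral_dominated_convergence[OF lm hm wi]) (use lim bd in auto)
  show "integrable lborel (\<lambda>t. \<integral>p. m (t, p) * (F t p)\<^sup>2 \<partial>lborel)"
    by (rule integrable_dominated_convergence[where s = h, OF lm hm wi]) (use lim bd in auto)
qed

section \<open>Regularity and boundedness of solutions\<close>

lemma zk_weak: 
  assumes "zk_solution u" "t \<in> {0..1}" "set es \<subseteq> dirs" "length es \<le> 3"
  shows "weak_deriv es (u t) (wd es (u t))" "sq_int (wd es (u t))"
proof -
  have "\<exists>g. weak_deriv es (u t) g" using assms unfolding zk_solution_def by blast
  then show "weak_deriv es (u t) (wd es (u t))" unfolding wd_def by (rule someI_ex)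
  then show "sq_int (wd es (u t))" by (simp add: weak_deriv_def)
qed

lemma zk_l2_cont:
  assumes "zk_solution u" "set es \<subseteq> dirs" "length es \<le> 3"
  shows "l2_cont_UNIV (\<lambda>t. wd es (u (clamp01 t)))"
  using l2_cont_clamp[of "\<lambda>t. wd es (u t)"] zk_weak(2)[OF assms(1)] assms unfolding zk_solution_def by blast

lemma zk_sq: "zk_solution u \<Longrightarrow> t \<in> {0..1} \<Longrightarrow> sq_int (u t)"
  by (simp add: zk_solution_def)

lemma weak_deriv_Nil: "sq_int f \<Longrightarrow> weak_deriv [] f f" by (simp add: weak_deriv_def)

text \<open>\<open>zk_solution\<close> states time continuity for the chosen representatives
  \<open>wd es (u t)\<close>. The empty list covers u itself, since \<open>wd [] (u t)\<close>
  agrees with \<open>u t\<close> almost everywhere.\<close>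

lemma zk_l2_cont0:
  assumes u: "zk_solution u" shows "l2_cont_UNIV (\<lambda>t. u (clamp01 t))"
proof (rule l2_cont_clamp)
  show "sq_int (u t)" if "t \<in> {0..1}" for t using zk_sq[OF u that] .
  have ae: "AE x in lborel. wd [] (u t) x = u t x" if "t \<in> {0..1}" for t
    by (rule weak_deriv_unique[of "[]" "u t"]) (use zk_weak[OF u that, of "[]"] weak_deriv_Nil[OF zk_sq[OF u that]] in auto)
  have "nsq (\<lambda>x. wd [] (u s) x - wd [] (u t) x) = nsq (\<lambda>x. u s x - u t x)" if "s \<in> {0..1}" "t \<in> {0..1}" for s t
  proof (rule integral_cong_AE)
    show "AE x in lborel. (wd [] (u s) x - wd [] (u t) x)\<^sup>2 = (u s x - u t x)\<^sup>2"
      using ae[OF that(1)] ae[OF that(2)] by eventually_elim simp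
  qed (use zk_weak[OF u that(1), of "[]"] zk_weak[OF u that(2), of "[]"] zk_sq[OF u that(1)] zk_sq[OF u that(2)] sq_int_measurable in auto)
  note eq = this
  show "l2_cont u" unfolding l2_cont_def
  proof
    fix t :: real assume t: "t \<in> {0..1}"
    have "((\<lambda>s. nsq (\<lambda>x. wd [] (u s) x - wd [] (u t) x)) \<longlongrightarrow> 0) (at t within {0..1})"
      using u t unfolding zk_solution_def l2_cont_def by force
    moreover have "eventually (\<lambda>s. nsq (\<lambda>x. wd [] (u s) x - wd [] (u t) x) = nsq (\<lambda>x. u s x - u t x)) (at t within {0..1})"
      using eq t by (auto simp: eventually_at_filter)
    ultimately show "((\<lambda>s. nsq (\<lambda>x. u s x - u t x)) \<longlongrightarrow> 0) (at t within {0..1})"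
      by (rule Lim_transform_eventually)
  qed
qed

text \<open>Testing the derivative along e0 with \<open>pd_list es \<phi>\<close> shows that third
  derivatives of u are second derivatives of u_x, so the Sobolev bound can be applied to
  u_x.\<close>

lemma weak_deriv_shift:
  assumes w: "weak_deriv [e0] f h" and g: "weak_deriv (e0 # es) f g" and es: "set es \<subseteq> dirs"
  shows "weak_deriv es h g"
  unfolding weak_deriv_def
proof (intro conjI allI impI)
  show "sq_int g" using g by (simp add: weak_deriv_def)
  fix \<phi> assume t: "test_fun \<phi>"
  have "(\<integral>x. f x * pd_list [e0] (pd_list es \<phi>) x \<partial>lborel) = (-1) ^ length [e0] * (\<integral>x. h x * pd_list es \<phi> x \<partial>lborel)"
    using w test_fun_pd[OF t es] unfolding weak_deriv_def by blast
  moreover have "(\<integral>x. f x * pd_list (e0 # es) \<phi> x \<partial>lborel) = (-1) ^ length (e0 # es) * (\<integral>x. g x * \<phi> x \<partial>lborel)"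
    using g t unfolding weak_deriv_def by blast
  moreover have "pd_list [e0] (pd_list es \<phi>) = pd_list (e0 # es) \<phi>" by (simp add: pd_list_Cons_dd del: pd_list.simps(2))
  ultimately show "(\<integral>x. h x * pd_list es \<phi> x \<partial>lborel) = (-1) ^ length es * (\<integral>x. g x * \<phi> x \<partial>lborel)"
    by simp
qed

text \<open>Both u and u_x have pure second derivatives in L^2, the latter because u has three
  derivatives. Continuity in time bounds all these norms on [0, 1], and the embedding turns them
  into one pointwise bound.\<close>

lemma zk_bounded:
  assumes u: "zk_solution u"
  shows "\<exists>M\<ge>0. \<forall>t\<in>{0..1}. (AE x in lborel. \<bar>u t x\<bar> \<le> M) \<and> (AE x in lborel. \<bar>wd [ex] (u t) x\<bar> \<le> M)"
proof -
  obtain S where S: "S \<ge> 0" "\<And>u g k p. sq_int u \<Longrightarrow> (\<And>e. e \<in> dirs \<Longrightarrow> weak_deriv [e, e] u (g e)) \<Longrightarrow>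
     \<bar>conv u (moll k) p\<bar> \<le> S * (sqrt (nsq u) + sqrt (nsq (g ex)) + sqrt (nsq (g ey)) + sqrt (nsq (g ez)))"
    using sobolev_conv by blast
  have "\<exists>B\<ge>0. \<forall>t\<in>{0..1}. nsq (wd es (u t)) \<le> B" if "set es \<subseteq> dirs" "length es \<le> 3" for es
    using l2_cont_nsq_bounded[OF zk_l2_cont[OF u that]] by (simp add: clamp01_id)
  then obtain B where B: "\<And>es t. set es \<subseteq> dirs \<Longrightarrow> length es \<le> 3 \<Longrightarrow> t \<in> {0..1} \<Longrightarrow> nsq (wd es (u t)) \<le> B es"
    by metis
  obtain B0 where "\<forall>t\<in>{0..1}. nsq (u (clamp01 t)) \<le> B0"
    using l2_cont_nsq_bounded[OF zk_l2_cont0[OF u]] by blast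
  then have B0: "\<And>t. t \<in> {0..1} \<Longrightarrow> nsq (u t) \<le> B0" by (simp add: clamp01_id)
  define M1 where "M1 = S * (sqrt B0 + sqrt (B [ex, ex]) + sqrt (B [ey, ey]) + sqrt (B [ez, ez]))"
  define M2 where "M2 = S * (sqrt (B [ex]) + sqrt (B [ex, ex, ex]) + sqrt (B [ex, ey, ey]) + sqrt (B [ex, ez, ez]))"
  have 1: "AE x in lborel. \<bar>u t x\<bar> \<le> M1" if t: "t \<in> {0..1}" for t
  proof (rule bounded_of_conv_bounded[OF zk_sq[OF u t]])
    fix k p
    have "\<bar>conv (u t) (moll k) p\<bar> \<le> S * (sqrt (nsq (u t)) + sqrt (nsq (wd [ex, ex] (u t))) + sqrt (nsq (wd [ey, ey] (u t))) + sqrt (nsq (wd [ez, ez] (u t))))"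
      by (rule S(2)[where g = "\<lambda>e. wd [e, e] (u t)"]) (use zk_sq[OF u t] zk_weak[OF u t] in auto)
    also have "\<dots> \<le> M1" unfolding M1_def
      by (intro mult_left_mono add_mono real_sqrt_le_mono B B0 t S(1)) auto
    finally show "\<bar>conv (u t) (moll k) p\<bar> \<le> M1" .
  qed
  have 2: "AE x in lborel. \<bar>wd [ex] (u t) x\<bar> \<le> M2" if t: "t \<in> {0..1}" for t
  proof (rule bounded_of_conv_bounded)
    show sq: "sq_int (wd [ex] (u t))" using zk_weak(2)[OF u t, of "[ex]"] by simp
    fix k p
    have "\<bar>conv (wd [ex] (u t)) (moll k) p\<bar> \<le> S * (sqrt (nsq (wd [ex] (u t))) + sqrt (nsq (wd [ex, ex, ex] (u t))) + sqrt (nsq (wd [ex, ey, ey] (u t))) + sqrt (nsq (wd [ex, ez, ez] (u t))))"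
      by (rule S(2)[where g = "\<lambda>e. wd [ex, e, e] (u t)"]) (auto intro!: sq weak_deriv_shift[of ex "u t"] zk_weak[OF u t])
    also have "\<dots> \<le> M2" unfolding M2_def
      by (intro mult_left_mono add_mono real_sqrt_le_mono B t S(1)) auto
    finally show "\<bar>conv (wd [ex] (u t)) (moll k) p\<bar> \<le> M2" .
  qed
  show ?thesis
  proof (intro exI[of _ "max 0 (max M1 M2)"] conjI ballI)
    fix t :: real assume t: "t \<in> {0..1}"
    show "AE x in lborel. \<bar>u t x\<bar> \<le> max 0 (max M1 M2)" using 1[OF t] by eventually_elim auto
    show "AE x in lborel. \<bar>wd [ex] (u t) x\<bar> \<le> max 0 (max M1 M2)" using 2[OF t] by eventually_elim auto
  qed simp
qed

lemma weak_deriv_diff: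
  assumes f: "weak_deriv es f f'" "sq_int f" and g: "weak_deriv es g g'" "sq_int g" and es: "set es \<subseteq> dirs"
  shows "weak_deriv es (\<lambda>x. f x - g x) (\<lambda>x. f' x - g' x)"
  unfolding weak_deriv_def
proof (intro conjI allI impI)
  have s: "sq_int f'" "sq_int g'" using f g by (auto simp: weak_deriv_def)
  then show "sq_int (\<lambda>x. f' x - g' x)" by (rule sq_int_diff)
  fix \<phi> assume t: "test_fun \<phi>"
  note c = sq_int_cc[OF test_fun_cc[OF t]] sq_int_cc[OF test_fun_cc[OF test_fun_pd[OF t es]]]
  have "(\<integral>x. f x * pd_list es \<phi> x \<partial>lborel) = (-1) ^ length es * (\<integral>x. f' x * \<phi> x \<partial>lborel)"
    "(\<integral>x. g x * pd_list es \<phi> x \<partial>lborel) = (-1) ^ length es * (\<integral>x. g' x * \<phi> x \<partial>lborel)"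
    using f g t unfolding weak_deriv_def by blast+
  then show "(\<integral>x. (f x - g x) * pd_list es \<phi> x \<partial>lborel) = (-1) ^ length es * (\<integral>x. (f' x - g' x) * \<phi> x \<partial>lborel)"
    using sq_int_mult_integrable[OF f(2) c(2)] sq_int_mult_integrable[OF g(2) c(2)] sq_int_mult_integrable[OF s(1) c(1)] sq_int_mult_integrable[OF s(2) c(1)]
    by (simp add: left_diff_distrib right_diff_distrib)
qed

text \<open>Here v is a difference of solutions, w its time derivative and \<open>d es\<close> its
  weak derivatives. N is defined as minus the linear part, so it inherits L^2 continuity; the
  nonlinear equation is used only to derive \<open>N_bound\<close>.\<close>

locale zk_pair =
  fixes v :: "real \<Rightarrow> real^3 \<Rightarrow> real" and d :: "(real^3) list \<Rightarrow> real \<Rightarrow> real^3 \<Rightarrow> real"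
    and w N :: "real \<Rightarrow> real^3 \<Rightarrow> real" and M :: real
  assumes v_cont: "l2_cont_UNIV v" and w_cont: "l2_cont_UNIV w" and N_cont: "l2_cont_UNIV N"
    and d_cont: "\<And>es. set es \<subseteq> dirs \<Longrightarrow> length es \<le> 3 \<Longrightarrow> l2_cont_UNIV (d es)"
    and d_weak: "\<And>es t. set es \<subseteq> dirs \<Longrightarrow> length es \<le> 3 \<Longrightarrow> weak_deriv es (v t) (d es t)"
    and v_deriv: "\<And>t. t \<in> {0<..<1} \<Longrightarrow> ((\<lambda>s. nsq (\<lambda>x. (v s x - v t x) / (s - t) - w t x)) \<longlongrightarrow> 0) (at t)"
    and N_def: "\<And>t x. N t x = - (w t x + d [ex, ex, ex] t x + d [ex, ey, ey] t x + d [ex, ez, ez] t x)"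
    and N_bound: "\<And>t. AE x in lborel. \<bar>N t x\<bar> \<le> M * (\<bar>d [ex] t x\<bar> + \<bar>v t x\<bar>)"
    and M0: "M \<ge> 0"

lemma zk_pair_exists:
  assumes u1: "zk_solution u1" and u2: "zk_solution u2"
  obtains d w N M where "zk_pair (\<lambda>t x. u1 (clamp01 t) x - u2 (clamp01 t) x) d w N M"
proof -
  obtain w1 where w1: "\<And>t. t \<in> {0..1} \<Longrightarrow> sq_int (w1 t)" "l2_cont w1"
    "\<And>t. t \<in> {0..1} \<Longrightarrow> ((\<lambda>s. nsq (\<lambda>x. (u1 s x - u1 t x) / (s - t) - w1 t x)) \<longlongrightarrow> 0) (at t within {0..1})"
    "\<And>t. t \<in> {0..1} \<Longrightarrow> AE x in lborel. w1 t x + wd [ex, ex, ex] (u1 t) x + wd [ex, ey, ey] (u1 t) x + wd [ex, ez, ez] (u1 t) x + u1 t x * wd [ex] (u1 t) x = 0"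
    using u1 unfolding zk_solution_def by blast
  obtain w2 where w2: "\<And>t. t \<in> {0..1} \<Longrightarrow> sq_int (w2 t)" "l2_cont w2"
    "\<And>t. t \<in> {0..1} \<Longrightarrow> ((\<lambda>s. nsq (\<lambda>x. (u2 s x - u2 t x) / (s - t) - w2 t x)) \<longlongrightarrow> 0) (at t within {0..1})"
    "\<And>t. t \<in> {0..1} \<Longrightarrow> AE x in lborel. w2 t x + wd [ex, ex, ex] (u2 t) x + wd [ex, ey, ey] (u2 t) x + wd [ex, ez, ez] (u2 t) x + u2 t x * wd [ex] (u2 t) x = 0"
    using u2 unfolding zk_solution_def by blast
  \<comment> \<open>These two bounds suffice because of the splitting N = u1 d_x v + (d_x u2)
    v.\<close>
  obtain M1 where M1: "M1 \<ge> 0" "\<And>t. t \<in> {0..1} \<Longrightarrow> AE x in lborel. \<bar>u1 t x\<bar> \<le> M1" using zk_bounded[OF u1] by blast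
  obtain M2 where M2: "M2 \<ge> 0" "\<And>t. t \<in> {0..1} \<Longrightarrow> AE x in lborel. \<bar>wd [ex] (u2 t) x\<bar> \<le> M2" using zk_bounded[OF u2] by blast
  define v where "v t x = u1 (clamp01 t) x - u2 (clamp01 t) x" for t x
  define d where "d es t x = wd es (u1 (clamp01 t)) x - wd es (u2 (clamp01 t)) x" for es t x
  define w where "w t x = w1 (clamp01 t) x - w2 (clamp01 t) x" for t x
  define N where "N t x = - (w t x + d [ex, ex, ex] t x + d [ex, ey, ey] t x + d [ex, ez, ez] t x)" for t x
  have vc: "l2_cont_UNIV v" unfolding v_def[abs_def] by (intro l2_cont_UNIV_diff zk_l2_cont0 u1 u2)
  have wc: "l2_cont_UNIV w" unfolding w_def[abs_def] by (intro l2_cont_UNIV_diff l2_cont_clamp w1 w2)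
  have dc: "l2_cont_UNIV (d es)" if "set es \<subseteq> dirs" "length es \<le> 3" for es
    unfolding d_def[abs_def] using that by (intro l2_cont_UNIV_diff zk_l2_cont u1 u2)
  have Nc: "l2_cont_UNIV N" unfolding N_def[abs_def]
    by (intro l2_cont_UNIV_minus l2_cont_UNIV_add wc dc) auto
  have dw: "weak_deriv es (v t) (d es t)" if "set es \<subseteq> dirs" "length es \<le> 3" for es t
    unfolding d_def[abs_def] v_def[abs_def] using that clamp01_in[of t]
    by (intro weak_deriv_diff zk_weak zk_sq u1 u2) auto
  have vd: "((\<lambda>s. nsq (\<lambda>x. (v s x - v t x) / (s - t) - w t x)) \<longlongrightarrow> 0) (at t)" if t: "t \<in> {0<..<1}" for t
  proof -
    have t': "t \<in> {0..1}" using t by auto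
    have at: "at t within {0..1} = at t" by (rule at_within_interior) (use t in auto)
    let ?a = "\<lambda>s x. (u1 s x - u1 t x) / (s - t) - w1 t x" and ?b = "\<lambda>s x. (u2 s x - u2 t x) / (s - t) - w2 t x"
    have "((\<lambda>s. 2 * nsq (?a s) + 2 * nsq (?b s)) \<longlongrightarrow> 2 * 0 + 2 * 0) (at t)"
      using w1(3)[OF t'] w2(3)[OF t'] unfolding at by (intro tendsto_intros)
    then have l: "((\<lambda>s. 2 * nsq (?a s) + 2 * nsq (?b s)) \<longlongrightarrow> 0) (at t)" by simp
    show ?thesis
    proof (rule Lim_null_comparison[OF _ l])
      have "eventually (\<lambda>s. s \<in> {0<..<1}) (at t)" using t by (intro eventually_at_in_open') auto
      then show "eventually (\<lambda>s. norm (nsq (\<lambda>x. (v s x - v t x) / (s - t) - w t x)) \<le> 2 * nsq (?a s) + 2 * nsq (?b s)) (at t)"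
      proof eventually_elim
        fix s :: real assume s: "s \<in> {0<..<1}"
        then have s': "s \<in> {0..1}" by auto
        have eq: "(\<lambda>x. (v s x - v t x) / (s - t) - w t x) = (\<lambda>x. ?a s x - ?b s x)"
          using clamp01_id[OF s'] clamp01_id[OF t'] by (auto simp: v_def w_def diff_divide_distrib)
        have sq: "sq_int (\<lambda>x. (u s x - u t x) / (s - t))" if "zk_solution u" for u
          using sq_int_cmult[OF sq_int_diff[OF zk_sq[OF that s'] zk_sq[OF that t']], of "inverse (s - t)"] by (simp add: divide_inverse mult.commute)
        have "nsq (\<lambda>x. ?a s x - ?b s x) \<le> 2 * nsq (?a s) + 2 * nsq (?b s)"
          by (intro nsq_diff_le sq_int_diff sq u1 u2 w1(1) w2(1) t')
        then show "norm (nsq (\<lambda>x. (v s x - v t x) / (s - t) - w t x)) \<le> 2 * nsq (?a s) + 2 * nsq (?b s)"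
          unfolding arg_cong[where f = nsq, OF eq] by simp
      qed
    qed
  qed
  define M where "M = max M1 M2"
  have Nb: "AE x in lborel. \<bar>N t x\<bar> \<le> M * (\<bar>d [ex] t x\<bar> + \<bar>v t x\<bar>)" for t
  proof -
    let ?t = "clamp01 t"
    have t: "?t \<in> {0..1}" by (rule clamp01_in)
    show ?thesis using w1(4)[OF t] w2(4)[OF t] M1(2)[OF t] M2(2)[OF t]
    proof eventually_elim
      fix x
      let ?a = "u1 ?t x" and ?b = "u2 ?t x" and ?a' = "wd [ex] (u1 ?t) x" and ?b' = "wd [ex] (u2 ?t) x"
      assume a: "w1 ?t x + wd [ex, ex, ex] (u1 ?t) x + wd [ex, ey, ey] (u1 ?t) x + wd [ex, ez, ez] (u1 ?t) x + ?a * ?a' = 0"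
        "w2 ?t x + wd [ex, ex, ex] (u2 ?t) x + wd [ex, ey, ey] (u2 ?t) x + wd [ex, ez, ez] (u2 ?t) x + ?b * ?b' = 0"
        "\<bar>?a\<bar> \<le> M1" "\<bar>?b'\<bar> \<le> M2"
      have "N t x = ?a * ?a' - ?b * ?b'" using a(1,2) by (simp add: N_def w_def d_def)
      also have "\<dots> = ?a * d [ex] t x + ?b' * v t x" by (simp add: d_def v_def algebra_simps)
      finally have "\<bar>N t x\<bar> \<le> \<bar>?a\<bar> * \<bar>d [ex] t x\<bar> + \<bar>?b'\<bar> * \<bar>v t x\<bar>"
        using abs_triangle_ineq[of "?a * d [ex] t x" "?b' * v t x"] by (simp add: abs_mult)
      also have "\<dots> \<le> M * \<bar>d [ex] t x\<bar> + M * \<bar>v t x\<bar>"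
        using a(3,4) by (intro add_mono mult_right_mono) (auto simp: M_def)
      finally show "\<bar>N t x\<bar> \<le> M * (\<bar>d [ex] t x\<bar> + \<bar>v t x\<bar>)" by (simp add: algebra_simps)
    qed
  qed
  have "zk_pair v d w N M"
    by unfold_locales (use vc wc Nc dc dw vd Nb M1(1) in \<open>auto simp: N_def M_def\<close>)
  then show ?thesis using that unfolding v_def[abs_def] by blast
qed

section \<open>Cutoff functions\<close>

definition slab :: "real \<Rightarrow> st set" where "slab R = {z. fst z \<in> {0..1} \<and> norm (snd z) \<le> R}"

text \<open>All derivatives up to order n are bounded on the slab with a constant that does not
  depend on R; the constants in the cutoff errors have to be uniform in R.\<close>

fun ubd :: "nat \<Rightarrow> (real \<Rightarrow> st \<Rightarrow> real) \<Rightarrow> bool" where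
  "ubd 0 F = (\<exists>C. \<forall>R\<ge>2. \<forall>z\<in>slab R. \<bar>F R z\<bar> \<le> C)"
| "ubd (Suc n) F = ((\<exists>C. \<forall>R\<ge>2. \<forall>z\<in>slab R. \<bar>F R z\<bar> \<le> C) \<and> (\<forall>e\<in>adirs. ubd n (\<lambda>R. dd e (F R))))"

text \<open>The head of the list is applied first, opposite to \<open>pd_list\<close>; this matches
  the recursion of \<open>ubd\<close>, which descends into derivatives of F.\<close>

fun ldd :: "st list \<Rightarrow> (st \<Rightarrow> real) \<Rightarrow> st \<Rightarrow> real" where
  "ldd [] f = f" | "ldd (e # es) f = ldd es (dd e f)"

lemma ubd_0I: "(\<And>R z. R \<ge> 2 \<Longrightarrow> z \<in> slab R \<Longrightarrow> \<bar>F R z\<bar> \<le> C) \<Longrightarrow> ubd 0 F"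
  unfolding ubd.simps by blast

lemma ubd_0: "ubd n F \<Longrightarrow> ubd 0 F" by (cases n) auto
lemma ubd_Suc_D: "ubd (Suc n) F \<Longrightarrow> ubd n F"
  by (induction n arbitrary: F) auto

lemma ubd_0_add: "ubd 0 F \<Longrightarrow> ubd 0 G \<Longrightarrow> ubd 0 (\<lambda>R z. F R z + G R z)"
proof -
  assume "ubd 0 F" "ubd 0 G"
  then obtain C D where "\<forall>R\<ge>2. \<forall>z\<in>slab R. \<bar>F R z\<bar> \<le> C" "\<forall>R\<ge>2. \<forall>z\<in>slab R. \<bar>G R z\<bar> \<le> D" by auto
  then have "\<forall>R\<ge>2. \<forall>z\<in>slab R. \<bar>F R z + G R z\<bar> \<le> C + D"
    using abs_triangle_ineq by (meson add_mono order_trans)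
  then show ?thesis unfolding ubd.simps by blast
qed

lemma ubd_0_mult: "ubd 0 F \<Longrightarrow> ubd 0 G \<Longrightarrow> ubd 0 (\<lambda>R z. F R z * G R z)"
proof -
  assume "ubd 0 F" "ubd 0 G"
  then obtain C D where C: "\<forall>R\<ge>2. \<forall>z\<in>slab R. \<bar>F R z\<bar> \<le> C" "\<forall>R\<ge>2. \<forall>z\<in>slab R. \<bar>G R z\<bar> \<le> D" by auto
  have "\<bar>F R z * G R z\<bar> \<le> C * D" if "R \<ge> 2" "z \<in> slab R" for R z
    unfolding abs_mult using C that by (intro mult_mono) (auto intro: order_trans[OF abs_ge_zero])
  then show ?thesis by (rule ubd_0I)
qed

definition fsm :: "(real \<Rightarrow> st \<Rightarrow> real) \<Rightarrow> bool" where "fsm F \<longleftrightarrow> (\<forall>R. smooth adirs (F R))"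

lemma fsm_dd: "fsm F \<Longrightarrow> e \<in> adirs \<Longrightarrow> fsm (\<lambda>R. dd e (F R))"
  by (simp add: fsm_def smooth_dd)

lemma ubd_add: "fsm F \<Longrightarrow> fsm G \<Longrightarrow> ubd n F \<Longrightarrow> ubd n G \<Longrightarrow> ubd n (\<lambda>R z. F R z + G R z)"
proof (induction n arbitrary: F G)
  case 0 then show ?case by (intro ubd_0_add)
next
  case (Suc n)
  have "ubd n (\<lambda>R. dd e (\<lambda>z. F R z + G R z))" if e: "e \<in> adirs" for e
  proof -
    have "(\<lambda>R. dd e (\<lambda>z. F R z + G R z)) = (\<lambda>R z. dd e (F R) z + dd e (G R) z)"
      using Suc.prems e dd_add[of adirs] by (simp add: fsm_def)
    then show ?thesis using Suc.IH[OF fsm_dd[OF Suc.prems(1) e] fsm_dd[OF Suc.prems(2) e]] Suc.prems e by simp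
  qed
  moreover have "ubd 0 (\<lambda>R z. F R z + G R z)" using Suc.prems(3,4)[THEN ubd_0] by (rule ubd_0_add)
  ultimately show ?case by simp
qed

lemma ubd_mult: "fsm F \<Longrightarrow> fsm G \<Longrightarrow> ubd n F \<Longrightarrow> ubd n G \<Longrightarrow> ubd n (\<lambda>R z. F R z * G R z)"
proof (induction n arbitrary: F G)
  case 0 then show ?case by (intro ubd_0_mult)
next
  case (Suc n)
  have "ubd n (\<lambda>R. dd e (\<lambda>z. F R z * G R z))" if e: "e \<in> adirs" for e
  proof -
    have eq: "(\<lambda>R. dd e (\<lambda>z. F R z * G R z)) = (\<lambda>R z. dd e (F R) z * G R z + F R z * dd e (G R) z)"
      using Suc.prems e dd_mult[of adirs] by (simp add: fsm_def)
    have "ubd n (\<lambda>R z. dd e (F R) z * G R z)" "ubd n (\<lambda>R z. F R z * dd e (G R) z)"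
      using Suc.prems e ubd_Suc_D by (auto intro!: Suc.IH fsm_dd)
    moreover have "fsm (\<lambda>R z. dd e (F R) z * G R z)" "fsm (\<lambda>R z. F R z * dd e (G R) z)"
      using Suc.prems e by (auto simp: fsm_def intro!: smooth_mult smooth_dd)
    ultimately show ?thesis unfolding eq by (intro ubd_add)
  qed
  moreover have "ubd 0 (\<lambda>R z. F R z * G R z)" using Suc.prems(3,4)[THEN ubd_0] by (rule ubd_0_mult)
  ultimately show ?case by simp
qed

lemma ubd_const: "(\<And>R. R \<ge> 2 \<Longrightarrow> \<bar>c R\<bar> \<le> C) \<Longrightarrow> ubd n (\<lambda>R z. c R)"
proof (induction n arbitrary: c C)
  case 0 then show ?case by auto
next
  case (Suc n)
  have "ubd n (\<lambda>R. dd e (\<lambda>z. c R))" for e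
    unfolding dd_const by (rule Suc.IH[of "\<lambda>_. 0" 0]) simp
  then show ?case using Suc.prems by auto
qed

lemma fsm_const: "fsm (\<lambda>R z. c R)" by (simp add: fsm_def smooth_const)

lemma has_dd_fst: "has_dd e (\<lambda>z::st. fst z) (\<lambda>_. fst e)"
  by (rule has_dd_linear) (rule bounded_linear_fst)
lemma smooth_fst: "smooth B (\<lambda>z::st. fst z)"
  by (rule smooth_linear) (rule bounded_linear_fst)
lemma has_dd_snd_nth: "has_dd e (\<lambda>z::st. snd z $ i) (\<lambda>_. snd e $ i)"
  by (rule has_dd_linear) (rule bounded_linear_compose[OF bounded_linear_vec_nth bounded_linear_snd])
lemma smooth_snd_nth: "smooth B (\<lambda>z::st. snd z $ i)"
  by (rule smooth_linear) (rule bounded_linear_compose[OF bounded_linear_vec_nth bounded_linear_snd])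

lemma has_dd_time: "smooth {1} \<psi> \<Longrightarrow> has_dd e (\<lambda>z::st. \<psi> (fst z)) (\<lambda>z. dd 1 \<psi> (fst z) * fst e)"
  by (rule has_dd_compose[OF smooth_has_dd has_dd_fst]) auto
lemma fsm_time: "smooth {1} \<psi> \<Longrightarrow> fsm (\<lambda>R z. \<psi> (fst z))"
  by (simp add: fsm_def smooth_compose[OF _ smooth_fst])

lemma ubd_time: "smooth {1} \<psi> \<Longrightarrow> ubd n (\<lambda>R z. \<psi> (fst z))"
proof (induction n arbitrary: \<psi>)
  case 0
  have "compact (\<psi> ` {0..1})" by (intro compact_continuous_image continuous_on_subset[OF smooth_cont[OF 0]]) auto
  then have "bounded (\<psi> ` {0..1})" by (rule compact_imp_bounded)
  then obtain C where "\<And>t. t \<in> {0..1} \<Longrightarrow> \<bar>\<psi> t\<bar> \<le> C" unfolding bounded_iff real_norm_def by blast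
  then show ?case by (auto simp: slab_def)
next
  case (Suc n)
  have s: "smooth {1} (dd 1 \<psi>)" by (rule smooth_dd[OF Suc.prems]) simp
  have "ubd n (\<lambda>R. dd e (\<lambda>z. \<psi> (fst z)))" for e
    unfolding has_dd_imp_dd[OF has_dd_time[OF Suc.prems]]
    by (intro ubd_mult fsm_time s Suc.IH fsm_const ubd_const[of "\<lambda>_. fst e" "\<bar>fst e\<bar>"]) simp
  moreover have "ubd 0 (\<lambda>R z. \<psi> (fst z))" using Suc.IH[OF Suc.prems] by (rule ubd_0)
  ultimately show ?case by simp
qed

text \<open>A class of bounded profiles containing \<open>ramp\<close> and closed under
  differentiation, as the derivative of \<open>ramp\<close> has bounded support.\<close>

definition bddfun :: "(real \<Rightarrow> real) \<Rightarrow> bool" where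
  "bddfun g \<longleftrightarrow> smooth {1} g \<and> (bsupp g \<or> g = ramp)"

lemma bddfun_bounded: "bddfun g \<Longrightarrow> \<exists>C. \<forall>x. \<bar>g x\<bar> \<le> C"
proof -
  assume g: "bddfun g"
  show ?thesis
  proof (cases "g = ramp")
    case True
    then have "\<forall>x. \<bar>g x\<bar> \<le> 1" using ramp_nonneg ramp_le1 by simp
    then show ?thesis by blast
  next
    case False
    then have "cc g" using g by (auto simp: bddfun_def intro: cc_smooth)
    then show ?thesis using cc_bounded by blast
  qed
qed

lemma bsupp_dd_ramp: "bsupp (dd 1 ramp)"
proof -
  have "dd 1 ramp x = 0" if "norm x > 1" for x
  proof -
    have "x < 0 \<or> x > 1" using that by auto
    moreover have "dd 1 ramp x = 0" if "x < 0"
      by (rule dd_zero_open[of "{..<0}" _ _ 0]) (use that ramp_zero in auto)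
    moreover have "dd 1 ramp x = 0" if "x > 1"
      by (rule dd_zero_open[of "{1<..}" _ _ 1]) (use that ramp_one in auto)
    ultimately show ?thesis by blast
  qed
  then show ?thesis by (auto simp: bsupp_def)
qed

lemma bddfun_dd: "bddfun g \<Longrightarrow> bddfun (dd 1 g)"
  using bsupp_dd_ramp by (auto simp: bddfun_def intro: smooth_dd bsupp_dd)

lemma bddfun_ramp: "bddfun ramp" by (simp add: bddfun_def smooth_ramp)

text \<open>Since g and its derivatives are bounded on the whole line, only the derivatives of F
  must be bounded uniformly. This matters for \<open>Qg\<close>, whose values grow with R.\<close>

lemma ubd_compose:
  assumes "bddfun g" "fsm F" "\<And>m e. e \<in> adirs \<Longrightarrow> ubd m (\<lambda>R. dd e (F R))"
  shows "ubd n (\<lambda>R z. g (F R z))"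
  using assms
proof (induction n arbitrary: g)
  case 0 then show ?case using bddfun_bounded[of g] by auto
next
  case (Suc n)
  have sg: "smooth {1} g" using Suc.prems by (simp add: bddfun_def)
  have "ubd n (\<lambda>R. dd e (\<lambda>z. g (F R z)))" if e: "e \<in> adirs" for e
  proof -
    have "dd e (\<lambda>z. g (F R z)) = (\<lambda>z. dd 1 g (F R z) * dd e (F R) z)" for R
      using Suc.prems(2) e by (intro has_dd_imp_dd has_dd_compose smooth_has_dd[OF sg] smooth_has_dd[where B = adirs]) (auto simp: fsm_def)
    then have eq: "(\<lambda>R. dd e (\<lambda>z. g (F R z))) = (\<lambda>R z. dd 1 g (F R z) * dd e (F R) z)" by simp
    have sg': "smooth {1} (dd 1 g)" by (rule smooth_dd[OF sg]) simp
    have "fsm (\<lambda>R z. dd 1 g (F R z))" using Suc.prems(2) by (auto simp: fsm_def intro: smooth_compose[OF sg'])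
    then show ?thesis unfolding eq
      using Suc.IH[OF bddfun_dd[OF Suc.prems(1)] Suc.prems(2,3)] Suc.prems(3)[OF e] fsm_dd[OF Suc.prems(2) e]
      by (intro ubd_mult) auto
  qed
  moreover have "ubd 0 (\<lambda>R z. g (F R z))" using bddfun_bounded[OF Suc.prems(1)] by auto
  ultimately show ?case by simp
qed

lemma finite_adirs: "finite adirs" by (simp add: adirs_def sdirs_def dirs_def)

lemma ubd_ldd:
  "ubd n F \<Longrightarrow> \<exists>C\<ge>0. \<forall>es R z. set es \<subseteq> adirs \<longrightarrow> length es \<le> n \<longrightarrow> R \<ge> 2 \<longrightarrow> z \<in> slab R \<longrightarrow> \<bar>ldd es (F R) z\<bar> \<le> C"
proof (induction n arbitrary: F)
  case 0
  then obtain C where "\<forall>R\<ge>2. \<forall>z\<in>slab R. \<bar>F R z\<bar> \<le> C" by auto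
  then show ?case by (intro exI[of _ "max 0 C"]) (auto simp: le_max_iff_disj)
next
  case (Suc n)
  obtain C where C: "\<forall>R\<ge>2. \<forall>z\<in>slab R. \<bar>F R z\<bar> \<le> C" using Suc.prems by auto
  have "\<forall>e\<in>adirs. \<exists>D\<ge>0. \<forall>es R z. set es \<subseteq> adirs \<longrightarrow> length es \<le> n \<longrightarrow> R \<ge> 2 \<longrightarrow> z \<in> slab R \<longrightarrow> \<bar>ldd es (dd e (F R)) z\<bar> \<le> D"
  proof
    fix e assume "e \<in> adirs"
    then have "ubd n (\<lambda>R. dd e (F R))" using Suc.prems by simp
    from Suc.IH[OF this]
    show "\<exists>D\<ge>0. \<forall>es R z. set es \<subseteq> adirs \<longrightarrow> length es \<le> n \<longrightarrow> R \<ge> 2 \<longrightarrow> z \<in> slab R \<longrightarrow> \<bar>ldd es (dd e (F R)) z\<bar> \<le> D" .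
  qed
  then obtain D where D: "\<And>e. e \<in> adirs \<Longrightarrow> D e \<ge> 0" and
    D': "\<And>e es R z. e \<in> adirs \<Longrightarrow> set es \<subseteq> adirs \<Longrightarrow> length es \<le> n \<Longrightarrow> R \<ge> 2 \<Longrightarrow> z \<in> slab R \<Longrightarrow> \<bar>ldd es (dd e (F R)) z\<bar> \<le> D e"
    by metis
  define B where "B = max 0 C + sum D adirs"
  have De: "D e \<le> B" if "e \<in> adirs" for e
    using member_le_sum[OF that, of D] D finite_adirs by (simp add: B_def)
  have CB: "C \<le> B" "0 \<le> B" using sum_nonneg[of adirs D] D by (auto simp: B_def)
  have "\<bar>ldd es (F R) z\<bar> \<le> B" if "set es \<subseteq> adirs" "length es \<le> Suc n" "R \<ge> 2" "z \<in> slab R" for es R z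
  proof (cases es)
    case Nil then show ?thesis using C CB that by force
  next
    case (Cons e es')
    then show ?thesis using D'[of e es' R z] De[of e] that by force
  qed
  then show ?case using CB by blast
qed

text \<open>\<phi> is the time profile in s = x/R + \<phi>(t); being 0 near the ends it keeps s
  \<le> 1 there, so the cutoff in s also cuts off in time. L enters the choice of \<alpha> and is
  therefore tied to the data of \<phi> alone.\<close>

locale zk_weight =
  fixes r :: real and \<phi> :: "real \<Rightarrow> real" and L :: real
  assumes r0: "0 < r" and r1: "r < 1/2" and smooth_\<phi>: "smooth {1} \<phi>"
    and \<phi>_zero: "\<And>t. t \<le> r / 2 \<or> t \<ge> 1 - r / 2 \<Longrightarrow> \<phi> t = 0"
    and \<phi>_three: "\<And>t. r \<le> t \<Longrightarrow> t \<le> 1 - r \<Longrightarrow> \<phi> t = 3"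
    and \<phi>_ge: "\<And>t. 0 \<le> \<phi> t" and \<phi>_le: "\<And>t. \<phi> t \<le> 3"
    and L1: "1 \<le> L" and \<phi>_d1: "\<And>t. t \<in> {0..1} \<Longrightarrow> \<bar>dd 1 \<phi> t\<bar> \<le> L"
    and \<phi>_d2: "\<And>t. t \<in> {0..1} \<Longrightarrow> \<bar>dd 1 (dd 1 \<phi>) t\<bar> \<le> L"

lemma zk_weight_exists:
  assumes "0 < r" "r < 1/2"
  obtains \<phi> L where "zk_weight r \<phi> L"
proof -
  \<comment> \<open>The first factor rises from 0 to 1 on [r/2, r], the second falls from 1 to 0 on
    [1 - r, 1 - r/2].\<close>
  define \<phi> where "\<phi> t = 3 * (ramp ((2 * t - r) / r) * ramp ((2 - r - 2 * t) / r))" for t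
  have s: "smooth {1} \<phi>" unfolding \<phi>_def[abs_def]
    by (intro smooth_mult smooth_const smooth_compose[OF smooth_ramp] smooth_divide_const smooth_diff smooth_id)
  have s1: "smooth {1} (dd 1 \<phi>)" by (rule smooth_dd[OF s]) simp
  have s2: "smooth {1} (dd 1 (dd 1 \<phi>))" by (rule smooth_dd[OF s1]) simp
  have bd: "\<exists>C. \<forall>t\<in>{0..1}. \<bar>g t\<bar> \<le> C" if "smooth {1} g" for g :: "real \<Rightarrow> real"
  proof -
    have "compact (g ` {0..1})" by (intro compact_continuous_image continuous_on_subset[OF smooth_cont[OF that]]) auto
    then have "bounded (g ` {0..1})" by (rule compact_imp_bounded)
    then show ?thesis unfolding bounded_iff real_norm_def by blast
  qed
  obtain L1 where L1: "\<forall>t\<in>{0..1}. \<bar>dd 1 \<phi> t\<bar> \<le> L1" using bd[OF s1] by blast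
  obtain L2 where L2: "\<forall>t\<in>{0..1}. \<bar>dd 1 (dd 1 \<phi>) t\<bar> \<le> L2" using bd[OF s2] by blast
  have "zk_weight r \<phi> (max 1 (max L1 L2))"
  proof
    show "\<phi> t = 0" if "t \<le> r / 2 \<or> t \<ge> 1 - r / 2" for t
    proof -
      have "(2 * t - r) / r \<le> 0 \<or> (2 - r - 2 * t) / r \<le> 0" using that assms by (simp add: divide_le_0_iff) linarith
      then show ?thesis by (auto simp: \<phi>_def ramp_zero)
    qed
    show "\<phi> t = 3" if "r \<le> t" "t \<le> 1 - r" for t
    proof -
      have "(2 * t - r) / r \<ge> 1" "(2 - r - 2 * t) / r \<ge> 1" using that assms by (auto simp: le_divide_eq)
      then show ?thesis by (simp add: \<phi>_def ramp_one)
    qed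
    show "0 \<le> \<phi> t" for t by (simp add: \<phi>_def ramp_nonneg)
    show "\<phi> t \<le> 3" for t using mult_le_one[OF ramp_le1 ramp_nonneg ramp_le1] by (simp add: \<phi>_def)
    show "\<bar>dd 1 \<phi> t\<bar> \<le> max 1 (max L1 L2)" "\<bar>dd 1 (dd 1 \<phi>) t\<bar> \<le> max 1 (max L1 L2)" if "t \<in> {0..1}" for t
      using L1 L2 that by (auto simp: le_max_iff_disj)
  qed (use assms s in auto)
  then show ?thesis by (rule that)
qed

section \<open>The space-time cutoff and its bounds uniform in R\<close>

context zk_weight
begin

definition Sg :: "real \<Rightarrow> st \<Rightarrow> real" where "Sg R z = snd z $ 1 / R + \<phi> (fst z)"
text \<open>Equals 0 on the sphere of radius R and 1 on the sphere of radius R - 1. Using the square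
  of the norm makes it a polynomial, smooth at the origin too.\<close>

definition Qg :: "real \<Rightarrow> st \<Rightarrow> real" where
  "Qg R z = (R\<^sup>2 - ((snd z $ 1)\<^sup>2 + (snd z $ 2)\<^sup>2 + (snd z $ 3)\<^sup>2)) / (2 * R - 1)"
definition chi :: "real \<Rightarrow> st \<Rightarrow> real" where "chi R z = ramp (Qg R z) * ramp (Sg R z - 1)"

lemma Sg_has_dd: "has_dd e (Sg R) (\<lambda>z. snd e $ 1 / R + dd 1 \<phi> (fst z) * fst e)"
  unfolding Sg_def[abs_def]
  using has_dd_add[OF has_dd_cmult[OF has_dd_snd_nth[of e 1], of "1 / R"] has_dd_time[OF smooth_\<phi>, of e]] by simp

lemma smooth_Sg: "smooth B (Sg R)"
  unfolding Sg_def[abs_def] by (intro smooth_add smooth_divide_const smooth_snd_nth smooth_compose[OF smooth_\<phi> smooth_fst])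

lemma smooth_Qg: "smooth B (Qg R)"
  unfolding Qg_def[abs_def] by (intro smooth_intros smooth_divide_const smooth_snd_nth)

lemma smooth_chi: "smooth B (chi R)"
  unfolding chi_def[abs_def]
  by (intro smooth_mult smooth_compose[OF smooth_ramp] smooth_diff smooth_const smooth_Sg smooth_Qg)

lemma Qg_has_dd: "has_dd e (Qg R) (\<lambda>z. - 2 * (snd z $ 1 * snd e $ 1 + snd z $ 2 * snd e $ 2 + snd z $ 3 * snd e $ 3) / (2 * R - 1))"
proof -
  have "has_dd e (\<lambda>z. inverse (2 * R - 1) * (R\<^sup>2 - ((snd z $ 1)\<^sup>2 + (snd z $ 2)\<^sup>2 + (snd z $ 3)\<^sup>2)))
    (\<lambda>z. inverse (2 * R - 1) * (0 - (2 * snd z $ 1 * snd e $ 1 + 2 * snd z $ 2 * snd e $ 2 + 2 * snd z $ 3 * snd e $ 3)))"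
    by (intro has_dd_cmult has_dd_diff has_dd_const has_dd_add has_dd_sq has_dd_snd_nth)
  then show ?thesis unfolding Qg_def[abs_def] by (simp add: divide_inverse algebra_simps)
qed

lemma adirs_component: "e \<in> adirs \<Longrightarrow> \<bar>snd e $ i\<bar> \<le> 1"
  by (auto simp: adirs_def sdirs_def dirs_def ex_def ey_def ez_def axis_def)

text \<open>The first derivatives are combinations of coordinates divided by 2 R - 1, which are
  bounded on the slab because R \<le> 2 R - 1; differentiating further leaves constants of size at
  most 1 / (2 R - 1), up to a factor.\<close>

lemma ubd_Qg: assumes e: "e \<in> adirs" shows "ubd m (\<lambda>R. dd e (Qg R))"
proof -
  have R: "R \<le> 2 * R - 1" "2 * R - 1 > 0" if "R \<ge> 2" for R :: real using that by auto
  have f1: "fsm (\<lambda>R z. snd z $ i)" for i by (simp add: fsm_def smooth_snd_nth)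
  have f2: "fsm (\<lambda>R z. snd z $ i / (2 * R - 1))" for i by (simp add: fsm_def smooth_divide_const smooth_snd_nth)
  have lin: "ubd m (\<lambda>R z. snd z $ i / (2 * R - 1))" for i m
  proof (cases m)
    case 0
    have "\<bar>snd z $ i / (2 * R - 1)\<bar> \<le> 1" if "R \<ge> 2" "z \<in> slab R" for R z
      using component_le_norm_cart[of "snd z" i] that R[OF that(1)] by (simp add: slab_def abs_divide divide_le_eq)
    then show ?thesis using 0 ubd_0I[of "\<lambda>R z. snd z $ i / (2 * R - 1)" 1] by simp
  next
    case (Suc n)
    have "\<bar>snd z $ i / (2 * R - 1)\<bar> \<le> 1" if "R \<ge> 2" "z \<in> slab R" for R z
      using component_le_norm_cart[of "snd z" i] that R[OF that(1)] by (simp add: slab_def abs_divide divide_le_eq)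
    then have "ubd 0 (\<lambda>R z. snd z $ i / (2 * R - 1))" by (rule ubd_0I)
    moreover have "ubd n (\<lambda>R. dd e (\<lambda>z. snd z $ i / (2 * R - 1)))" if "e \<in> adirs" for e
    proof -
      have "dd e (\<lambda>z. snd z $ i / (2 * R - 1)) = (\<lambda>z. snd e $ i / (2 * R - 1))" for R
        using has_dd_imp_dd[OF has_dd_cmult[OF has_dd_snd_nth[of e i], of "inverse (2 * R - 1)"]] by (simp add: divide_inverse mult.commute)
      moreover have "\<bar>snd e $ i / (2 * R - 1)\<bar> \<le> 1" if "R \<ge> 2" for R
        using adirs_component[OF \<open>e \<in> adirs\<close>, of i] that R[OF that] by (simp add: abs_divide divide_le_eq)
      ultimately show ?thesis by (simp add: ubd_const[of "\<lambda>R. snd e $ i / (2 * R - 1)" 1])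
    qed
    ultimately show ?thesis using Suc by simp
  qed
  define c where "c i = - 2 * snd e $ i" for i
  have eq: "(\<lambda>R. dd e (Qg R)) = (\<lambda>R z. c 1 * (snd z $ 1 / (2 * R - 1)) + c 2 * (snd z $ 2 / (2 * R - 1)) + c 3 * (snd z $ 3 / (2 * R - 1)))"
    unfolding has_dd_imp_dd[OF Qg_has_dd] c_def by (simp add: fun_eq_iff diff_divide_distrib add_divide_distrib algebra_simps)
  have t: "ubd m (\<lambda>R z. c i * (snd z $ i / (2 * R - 1)))" "fsm (\<lambda>R z. c i * (snd z $ i / (2 * R - 1)))" for i
    using ubd_mult[OF fsm_const f2 ubd_const[of "\<lambda>_. c i" "\<bar>c i\<bar>"] lin] by (auto simp: fsm_def intro!: smooth_mult smooth_const smooth_divide_const smooth_snd_nth)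
  have "fsm (\<lambda>R z. c 1 * (snd z $ 1 / (2 * R - 1)) + c 2 * (snd z $ 2 / (2 * R - 1)))"
    using t(2) by (simp add: fsm_def smooth_add)
  then show ?thesis unfolding eq by (intro ubd_add t)
qed

lemma ubd_chi: "ubd n chi"
proof -
  have 1: "ubd n (\<lambda>R z. ramp (Qg R z))"
    by (rule ubd_compose[OF bddfun_ramp _ ubd_Qg]) (simp add: fsm_def smooth_Qg)
  have dS: "ubd m (\<lambda>R. dd e (\<lambda>z. Sg R z - 1))" if e: "e \<in> adirs" for m e
  proof -
    have "dd e (\<lambda>z. Sg R z - 1) = (\<lambda>z. snd e $ 1 / R + dd 1 \<phi> (fst z) * fst e)" for R
      using has_dd_imp_dd[OF has_dd_diff[OF Sg_has_dd[of e R] has_dd_const]] by simp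
    moreover have "\<bar>snd e $ 1 / R\<bar> \<le> 1" if "R \<ge> 2" for R
      using adirs_component[OF e, of 1] that by (simp add: abs_divide divide_le_eq)
    moreover have "smooth {1} (dd 1 \<phi>)" by (rule smooth_dd[OF smooth_\<phi>]) simp
    ultimately show ?thesis
      using ubd_add[OF fsm_const[of "\<lambda>R. snd e $ 1 / R"] _ ubd_const[of "\<lambda>R. snd e $ 1 / R" 1], of "\<lambda>R z. dd 1 \<phi> (fst z) * fst e" m]
        ubd_mult[OF fsm_time[of "dd 1 \<phi>"] fsm_const[of "\<lambda>_. fst e"] ubd_time[of "dd 1 \<phi>"] ubd_const[of "\<lambda>_. fst e" "\<bar>fst e\<bar>"], of m]
      by (simp add: fsm_def smooth_mult smooth_const smooth_compose[OF _ smooth_fst])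
  qed
  have 2: "ubd n (\<lambda>R z. ramp (Sg R z - 1))"
    by (rule ubd_compose[OF bddfun_ramp _ dS]) (simp add: fsm_def smooth_Sg smooth_diff smooth_const)
  have "ubd n (\<lambda>R z. ramp (Qg R z) * ramp (Sg R z - 1))"
    by (intro ubd_mult 1 2) (auto simp: fsm_def intro!: smooth_compose[OF smooth_ramp] smooth_Qg smooth_diff smooth_Sg smooth_const)
  moreover have "(\<lambda>R z. ramp (Qg R z) * ramp (Sg R z - 1)) = chi" by (intro ext) (simp add: chi_def)
  ultimately show ?thesis by simp
qed

lemma chi_bounds:
  obtains C where "C \<ge> 0"
    "\<And>R z e. R \<ge> 2 \<Longrightarrow> z \<in> slab R \<Longrightarrow> e \<in> adirs \<Longrightarrow> \<bar>dd e (chi R) z\<bar> \<le> C"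
    "\<And>R z e e'. R \<ge> 2 \<Longrightarrow> z \<in> slab R \<Longrightarrow> e \<in> adirs \<Longrightarrow> e' \<in> adirs \<Longrightarrow> \<bar>dd e (dd e' (chi R)) z\<bar> \<le> C"
    "\<And>R z e e' e''. R \<ge> 2 \<Longrightarrow> z \<in> slab R \<Longrightarrow> e \<in> adirs \<Longrightarrow> e' \<in> adirs \<Longrightarrow> e'' \<in> adirs \<Longrightarrow> \<bar>dd e (dd e' (dd e'' (chi R))) z\<bar> \<le> C"
proof -
  obtain C where C: "C \<ge> 0" "\<And>es R z. set es \<subseteq> adirs \<Longrightarrow> length es \<le> 3 \<Longrightarrow> R \<ge> 2 \<Longrightarrow> z \<in> slab R \<Longrightarrow> \<bar>ldd es (chi R) z\<bar> \<le> C"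
    using ubd_ldd[OF ubd_chi[of 3]] by blast
  show ?thesis
  proof (rule that[OF C(1)])
    fix R z e e' e'' assume a: "R \<ge> (2::real)" "z \<in> slab R" "e \<in> adirs"
    show "\<bar>dd e (chi R) z\<bar> \<le> C" using C(2)[of "[e]" R z] a by simp
    assume b: "e' \<in> adirs"
    show "\<bar>dd e (dd e' (chi R)) z\<bar> \<le> C" using C(2)[of "[e', e]" R z] a b by simp
    assume c: "e'' \<in> adirs"
    show "\<bar>dd e (dd e' (dd e'' (chi R))) z\<bar> \<le> C" using C(2)[of "[e'', e', e]" R z] a b c by simp
  qed
qed

lemma norm_snd_sq: "(norm (p::real^3))\<^sup>2 = (p $ 1)\<^sup>2 + (p $ 2)\<^sup>2 + (p $ 3)\<^sup>2"
  by (simp add: norm_vec_def L2_set_def sum_3)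

lemma chi_zero:
  assumes R: "R \<ge> 2" and z: "norm (snd z) > R \<or> Sg R z < 1 \<or> fst z < r / 2 \<or> fst z > 1 - r / 2"
  shows "chi R z = 0"
proof -
  have Q: "ramp (Qg R z) = 0" if "norm (snd z) > R"
  proof -
    have "R\<^sup>2 < (norm (snd z))\<^sup>2" using that R by (intro power_strict_mono) auto
    then have "Qg R z \<le> 0" unfolding Qg_def norm_snd_sq[symmetric] using R by (intro divide_nonpos_pos) linarith+
    then show ?thesis by (rule ramp_zero)
  qed
  have S: "ramp (Sg R z - 1) = 0" if "Sg R z \<le> 1" using that by (simp add: ramp_zero)
  have "Sg R z \<le> 1" if "fst z < r / 2 \<or> fst z > 1 - r / 2" "norm (snd z) \<le> R"
  proof -
    have "\<phi> (fst z) = 0" using that(1) by (intro \<phi>_zero) auto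
    moreover have "snd z $ 1 \<le> R" using component_le_norm_cart[of "snd z" 1] that by linarith
    ultimately show ?thesis using R by (simp add: Sg_def)
  qed
  then show ?thesis using Q S z unfolding chi_def by force
qed

lemma chi_one:
  assumes R: "R \<ge> 2" and z: "norm (snd z) \<le> R - 1" "Sg R z \<ge> 2"
  shows "chi R z = 1"
proof -
  have "(norm (snd z))\<^sup>2 \<le> (R - 1)\<^sup>2" using z R by (intro power_mono) auto
  then have "Qg R z \<ge> 1" unfolding Qg_def norm_snd_sq[symmetric] using R by (simp add: le_divide_eq power2_eq_square algebra_simps)
  then show ?thesis using z by (simp add: chi_def ramp_one)
qed

lemma Sg_le: "R \<ge> 2 \<Longrightarrow> norm (snd z) \<le> R \<Longrightarrow> Sg R z \<le> 4"
  using component_le_norm_cart[of "snd z" 1] \<phi>_le[of "fst z"] by (simp add: Sg_def) (smt (verit) divide_le_eq_1)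

text \<open>Open sets on which \<open>chi R\<close> is constantly 0 and 1.\<close>

definition Zset :: "real \<Rightarrow> st set" where
  "Zset R = {z. norm (snd z) > R} \<union> {z. Sg R z < 1} \<union> {z. fst z < r / 2} \<union> {z. fst z > 1 - r / 2}"
definition Oset :: "real \<Rightarrow> st set" where
  "Oset R = {z. norm (snd z) < R - 1} \<inter> {z. Sg R z > 2}"

lemma open_Zset: "open (Zset R)" and open_Oset: "open (Oset R)"
  unfolding Zset_def Oset_def
  by (intro open_Un open_Int open_Collect_less continuous_intros smooth_cont[OF smooth_Sg[where B = "{}"]])+

lemma chi_dd_zero:
  assumes R: "R \<ge> 2" and z: "z \<in> Zset R \<union> Oset R"
  shows "dd e (chi R) z = 0" "dd e (dd e' (chi R)) z = 0" "dd e (dd e' (dd e'' (chi R))) z = 0"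
proof -
  have o: "open (Zset R \<union> Oset R)" by (intro open_Un open_Zset open_Oset)
  have 1: "dd e (chi R) z = 0" if "z \<in> Zset R \<union> Oset R" for z e
    using that
  proof
    assume "z \<in> Zset R" then show ?thesis
      by (rule dd_zero_open[OF open_Zset, where c = 0]) (use chi_zero[OF R] in \<open>auto simp: Zset_def\<close>)
  next
    assume "z \<in> Oset R" then show ?thesis
      by (rule dd_zero_open[OF open_Oset, where c = 1]) (use chi_one[OF R] in \<open>auto simp: Oset_def\<close>)
  qed
  have 2: "dd e (dd e' (chi R)) z = 0" if "z \<in> Zset R \<union> Oset R" for z e e'
    by (rule dd_zero_open[OF o that]) (rule 1)
  have 3: "dd e (dd e' (dd e'' (chi R))) z = 0" if "z \<in> Zset R \<union> Oset R" for z e e' e''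
    by (rule dd_zero_open[OF o that]) (rule 2)
  show "dd e (chi R) z = 0" "dd e (dd e' (chi R)) z = 0" "dd e (dd e' (dd e'' (chi R))) z = 0"
    using 1 2 3 z by auto
qed

end

section \<open>The weighted operator\<close>

text \<open>To be read with h = 1/R, s the value of \<open>Sg\<close>, and p, q the first two
  derivatives of the time profile. Put U = \<alpha>^5 h^6. The leading term is 16 s^4 U. By
  \<open>key\<close>, the terms with p or q are small multiples of s^2 U / 10000 times at most 32;
  the terms with only \<kappa> and a carry at least one extra factor 1/\<alpha> and are at most 160
  resp. 60 times s^2 U / 200. Less than 2 s^2 U is lost in total, so at least 8 U remains.\<close>

lemma coefficient_bounds:
  fixes \<alpha> h s p q L :: real
  assumes \<alpha>: "\<alpha> \<ge> 200" and h: "h > 0" and s: "1 \<le> s" and p: "\<bar>p\<bar> \<le> L" and q: "\<bar>q\<bar> \<le> L" and L: "1 \<le> L"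
    and key: "\<alpha>\<^sup>2 * h^3 = 10000 * L\<^sup>2"
  defines "\<kappa> \<equiv> 2 * \<alpha> * h\<^sup>2" and "a \<equiv> 2 * \<alpha> * h * s" and "\<tau> \<equiv> 2 * \<alpha> * h * p"
    and "b \<equiv> 2 * \<alpha> * (s * p)" and "\<beta> \<equiv> 2 * \<alpha> * (p\<^sup>2 + s * q)"
  shows "8 * \<alpha>^5 * h^6 \<le> \<kappa> * a^4 / 2 + 3 * a\<^sup>2 * \<tau> - 10 * \<kappa>\<^sup>2 * a\<^sup>2 + \<beta> / 2 - 2 * \<kappa> * \<tau> - 15 / 2 * \<kappa>^3 - 4 * \<kappa> * a * b"
    and "100 * \<alpha>^3 * h^4 \<le> 21 * \<kappa> * a\<^sup>2 - 3 * \<tau> + 6 * \<kappa>\<^sup>2"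
    and "0 \<le> \<kappa> * a\<^sup>2 - \<tau> + 2 * \<kappa>\<^sup>2"
proof -
  define U where "U = \<alpha>^5 * h^6"
  \<comment> \<open>The size of the terms from the time dependence of the weight, before the factor
    p. \<open>key\<close> says U = 10000 L^2 y, which makes y L small against U.\<close>
  define y where "y = \<alpha>^3 * h^3"
  have s2: "1 \<le> s\<^sup>2" using s by simp
  have s4: "s\<^sup>2 \<le> s^4" using mult_left_mono[OF s2, of "s\<^sup>2"] by (simp add: power4_eq_xxxx power2_eq_square)
  have ss: "s \<le> s\<^sup>2" using s by (simp add: power2_eq_square)
  have LL: "L \<le> L\<^sup>2" using L by (simp add: power2_eq_square)
  have L2: "1 \<le> L\<^sup>2" using L by simp
  have y0: "y > 0" using \<alpha> h by (simp add: y_def)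
  have U: "U = 10000 * L\<^sup>2 * y"
  proof -
    have "U = (\<alpha>\<^sup>2 * h^3) * y" by (simp add: U_def y_def eval_nat_numeral algebra_simps)
    then show ?thesis using key by simp
  qed
  have U0: "U > 0" using \<alpha> h by (simp add: U_def)
  have yU: "y * L \<le> U / 10000" using mult_left_mono[OF LL, of y] y0 by (simp add: U mult.commute)
  have T2: "\<alpha>^4 * h^6 \<le> U / 200"
  proof -
    have "200 * (\<alpha>^4 * h^6) \<le> \<alpha> * (\<alpha>^4 * h^6)" using \<alpha> by (intro mult_right_mono) auto
    then show ?thesis by (simp add: U_def eval_nat_numeral algebra_simps)
  qed
  have T3: "\<alpha> * L\<^sup>2 \<le> U / 10000"
  proof -
    have "\<alpha> * (\<alpha>\<^sup>2 * h^3) = y" by (simp add: y_def eval_nat_numeral algebra_simps)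
    then have "\<alpha> * (10000 * L\<^sup>2) = y" using key by simp
    then have "\<alpha> * L\<^sup>2 = y / 10000" by simp
    moreover have "y * 1 \<le> y * L\<^sup>2" using y0 L2 by (intro mult_left_mono) auto
    moreover have "U / 10000 = y * L\<^sup>2" by (simp add: U)
    ultimately show ?thesis using y0 by linarith
  qed
  have T4: "\<alpha>\<^sup>2 * h^3 * L \<le> U / 10000"
  proof -
    have "(\<alpha>\<^sup>2 * h^3 * L) * 1 \<le> (\<alpha>\<^sup>2 * h^3 * L) * \<alpha>" using \<alpha> h L by (intro mult_left_mono) auto
    also have "\<dots> = y * L" by (simp add: y_def eval_nat_numeral algebra_simps)
    finally show ?thesis using yU by simp
  qed
  have T5: "\<alpha>^3 * h^6 \<le> U / 200"
  proof -
    have "(\<alpha>^3 * h^6) * 1 \<le> (\<alpha>^3 * h^6) * \<alpha>" using \<alpha> by (intro mult_left_mono) auto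
    also have "\<dots> = \<alpha>^4 * h^6" by (simp add: eval_nat_numeral algebra_simps)
    finally show ?thesis using T2 by simp
  qed
  have e1: "\<bar>3 * a\<^sup>2 * \<tau>\<bar> \<le> 24 * s\<^sup>2 * (U / 10000)"
  proof -
    have "3 * a\<^sup>2 * \<tau> = 24 * s\<^sup>2 * (y * p)" by (simp add: a_def \<tau>_def y_def eval_nat_numeral algebra_simps)
    from this have "\<bar>3 * a\<^sup>2 * \<tau>\<bar> = \<bar>24 * s\<^sup>2 * (y * p)\<bar>" by (rule arg_cong)
    also have "\<dots> = 24 * s\<^sup>2 * (y * \<bar>p\<bar>)" using y0 by (simp add: abs_mult)
    also have "\<dots> \<le> 24 * s\<^sup>2 * (y * L)" using y0 p by (intro mult_left_mono) auto
    also have "\<dots> \<le> 24 * s\<^sup>2 * (U / 10000)" by (intro mult_left_mono yU) auto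
    finally show ?thesis .
  qed
  have e2: "10 * \<kappa>\<^sup>2 * a\<^sup>2 \<le> 160 * s\<^sup>2 * (U / 200)"
  proof -
    have "10 * \<kappa>\<^sup>2 * a\<^sup>2 = 160 * s\<^sup>2 * (\<alpha>^4 * h^6)" by (simp add: a_def \<kappa>_def eval_nat_numeral algebra_simps)
    then show ?thesis using mult_left_mono[OF T2, of "160 * s\<^sup>2"] by simp
  qed
  have e3: "\<bar>\<beta> / 2\<bar> \<le> 2 * s\<^sup>2 * (U / 10000)"
  proof -
    have "\<bar>p\<^sup>2 + s * q\<bar> \<le> L\<^sup>2 + s * L"
    proof -
      have "p\<^sup>2 \<le> L\<^sup>2" using p by (simp add: abs_le_square_iff[symmetric])
      moreover have "\<bar>s * q\<bar> \<le> s * L" using s q by (simp add: abs_mult)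
      ultimately show ?thesis using zero_le_power2[of p] by linarith
    qed
    also have "\<dots> \<le> s\<^sup>2 * L\<^sup>2 + s\<^sup>2 * L\<^sup>2"
      using s2 ss LL L2 L s by (intro add_mono mult_mono) (auto simp: mult_le_cancel_right1)
    also have "s\<^sup>2 * L\<^sup>2 + s\<^sup>2 * L\<^sup>2 = 2 * s\<^sup>2 * L\<^sup>2" by simp
    finally have "\<bar>p\<^sup>2 + s * q\<bar> \<le> 2 * s\<^sup>2 * L\<^sup>2" .
    then have "\<alpha> * \<bar>p\<^sup>2 + s * q\<bar> \<le> \<alpha> * (2 * s\<^sup>2 * L\<^sup>2)" using \<alpha> by (intro mult_left_mono) auto
    also have "\<dots> = 2 * s\<^sup>2 * (\<alpha> * L\<^sup>2)" by simp
    also have "\<dots> \<le> 2 * s\<^sup>2 * (U / 10000)" by (intro mult_left_mono T3) auto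
    finally show ?thesis using \<alpha> by (simp add: \<beta>_def abs_mult)
  qed
  have e4: "\<bar>2 * \<kappa> * \<tau>\<bar> \<le> 8 * s\<^sup>2 * (U / 10000)"
  proof -
    have "2 * \<kappa> * \<tau> = 8 * (\<alpha>\<^sup>2 * h^3 * p)" by (simp add: \<kappa>_def \<tau>_def eval_nat_numeral algebra_simps)
    from this have "\<bar>2 * \<kappa> * \<tau>\<bar> = \<bar>8 * (\<alpha>\<^sup>2 * h^3 * p)\<bar>" by (rule arg_cong)
    also have "\<dots> = 8 * (\<alpha>\<^sup>2 * h^3 * \<bar>p\<bar>)" using h by (simp add: abs_mult)
    also have "\<dots> \<le> 8 * (\<alpha>\<^sup>2 * h^3 * L)" using p h by (intro mult_left_mono) auto
    also have "\<dots> \<le> 8 * (U / 10000)" using T4 by simp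
    also have "\<dots> \<le> 8 * s\<^sup>2 * (U / 10000)" using s2 U0 by (intro mult_right_mono) auto
    finally show ?thesis .
  qed
  have e5: "15 / 2 * \<kappa>^3 \<le> 60 * s\<^sup>2 * (U / 200)"
  proof -
    have "15 / 2 * \<kappa>^3 = 60 * (\<alpha>^3 * h^6)" by (simp add: \<kappa>_def eval_nat_numeral algebra_simps)
    also have "\<dots> \<le> 60 * (U / 200)" using T5 by simp
    also have "\<dots> \<le> 60 * s\<^sup>2 * (U / 200)" using s2 U0 by (intro mult_right_mono) auto
    finally show ?thesis .
  qed
  have e6: "\<bar>4 * \<kappa> * a * b\<bar> \<le> 32 * s\<^sup>2 * (U / 10000)"
  proof -
    have "4 * \<kappa> * a * b = 32 * s\<^sup>2 * (y * p)" by (simp add: \<kappa>_def a_def b_def y_def eval_nat_numeral algebra_simps)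
    from this have "\<bar>4 * \<kappa> * a * b\<bar> = \<bar>32 * s\<^sup>2 * (y * p)\<bar>" by (rule arg_cong)
    also have "\<dots> = 32 * s\<^sup>2 * (y * \<bar>p\<bar>)" using y0 by (simp add: abs_mult)
    also have "\<dots> \<le> 32 * s\<^sup>2 * (y * L)" using y0 p by (intro mult_left_mono) auto
    also have "\<dots> \<le> 32 * s\<^sup>2 * (U / 10000)" by (intro mult_left_mono yU) auto
    finally show ?thesis .
  qed
  have m: "\<kappa> * a^4 / 2 = 16 * s^4 * U" by (simp add: \<kappa>_def a_def U_def eval_nat_numeral algebra_simps)
  have s4U: "s\<^sup>2 * U \<le> s^4 * U" using s4 U0 by (intro mult_right_mono) auto
  have s2U: "U \<le> s\<^sup>2 * U" using s2 U0 by simp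
  show "8 * \<alpha>^5 * h^6 \<le> \<kappa> * a^4 / 2 + 3 * a\<^sup>2 * \<tau> - 10 * \<kappa>\<^sup>2 * a\<^sup>2 + \<beta> / 2 - 2 * \<kappa> * \<tau> - 15 / 2 * \<kappa>^3 - 4 * \<kappa> * a * b"
    using e1 e2 e3 e4 e5 e6 m s4U s2U U0 unfolding U_def[symmetric] mult.assoc[of 8] by linarith
  define G where "G = \<alpha>^3 * h^4"
  have G0: "G > 0" using \<alpha> h by (simp add: G_def)
  have g1: "\<bar>\<tau>\<bar> \<le> G / 1000"
  proof -
    have "\<alpha> * h * L * 10000 \<le> \<alpha> * h * (10000 * L\<^sup>2)" using \<alpha> h LL by simp
    also have "\<dots> = \<alpha> * h * (\<alpha>\<^sup>2 * h^3)" using key by simp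
    also have "\<dots> = G" by (simp add: G_def eval_nat_numeral algebra_simps)
    finally have "\<alpha> * h * L * 10000 \<le> G" .
    moreover have "\<bar>\<tau>\<bar> = 2 * (\<alpha> * h * \<bar>p\<bar>)" using \<alpha> h by (simp add: \<tau>_def abs_mult)
    moreover have "\<alpha> * h * \<bar>p\<bar> \<le> \<alpha> * h * L" using \<alpha> h p by (intro mult_left_mono) auto
    ultimately show ?thesis using G0 by simp
  qed
  have g2: "\<kappa> * a\<^sup>2 = 8 * (s\<^sup>2 * G)" by (simp add: \<kappa>_def a_def G_def eval_nat_numeral algebra_simps)
  have g3: "G \<le> s\<^sup>2 * G" using s2 G0 by simp
  show "100 * \<alpha>^3 * h^4 \<le> 21 * \<kappa> * a\<^sup>2 - 3 * \<tau> + 6 * \<kappa>\<^sup>2"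
    using g1 g2 g3 G0 zero_le_power2[of \<kappa>] unfolding G_def[symmetric] mult.assoc[of 100] mult.assoc[of 21] by linarith
  show "0 \<le> \<kappa> * a\<^sup>2 - \<tau> + 2 * \<kappa>\<^sup>2"
    using g1 g2 g3 G0 zero_le_power2[of \<kappa>] by linarith
qed

section \<open>Coefficients of the concrete weight\<close>

context zk_weight
begin

definition wt :: "real \<Rightarrow> real \<Rightarrow> st \<Rightarrow> real" where "wt \<alpha> R z = exp (\<alpha> * (Sg R z)\<^sup>2)"
text \<open>This and the next four definitions are derivatives of the exponent
  \<open>\<alpha> * (Sg R z)\<^sup>2\<close>: \<open>kap\<close> in xx, \<open>ca\<close> in x,
  \<open>tau\<close> in xt, \<open>cb\<close> in t and \<open>beta\<close> in tt.\<close>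

definition kap :: "real \<Rightarrow> real \<Rightarrow> real" where "kap \<alpha> R = 2 * \<alpha> * (1 / R)\<^sup>2"
definition ca :: "real \<Rightarrow> real \<Rightarrow> st \<Rightarrow> real" where "ca \<alpha> R z = 2 * \<alpha> * (1 / R) * Sg R z"
definition tau :: "real \<Rightarrow> real \<Rightarrow> st \<Rightarrow> real" where "tau \<alpha> R z = 2 * \<alpha> * (1 / R) * dd 1 \<phi> (fst z)"
definition cb :: "real \<Rightarrow> real \<Rightarrow> st \<Rightarrow> real" where "cb \<alpha> R z = 2 * \<alpha> * (Sg R z * dd 1 \<phi> (fst z))"
definition beta :: "real \<Rightarrow> real \<Rightarrow> st \<Rightarrow> real" where
  "beta \<alpha> R z = 2 * \<alpha> * ((dd 1 \<phi> (fst z))\<^sup>2 + Sg R z * dd 1 (dd 1 \<phi>) (fst z))"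

lemma smooth_\<phi>1: "smooth {1} (dd 1 \<phi>)" by (rule smooth_dd[OF smooth_\<phi>]) simp

lemma carleman_coeffs_weight: "carleman_coeffs (kap \<alpha> R) (ca \<alpha> R) (cb \<alpha> R) (tau \<alpha> R) (beta \<alpha> R)"
proof
  have t: "has_dd e (\<lambda>z. dd 1 \<phi> (fst z)) (\<lambda>z. dd 1 (dd 1 \<phi>) (fst z) * fst e)" for e :: st
    by (rule has_dd_time[OF smooth_\<phi>1])
  have a: "dd e (ca \<alpha> R) = (\<lambda>z. 2 * \<alpha> * (1 / R) * (snd e $ 1 / R + dd 1 \<phi> (fst z) * fst e))" for e
    unfolding ca_def[abs_def] by (intro has_dd_imp_dd has_dd_cmult Sg_has_dd)
  have b: "dd e (cb \<alpha> R) = (\<lambda>z. 2 * \<alpha> * ((snd e $ 1 / R + dd 1 \<phi> (fst z) * fst e) * dd 1 \<phi> (fst z) + Sg R z * (dd 1 (dd 1 \<phi>) (fst z) * fst e)))" for e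
    unfolding cb_def[abs_def] by (intro has_dd_imp_dd has_dd_cmult has_dd_mult Sg_has_dd t)
  have ta: "dd e (tau \<alpha> R) = (\<lambda>z. 2 * \<alpha> * (1 / R) * (dd 1 (dd 1 \<phi>) (fst z) * fst e))" for e
    unfolding tau_def[abs_def] by (intro has_dd_imp_dd has_dd_cmult t)
  show "smooth adirs (ca \<alpha> R)" "smooth adirs (cb \<alpha> R)" "smooth adirs (tau \<alpha> R)"
    unfolding ca_def[abs_def] cb_def[abs_def] tau_def[abs_def]
    by (intro smooth_mult smooth_const smooth_Sg smooth_compose[OF smooth_\<phi>1 smooth_fst])+
  show "dT (ca \<alpha> R) = tau \<alpha> R" by (simp add: a tau_def fun_eq_iff)
  show "dT (cb \<alpha> R) = beta \<alpha> R" by (simp add: b beta_def fun_eq_iff power2_eq_square)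
  show "dX (ca \<alpha> R) = (\<lambda>_. kap \<alpha> R)" by (simp add: a kap_def fun_eq_iff power2_eq_square)
  show "dY (ca \<alpha> R) = (\<lambda>_. 0)" "dZ (ca \<alpha> R) = (\<lambda>_. 0)" by (simp_all add: a)
  show "dX (cb \<alpha> R) = tau \<alpha> R" by (simp add: b tau_def fun_eq_iff)
  show "dY (cb \<alpha> R) = (\<lambda>_. 0)" "dZ (cb \<alpha> R) = (\<lambda>_. 0)" "dX (tau \<alpha> R) = (\<lambda>_. 0)" by (simp_all add: b ta)
qed

lemma wt_has_dd: "has_dd e (wt \<alpha> R) (\<lambda>z. 2 * \<alpha> * Sg R z * (snd e $ 1 / R + dd 1 \<phi> (fst z) * fst e) * wt \<alpha> R z)"
proof -
  have e: "has_dd 1 exp (exp :: real \<Rightarrow> real)" by (simp add: has_dd_1)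
  have "has_dd e (\<lambda>z. \<alpha> * (Sg R z)\<^sup>2) (\<lambda>z. \<alpha> * (2 * Sg R z * (snd e $ 1 / R + dd 1 \<phi> (fst z) * fst e)))"
    by (intro has_dd_cmult has_dd_sq Sg_has_dd)
  from has_dd_compose[OF e this] show ?thesis unfolding wt_def[abs_def] by (simp add: algebra_simps)
qed

lemma wt_dd: "dX (wt \<alpha> R) = (\<lambda>z. ca \<alpha> R z * wt \<alpha> R z)" "dY (wt \<alpha> R) = (\<lambda>_. 0)" "dZ (wt \<alpha> R) = (\<lambda>_. 0)"
  "dT (wt \<alpha> R) = (\<lambda>z. cb \<alpha> R z * wt \<alpha> R z)"
  unfolding has_dd_imp_dd[OF wt_has_dd] by (simp_all add: ca_def cb_def fun_eq_iff)

lemma smooth_wt: "smooth B (wt \<alpha> R)"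
  unfolding wt_def[abs_def] by (intro smooth_compose[OF smooth_exp] smooth_mult smooth_const smooth_power smooth_Sg)

definition Ef :: "real \<Rightarrow> real \<Rightarrow> st \<Rightarrow> real" where "Ef \<alpha> R z = wt \<alpha> R z * chi R z"

lemma smooth_Ef: "smooth B (Ef \<alpha> R)"
  unfolding Ef_def[abs_def] by (intro smooth_mult smooth_wt smooth_chi)

lemma Ef_zero: "R \<ge> 2 \<Longrightarrow> z \<in> Zset R \<Longrightarrow> Ef \<alpha> R z = 0"
  using chi_zero[of R z] by (auto simp: Ef_def Zset_def)

lemma not_Zset: "z \<notin> Zset R \<Longrightarrow> fst z \<in> {0..1} \<and> fst z \<in> {0<..<1} \<and> norm (snd z) \<le> R \<and> 1 \<le> Sg R z"
  using r0 r1 by (auto simp: Zset_def)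

lemma bsupp_Ef: assumes "R \<ge> 2" shows "bsupp (Ef \<alpha> R)"
  unfolding bsupp_def
proof (intro exI[of _ "R + 1"] allI impI)
  fix z :: st assume z: "norm z > R + 1"
  have "norm z \<le> norm (fst z) + norm (snd z)" by (metis norm_Pair_le prod.collapse)
  then have "z \<in> Zset R" using not_Zset[of z R] z by force
  then show "Ef \<alpha> R z = 0" by (rule Ef_zero[OF assms])
qed

end

text \<open>One list for each triple with k + l + n \<le> 2, in the normal form produced by
  \<open>mi\<close>, so that sums over it are the sums in \<open>A_R\<close>.\<close>

definition Jset :: "(real^3) list set" where
  "Jset = {[], [ex], [ey], [ez], [ex, ex], [ex, ey], [ex, ez], [ey, ey], [ey, ez], [ez, ez]}"

lemma exyz_neq [simp]: "ex \<noteq> ey" "ey \<noteq> ex" "ex \<noteq> ez" "ez \<noteq> ex" "ey \<noteq> ez" "ez \<noteq> ey"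
  by (metis exyz_nth zero_neq_one)+

lemma Jset_dirs: "es \<in> Jset \<Longrightarrow> set es \<subseteq> dirs \<and> length es \<le> 3" by (auto simp: Jset_def)
lemma finite_Jset: "finite Jset" by (simp add: Jset_def)

lemma mi_sum: "(\<Sum>k\<le>2. \<Sum>l\<le>2-k. \<Sum>n\<le>2-k-l. f (mi k l n)) = (\<Sum>es\<in>Jset. f es)" for f :: "(real^3) list \<Rightarrow> real"
  by (simp add: Jset_def mi_def numeral_2_eq_2)

text \<open>Convolution turns a time derivative in the L^2 sense into a classical one at each point,
  because Cauchy-Schwarz bounds the error of the difference quotient by its L^2 norm times that of
  the kernel.\<close>

lemma has_dd_tconv_time:
  assumes F: "l2_cont_UNIV F" and G: "l2_cont_UNIV G" and c: "cc \<rho>"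
    and lim: "((\<lambda>s. nsq (\<lambda>x. (F s x - F (fst z) x) / (s - fst z) - G (fst z) x)) \<longlongrightarrow> 0) (at (fst z))"
  shows "((\<lambda>s. tconv F \<rho> (z + s *\<^sub>R (1, 0))) has_real_derivative tconv G \<rho> z) (at 0)"
proof -
  obtain t p where z: "z = (t, p)" by (cases z)
  have s: "sq_int (F t)" "sq_int (G t)" for t using F G by (auto simp: l2_cont_UNIV_def)
  let ?h = "\<lambda>s x. (F s x - F t x) / (s - t) - G t x"
  have sq: "sq_int (\<lambda>x. (F s x - F t x) / (s - t))" for s
    using sq_int_cmult[OF sq_int_diff[OF s(1)[of s] s(1)[of t]], of "inverse (s - t)"] by (simp add: divide_inverse mult.commute)
  have "((\<lambda>s. sqrt (nsq (?h s)) * sqrt (nsq \<rho>)) \<longlongrightarrow> sqrt 0 * sqrt (nsq \<rho>)) (at t)"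
    using lim z by (intro tendsto_intros) simp
  then have l: "((\<lambda>s. sqrt (nsq (?h s)) * sqrt (nsq \<rho>)) \<longlongrightarrow> 0) (at t)" by simp
  have "((\<lambda>s. (conv (F s) \<rho> p - conv (F t) \<rho> p) / (s - t) - conv (G t) \<rho> p) \<longlongrightarrow> 0) (at t)"
  proof (rule Lim_null_comparison[OF _ l], rule always_eventually, rule allI)
    fix \<sigma>
    have "conv (?h \<sigma>) \<rho> p = conv (\<lambda>x. inverse (\<sigma> - t) * (F \<sigma> x - F t x)) \<rho> p - conv (G t) \<rho> p"
      using conv_diff_left[OF sq[of \<sigma>] s(2)[of t] c] by (simp add: divide_inverse mult.commute)
    also have "\<dots> = inverse (\<sigma> - t) * (conv (F \<sigma>) \<rho> p - conv (F t) \<rho> p) - conv (G t) \<rho> p"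
      by (simp only: conv_cmult_left conv_diff_left[OF s(1) s(1) c])
    finally have "(conv (F \<sigma>) \<rho> p - conv (F t) \<rho> p) / (\<sigma> - t) - conv (G t) \<rho> p = conv (?h \<sigma>) \<rho> p"
      by (simp add: divide_inverse mult.commute)
    then show "norm ((conv (F \<sigma>) \<rho> p - conv (F t) \<rho> p) / (\<sigma> - t) - conv (G t) \<rho> p) \<le> sqrt (nsq (?h \<sigma>)) * sqrt (nsq \<rho>)"
      using conv_bound[OF sq_int_diff[OF sq[of \<sigma>] s(2)[of t]] c, of p] by simp
  qed
  then have "((\<lambda>s. (conv (F s) \<rho> p - conv (F t) \<rho> p) / (s - t)) \<longlongrightarrow> conv (G t) \<rho> p) (at t)"
    by (rule LIM_zero_cancel)
  then have "((\<lambda>s. conv (F s) \<rho> p) has_real_derivative conv (G t) \<rho> p) (at (0 + t))"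
    by (simp add: has_field_derivative_iff)
  then have "((\<lambda>s. conv (F (s + t)) \<rho> p) has_real_derivative conv (G t) \<rho> p) (at 0)"
    by (simp only: DERIV_shift)
  then show ?thesis by (simp add: z tconv_def add.commute)
qed

section \<open>The mollified difference with weight and cutoff\<close>

locale zk_main = zk_weight + zk_pair
begin

abbreviation V :: "nat \<Rightarrow> st \<Rightarrow> real" where "V k \<equiv> tconv v (moll k)"
abbreviation D :: "(real^3) list \<Rightarrow> nat \<Rightarrow> st \<Rightarrow> real" where "D es k \<equiv> tconv (d es) (moll k)"

lemma V_pd: "set es \<subseteq> dirs \<Longrightarrow> length es \<le> 3 \<Longrightarrow> tconv v (pd_list es (moll k)) = D es k"
  unfolding tconv_def using conv_weak_deriv[OF d_weak moll_test] by auto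

lemma V_D0: "V k = D [] k" using V_pd[of "[]" k] by simp

lemma dd_tconv_v: "test_fun \<rho> \<Longrightarrow> e \<in> dirs \<Longrightarrow> dd (0, e) (tconv v \<rho>) = tconv v (dd e \<rho>)"
  by (rule has_dd_imp_dd[OF tconv_has_dd[OF v_cont]])

lemma V_dd1: "e \<in> dirs \<Longrightarrow> dd (0, e) (V k) = D [e] k"
  using V_pd[of "[e]" k] dd_tconv_v[OF moll_test] by (simp add: pd_list_Cons_dd del: pd_list.simps(2))
lemma smooth_D: "set es \<subseteq> dirs \<Longrightarrow> length es \<le> 3 \<Longrightarrow> smooth sdirs (D es k)"
  by (rule tconv_smooth[OF d_cont moll_test])

lemma dd_D: "set es \<subseteq> dirs \<Longrightarrow> length es \<le> 2 \<Longrightarrow> e \<in> dirs \<Longrightarrow> dd (0, e) (D es k) = D (e # es) k"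
  using dd_tconv_v[OF test_fun_pd[OF moll_test], of es e k] V_pd[of es k] V_pd[of "e # es" k]
  by (simp add: pd_list_Cons_dd del: pd_list.simps(2))

lemma smooth_V: "smooth sdirs (V k)" by (rule tconv_smooth[OF v_cont moll_test])

lemma tconv_N: "tconv N (moll k) z = - (tconv w (moll k) z + D [ex, ex, ex] k z + D [ex, ey, ey] k z + D [ex, ez, ez] k z)"
proof -
  obtain t p where z: "z = (t, p)" by (cases z)
  have s: "sq_int (w t)" "sq_int (d [ex, ex, ex] t)" "sq_int (d [ex, ey, ey] t)" "sq_int (d [ex, ez, ez] t)"
    using w_cont d_cont[of "[ex, ex, ex]"] d_cont[of "[ex, ey, ey]"] d_cont[of "[ex, ez, ez]"] by (auto simp: l2_cont_UNIV_def)
  have "N t = (\<lambda>x. (-1) * (w t x + d [ex, ex, ex] t x + d [ex, ey, ey] t x + d [ex, ez, ez] t x))"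
    by (auto simp: N_def)
  then have "conv (N t) (moll k) p = (-1) * conv (\<lambda>x. w t x + d [ex, ex, ex] t x + d [ex, ey, ey] t x + d [ex, ez, ez] t x) (moll k) p"
    by (simp only: conv_cmult_left)
  then show ?thesis by (simp add: z tconv_def conv_add_left s sq_int_add moll_cc)
qed

text \<open>The integrand of \<open>A_R\<close> for the mollified difference; it dominates every
  term of the cutoff error.\<close>

definition SV :: "nat \<Rightarrow> st \<Rightarrow> real" where "SV k z = (\<Sum>es\<in>Jset. (D es k z)\<^sup>2)"

lemma D_le_SV: "es \<in> Jset \<Longrightarrow> \<bar>D es k z\<bar> \<le> sqrt (SV k z)"
proof -
  assume "es \<in> Jset"
  then have "(D es k z)\<^sup>2 \<le> SV k z" unfolding SV_def
    by (intro member_le_sum) (auto simp: finite_Jset)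
  from real_sqrt_le_mono[OF this] show ?thesis by simp
qed

lemma SV_nonneg: "SV k z \<ge> 0" by (simp add: SV_def sum_nonneg)

text \<open>The commutator of \<open>\<partial>\<^sub>t + \<partial>\<^sub>x\<Delta>\<close> with multiplication by \<open>chi R\<close>.\<close>

definition Rem :: "real \<Rightarrow> nat \<Rightarrow> st \<Rightarrow> real" where
  "Rem R k z = dT (chi R) z * D [] k z
     + (dX (dX (dX (chi R))) z + dX (dY (dY (chi R))) z + dX (dZ (dZ (chi R))) z) * D [] k z
     + (3 * dX (dX (chi R)) z + dY (dY (chi R)) z + dZ (dZ (chi R)) z) * D [ex] k z
     + 2 * dX (dY (chi R)) z * D [ey] k z + 2 * dX (dZ (chi R)) z * D [ez] k z
     + 3 * dX (chi R) z * D [ex, ex] k z + 2 * dY (chi R) z * D [ex, ey] k z + 2 * dZ (chi R) z * D [ex, ez] k z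
     + dX (chi R) z * (D [ey, ey] k z + D [ez, ez] k z)"

text \<open>v has a time derivative only on (0, 1). At all other times the point lies in the open
  set \<open>Zset R\<close>, where the product is locally zero whatever v does.\<close>

lemma EV_time: 
  assumes R: "R \<ge> 2"
  shows "has_dd (1, 0) (\<lambda>z. Ef \<alpha> R z * V k z) (\<lambda>z. dT (Ef \<alpha> R) z * V k z + Ef \<alpha> R z * tconv w (moll k) z)"
  unfolding has_dd_def
proof
  fix z
  let ?W = "tconv w (moll k)"
  show "((\<lambda>s. Ef \<alpha> R (z + s *\<^sub>R (1, 0)) * V k (z + s *\<^sub>R (1, 0))) has_real_derivative
      dT (Ef \<alpha> R) z * V k z + Ef \<alpha> R z * ?W z) (at 0)"
  proof (cases "z \<in> Zset R")
    case True
    have "Ef \<alpha> R z = 0" by (rule Ef_zero[OF R True])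
    moreover have "dT (Ef \<alpha> R) z = 0" by (rule dd_zero_open[OF open_Zset True]) (rule Ef_zero[OF R])
    moreover have "((\<lambda>s. Ef \<alpha> R (z + s *\<^sub>R (1, 0)) * V k (z + s *\<^sub>R (1, 0))) has_real_derivative 0) (at 0)"
      by (rule dd_locally_const[OF open_Zset True, of "\<lambda>z. Ef \<alpha> R z * V k z" 0]) (simp add: Ef_zero[OF R])
    ultimately show ?thesis by simp
  next
    case False
    then have t: "fst z \<in> {0<..<1}" using not_Zset by blast
    have v: "((\<lambda>s. V k (z + s *\<^sub>R (1, 0))) has_real_derivative ?W z) (at 0)"
      by (rule has_dd_tconv_time[OF v_cont w_cont moll_cc v_deriv[OF t]])
    have e: "((\<lambda>s. Ef \<alpha> R (z + s *\<^sub>R (1, 0))) has_real_derivative dT (Ef \<alpha> R) z) (at 0)"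
      using smooth_has_dd[OF smooth_Ef[of adirs \<alpha> R], of "(1, 0)", unfolded has_dd_def, rule_format, of z] by simp
    show ?thesis using DERIV_mult[OF e v] by (simp add: algebra_simps zero_prod_def[symmetric])
  qed
qed

lemma EV_good: assumes R: "R \<ge> 2" shows "good (\<lambda>z. Ef \<alpha> R z * V k z)"
proof -
  have sE: "smooth sdirs (dT (Ef \<alpha> R))"
    by (rule smooth_subset[OF smooth_dd[OF smooth_Ef[of adirs]] sdirs_adirs]) simp
  show ?thesis unfolding good_def has_dd_imp_dd[OF EV_time[OF R]]
    by (intro conjI smooth_mult smooth_add smooth_Ef smooth_V sE tconv_smooth[OF w_cont moll_test]
        bsupp_mult1 bsupp_Ef[OF R] EV_time[OF R])
qed

text \<open>Multiplication by the weight intertwines P = d_t + d_x Laplace with \<open>opA\<close> +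
  \<open>opS\<close>, so the left side is the weight times P (chi V) = \<open>Rem\<close> + chi P V.
  Finally P V = - \<open>tconv N (moll k)\<close>, as mollification commutes with weak
  derivatives.\<close>

lemma EV_operator:
  fixes \<alpha> R :: real and k :: nat and f :: "st \<Rightarrow> real"
  assumes R: "R \<ge> 2"
  defines "f \<equiv> (\<lambda>z. Ef \<alpha> R z * V k z)"
  shows "carleman_coeffs.opA (kap \<alpha> R) (ca \<alpha> R) f z + carleman_coeffs.opS (kap \<alpha> R) (ca \<alpha> R) (cb \<alpha> R) f z
     = wt \<alpha> R z * (Rem R k z - chi R z * tconv N (moll k) z)"
proof -
  interpret C: carleman_coeffs "kap \<alpha> R" "ca \<alpha> R" "cb \<alpha> R" "tau \<alpha> R" "beta \<alpha> R" by (rule carleman_coeffs_weight)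
  have sc [simp]: "smooth sdirs (chi R)" "smooth sdirs (V k)" "smooth sdirs (wt \<alpha> R)" "smooth sdirs (ca \<alpha> R)"
    using smooth_chi smooth_V smooth_wt C.sa by auto
  note [simp] = smooth_s_rules smooth_dd
  define g where "g = (\<lambda>z. chi R z * V k z)"
  have sg [simp]: "smooth sdirs g" by (simp add: g_def)
  have fg: "f = (\<lambda>z. wt \<alpha> R z * g z)" by (auto simp: f_def Ef_def g_def)
  let ?W = "tconv w (moll k)"
  have fT: "dT f = (\<lambda>z. wt \<alpha> R z * (cb \<alpha> R z * g z + (dT (chi R) z * V k z + chi R z * ?W z)))"
  proof -
    have "dT (Ef \<alpha> R) = (\<lambda>z. dT (wt \<alpha> R) z * chi R z + wt \<alpha> R z * dT (chi R) z)"
      unfolding Ef_def[abs_def] by (rule dd_mult[of adirs]) (auto intro: smooth_wt smooth_chi)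
    then show ?thesis unfolding f_def has_dd_imp_dd[OF EV_time[OF R]]
      by (simp add: wt_dd Ef_def g_def fun_eq_iff algebra_simps)
  qed
  have X1: "dX f = (\<lambda>z. wt \<alpha> R z * (ca \<alpha> R z * g z + dX g z))"
    unfolding fg by (simp add: dd_mult[of sdirs] wt_dd fun_eq_iff algebra_simps)
  have X2: "dX (dX f) = (\<lambda>z. wt \<alpha> R z * (((ca \<alpha> R z)\<^sup>2 + kap \<alpha> R) * g z + 2 * ca \<alpha> R z * dX g z + dX (dX g) z))"
    unfolding X1 by (simp add: dd_rules[of sdirs] wt_dd C.dXa fun_eq_iff power2_eq_square algebra_simps)
  have X3: "dX (dX (dX f)) = (\<lambda>z. wt \<alpha> R z * (((ca \<alpha> R z)^3 + 3 * kap \<alpha> R * ca \<alpha> R z) * g z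
      + (3 * (ca \<alpha> R z)\<^sup>2 + 3 * kap \<alpha> R) * dX g z + 3 * ca \<alpha> R z * dX (dX g) z + dX (dX (dX g)) z))"
    unfolding X2 by (simp add: dd_rules[of sdirs] dd_const wt_dd C.dXa fun_eq_iff power2_eq_square power3_eq_cube algebra_simps)
  have Y2: "dY (dY f) = (\<lambda>z. wt \<alpha> R z * dY (dY g) z)" "dZ (dZ f) = (\<lambda>z. wt \<alpha> R z * dZ (dZ g) z)"
    unfolding fg by (simp_all add: dd_rules[of sdirs] wt_dd)
  have Y3: "dX (dY (dY f)) = (\<lambda>z. wt \<alpha> R z * (ca \<alpha> R z * dY (dY g) z + dX (dY (dY g)) z))"
    "dX (dZ (dZ f)) = (\<lambda>z. wt \<alpha> R z * (ca \<alpha> R z * dZ (dZ g) z + dX (dZ (dZ g)) z))"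
    unfolding Y2 by (simp_all add: dd_rules[of sdirs] wt_dd fun_eq_iff algebra_simps)
  have 1: "C.opA f z + C.opS f z = wt \<alpha> R z * (dT (chi R) z * V k z + chi R z * ?W z
      + dX (dX (dX g)) z + dX (dY (dY g)) z + dX (dZ (dZ g)) z)"
    by (simp only: C.opA_def C.opS_def fT[THEN fun_cong, of z] X3[THEN fun_cong, of z] X2[THEN fun_cong, of z] X1[THEN fun_cong, of z]
        Y2[THEN fun_cong, of z] Y3[THEN fun_cong, of z] fg[THEN fun_cong, of z])
       (simp add: power2_eq_square power3_eq_cube algebra_simps)
  have gx: "dX (dX (dX g)) z + dX (dY (dY g)) z + dX (dZ (dZ g)) z =
     Rem R k z - dT (chi R) z * D [] k z + chi R z * (D [ex, ex, ex] k z + D [ex, ey, ey] k z + D [ex, ez, ez] k z)"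
    unfolding g_def
    by (simp add: dd_rules[of sdirs] dd_const V_D0 dd_D smooth_D Rem_def) (simp add: algebra_simps)
  show ?thesis unfolding 1 tconv_N using gx by (simp add: V_D0[symmetric] algebra_simps)
qed

end

section \<open>The lower bound\<close>

lemma weighted_sq_integrable:
  assumes f: "sq_int f" and m: "m \<in> borel_measurable borel" and C: "\<And>x. \<bar>m x\<bar> \<le> C"
  shows "integrable lborel (\<lambda>x. m x * (f x)\<^sup>2)"
  using sq_int_mult_integrable[OF sq_int_bdd_mult[OF f m C] f] by (simp add: power2_eq_square mult.assoc)

context zk_main
begin

definition m1 :: "real \<Rightarrow> st \<Rightarrow> real" where
  "m1 R = indicator {z. fst z \<in> {0..1} \<and> R - 1 \<le> norm (snd z) \<and> norm (snd z) \<le> R}"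
definition m2 :: "real \<Rightarrow> st \<Rightarrow> real" where "m2 R = indicator (slab R)"
definition mq :: "st \<Rightarrow> real" where "mq = indicator ({r..1-r} \<times> cball 0 1)"
text \<open>A majorant for the squared weight where derivatives of the cutoff live. The second mask
  is the whole slab rather than its part with s \<le> 2: the energy over the slab is bounded in R,
  so the larger region does no harm.\<close>

definition mreg :: "real \<Rightarrow> real \<Rightarrow> st \<Rightarrow> real" where
  "mreg \<alpha> R z = exp (32 * \<alpha>) * m1 R z + exp (8 * \<alpha>) * m2 R z"

definition chib :: "real \<Rightarrow> real \<Rightarrow> bool" where
  "chib C R \<longleftrightarrow> 0 \<le> C \<and> (\<forall>z\<in>slab R. \<forall>e\<in>adirs. \<bar>dd e (chi R) z\<bar> \<le> C \<and>
     (\<forall>e'\<in>adirs. \<bar>dd e (dd e' (chi R)) z\<bar> \<le> C \<and> (\<forall>e''\<in>adirs. \<bar>dd e (dd e' (dd e'' (chi R))) z\<bar> \<le> C)))"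

lemma measurable_masks [measurable]:
  "m1 R \<in> borel_measurable borel" "m2 R \<in> borel_measurable borel" "mq \<in> borel_measurable borel"
proof -
  have "closed ({0..1::real} \<times> {p::real^3. R - 1 \<le> norm p \<and> norm p \<le> R})"
    by (intro closed_Times closed_Collect_conj closed_Collect_le continuous_intros closed_atLeastAtMost)
  moreover have "{z::st. fst z \<in> {0..1} \<and> R - 1 \<le> norm (snd z) \<and> norm (snd z) \<le> R} = {0..1} \<times> {p::real^3. R - 1 \<le> norm p \<and> norm p \<le> R}"
    by auto
  ultimately have "closed {z::st. fst z \<in> {0..1} \<and> R - 1 \<le> norm (snd z) \<and> norm (snd z) \<le> R}" by simp
  then show "m1 R \<in> borel_measurable borel" unfolding m1_def by (intro borel_measurable_indicator borel_closed)
  have "slab R = {0..1} \<times> cball 0 R" by (auto simp: slab_def)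
  then have "closed (slab R)" by (simp add: closed_Times)
  then show "m2 R \<in> borel_measurable borel" unfolding m2_def by (intro borel_measurable_indicator borel_closed)
  have "closed ({r..1-r} \<times> cball (0::real^3) 1)" by (intro closed_Times) auto
  then show "mq \<in> borel_measurable borel" unfolding mq_def by (intro borel_measurable_indicator borel_closed)
qed

lemma masks_bounds: "\<bar>m1 R z\<bar> \<le> 1" "\<bar>m2 R z\<bar> \<le> 1" "\<bar>mq z\<bar> \<le> 1" "0 \<le> m1 R z" "0 \<le> m2 R z" "0 \<le> mq z"
  by (auto simp: m1_def m2_def mq_def indicator_def)

lemma masks_support:
  "m1 R (t, p) \<noteq> 0 \<Longrightarrow> t \<in> {0..1} \<and> norm p \<le> R"
  "m2 R (t, p) \<noteq> 0 \<Longrightarrow> t \<in> {0..1} \<and> norm p \<le> R"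
  "mq (t, p) \<noteq> 0 \<Longrightarrow> t \<in> {0..1} \<and> norm p \<le> 1"
  using r0 by (auto simp: m1_def m2_def mq_def slab_def indicator_def split: if_splits)

lemma mreg_nonneg: "0 \<le> mreg \<alpha> R z"
  using masks_bounds by (simp add: mreg_def)

lemma wt_le_mreg:
  assumes R: "R \<ge> 2" and \<alpha>: "\<alpha> \<ge> 0" and z: "z \<notin> Zset R \<union> Oset R"
  shows "(wt \<alpha> R z)\<^sup>2 \<le> mreg \<alpha> R z"
proof -
  have n: "fst z \<in> {0..1}" "norm (snd z) \<le> R" "1 \<le> Sg R z" using not_Zset[of z R] z by auto
  have m2: "m2 R z = 1" using n by (simp add: m2_def slab_def)
  have w: "(wt \<alpha> R z)\<^sup>2 = exp (2 * (\<alpha> * (Sg R z)\<^sup>2))" by (simp add: wt_def exp_double)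
  have "norm (snd z) \<ge> R - 1 \<or> Sg R z \<le> 2" using z by (auto simp: Oset_def)
  then show ?thesis
  proof
    assume "norm (snd z) \<ge> R - 1"
    then have "m1 R z = 1" using n by (simp add: m1_def)
    moreover have "(Sg R z)\<^sup>2 \<le> 4\<^sup>2" using n Sg_le[OF R n(2)] by (intro power_mono) auto
    then have "\<alpha> * (Sg R z)\<^sup>2 \<le> \<alpha> * 16" using \<alpha> by (intro mult_left_mono) auto
    then have "(wt \<alpha> R z)\<^sup>2 \<le> exp (32 * \<alpha>)" unfolding w by simp
    ultimately show ?thesis using m2 by (simp add: mreg_def add_increasing2)
  next
    assume "Sg R z \<le> 2"
    then have "(Sg R z)\<^sup>2 \<le> 2\<^sup>2" using n by (intro power_mono) auto
    then have "\<alpha> * (Sg R z)\<^sup>2 \<le> \<alpha> * 4" using \<alpha> by (intro mult_left_mono) auto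
    then have "(wt \<alpha> R z)\<^sup>2 \<le> exp (8 * \<alpha>)" unfolding w by simp
    then show ?thesis using m2 masks_bounds(4)[of R z] by (simp add: mreg_def add_increasing)
  qed
qed

text \<open>On \<open>Zset R\<close> and \<open>Oset R\<close> all derivatives of the cutoff vanish;
  elsewhere they are at most C, the squared weight is at most \<open>mreg\<close>, and each
  derivative of the mollified difference is at most the square root of \<open>SV\<close>.\<close>

lemma error_bounds:
  assumes R: "R \<ge> 2" and \<alpha>: "\<alpha> \<ge> 0" and C: "chib C R"
  shows "(wt \<alpha> R z * Rem R k z)\<^sup>2 \<le> 484 * C\<^sup>2 * (mreg \<alpha> R z * SV k z)"
    and "(wt \<alpha> R z * (dX (chi R) z * V k z))\<^sup>2 \<le> C\<^sup>2 * (mreg \<alpha> R z * SV k z)"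
proof -
  have nn: "0 \<le> mreg \<alpha> R z * SV k z" by (intro mult_nonneg_nonneg mreg_nonneg SV_nonneg)
  have "(wt \<alpha> R z * Rem R k z)\<^sup>2 \<le> 484 * C\<^sup>2 * (mreg \<alpha> R z * SV k z) \<and>
      (wt \<alpha> R z * (dX (chi R) z * V k z))\<^sup>2 \<le> C\<^sup>2 * (mreg \<alpha> R z * SV k z)"
  proof (cases "z \<in> Zset R \<union> Oset R")
    case True
    note [simp] = chi_dd_zero[OF R True]
    have "Rem R k z = 0" "dX (chi R) z = 0" by (simp_all add: Rem_def)
    then show ?thesis using nn by simp
  next
    case False
    define y where "y = sqrt (SV k z)"
    have y0: "y \<ge> 0" by (simp add: y_def SV_nonneg)
    have yy: "y\<^sup>2 = SV k z" by (simp add: y_def SV_nonneg)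
    have C0: "C \<ge> 0" using C by (simp add: chib_def)
    have zs: "z \<in> slab R" using not_Zset[of z R] False by (simp add: slab_def)
    have c1: "\<bar>dd e (chi R) z\<bar> \<le> C" if "e \<in> adirs" for e using C zs that unfolding chib_def by blast
    have c2: "\<bar>dd e (dd e' (chi R)) z\<bar> \<le> C" if "e \<in> adirs" "e' \<in> adirs" for e e' using C zs that unfolding chib_def by blast
    have c3: "\<bar>dd e (dd e' (dd e'' (chi R))) z\<bar> \<le> C" if "e \<in> adirs" "e' \<in> adirs" "e'' \<in> adirs" for e e' e''
      using C zs that unfolding chib_def by blast
    have v: "\<bar>D es k z\<bar> \<le> y" if "es \<in> Jset" for es unfolding y_def by (rule D_le_SV[OF that])
    have J: "[] \<in> Jset" "[ex] \<in> Jset" "[ey] \<in> Jset" "[ez] \<in> Jset" "[ex, ex] \<in> Jset" "[ex, ey] \<in> Jset" "[ex, ez] \<in> Jset"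
      "[ey, ey] \<in> Jset" "[ez, ez] \<in> Jset" by (auto simp: Jset_def)
    have p: "\<bar>c * D es k z\<bar> \<le> n * (C * y)" if "\<bar>c\<bar> \<le> n * C" "es \<in> Jset" for c n es
    proof -
      have "\<bar>c * D es k z\<bar> \<le> (n * C) * y" unfolding abs_mult
        using that v[OF that(2)] y0 by (intro mult_mono) (auto intro: order_trans[OF abs_ge_zero])
      then show ?thesis by simp
    qed
    note x = adirs_in(1) and y' = adirs_in(2) and z' = adirs_in(3)
    have t1: "\<bar>dT (chi R) z * D [] k z\<bar> \<le> 1 * (C * y)" using c1 by (intro p J) auto
    have t2: "\<bar>(dX (dX (dX (chi R))) z + dX (dY (dY (chi R))) z + dX (dZ (dZ (chi R))) z) * D [] k z\<bar> \<le> 3 * (C * y)"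
      using c3[OF x x x] c3[OF x y' y'] c3[OF x z' z'] by (intro p J) linarith
    have t3: "\<bar>(3 * dX (dX (chi R)) z + dY (dY (chi R)) z + dZ (dZ (chi R)) z) * D [ex] k z\<bar> \<le> 5 * (C * y)"
      using c2[OF x x] c2[OF y' y'] c2[OF z' z'] by (intro p J) linarith
    have t4: "\<bar>2 * dX (dY (chi R)) z * D [ey] k z\<bar> \<le> 2 * (C * y)" using c2[OF x y'] by (intro p J) linarith
    have t5: "\<bar>2 * dX (dZ (chi R)) z * D [ez] k z\<bar> \<le> 2 * (C * y)" using c2[OF x z'] by (intro p J) linarith
    have t6: "\<bar>3 * dX (chi R) z * D [ex, ex] k z\<bar> \<le> 3 * (C * y)" using c1[OF x] by (intro p J) linarith
    have t7: "\<bar>2 * dY (chi R) z * D [ex, ey] k z\<bar> \<le> 2 * (C * y)" using c1[OF y'] by (intro p J) linarith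
    have t8: "\<bar>2 * dZ (chi R) z * D [ex, ez] k z\<bar> \<le> 2 * (C * y)" using c1[OF z'] by (intro p J) linarith
    have t9: "\<bar>dX (chi R) z * D [ey, ey] k z\<bar> \<le> 1 * (C * y)" "\<bar>dX (chi R) z * D [ez, ez] k z\<bar> \<le> 1 * (C * y)"
      using c1[OF x] by (intro p J; linarith)+
    note T = t1 t2 t3 t4 t5 t6 t7 t8 t9
    \<comment> \<open>22 is the sum of the factors in t1 to t9, and 484 is its square.\<close>
    have "\<bar>Rem R k z\<bar> \<le> 22 * (C * y)"
      unfolding Rem_def distrib_left
    proof (rule abs_leI)
    qed (use T[THEN abs_le_D1] T[THEN abs_le_D2] in linarith)+
    then have "(Rem R k z)\<^sup>2 \<le> (22 * (C * y))\<^sup>2" using C0 y0 by (intro abs_le_square_iff[THEN iffD1]) simp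
    then have r: "(Rem R k z)\<^sup>2 \<le> 484 * C\<^sup>2 * SV k z" by (simp add: power_mult_distrib yy)
    have "\<bar>dX (chi R) z * V k z\<bar> \<le> 1 * (C * y)" unfolding V_D0 using c1[of "(0,ex)"] by (intro p J) auto
    then have "(dX (chi R) z * V k z)\<^sup>2 \<le> (C * y)\<^sup>2" using C0 y0 by (intro abs_le_square_iff[THEN iffD1]) simp
    then have x: "(dX (chi R) z * V k z)\<^sup>2 \<le> C\<^sup>2 * SV k z" by (simp add: power_mult_distrib yy)
    note w = wt_le_mreg[OF R \<alpha> False]
    have "(wt \<alpha> R z)\<^sup>2 * (Rem R k z)\<^sup>2 \<le> mreg \<alpha> R z * (484 * C\<^sup>2 * SV k z)"
      by (intro mult_mono w r mreg_nonneg) simp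
    moreover have "(wt \<alpha> R z)\<^sup>2 * (dX (chi R) z * V k z)\<^sup>2 \<le> mreg \<alpha> R z * (C\<^sup>2 * SV k z)"
      by (intro mult_mono w x mreg_nonneg) simp
    ultimately show ?thesis by (simp add: power_mult_distrib mult.left_commute mult.assoc)
  qed
  then show "(wt \<alpha> R z * Rem R k z)\<^sup>2 \<le> 484 * C\<^sup>2 * (mreg \<alpha> R z * SV k z)"
    "(wt \<alpha> R z * (dX (chi R) z * V k z))\<^sup>2 \<le> C\<^sup>2 * (mreg \<alpha> R z * SV k z)" by auto
qed

lemma d_sq: "es \<in> Jset \<Longrightarrow> sq_int (d es t)"
  using d_cont[of es] Jset_dirs[of es] by (auto simp: l2_cont_UNIV_def)

lemma d_cont_J: "es \<in> Jset \<Longrightarrow> l2_cont_UNIV (d es)"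
  using d_cont[of es] Jset_dirs[of es] by auto

lemma mreg_SV_limit:
  shows "integrable lborel (\<lambda>z. mreg \<alpha> R z * SV k z)"
    and "(\<lambda>k. IT (\<lambda>z. mreg \<alpha> R z * SV k z)) \<longlonglongrightarrow>
      exp (32 * \<alpha>) * (\<Sum>es\<in>Jset. stint (m1 R) (d es))
      + exp (8 * \<alpha>) * (\<Sum>es\<in>Jset. stint (m2 R) (d es))"
proof -
  note t1 = tconv_weighted_tendsto[OF d_cont_J measurable_masks(1) masks_bounds(1) masks_support(1)]
  note t2 = tconv_weighted_tendsto[OF d_cont_J measurable_masks(2) masks_bounds(2) masks_support(2)]
  have eq: "(\<lambda>z. mreg \<alpha> R z * SV k z) = (\<lambda>z. exp (32 * \<alpha>) * (\<Sum>es\<in>Jset. m1 R z * (D es k z)\<^sup>2) + exp (8 * \<alpha>) * (\<Sum>es\<in>Jset. m2 R z * (D es k z)\<^sup>2))" for k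
    by (simp add: mreg_def SV_def sum_distrib_left distrib_right mult.assoc fun_eq_iff sum.distrib)
  show "integrable lborel (\<lambda>z. mreg \<alpha> R z * SV k z)"
    unfolding eq using t1(1) t2(1) by (intro Bochner_Integration.integrable_add integrable_mult_right Bochner_Integration.integrable_sum) auto
  have I: "IT (\<lambda>z. mreg \<alpha> R z * SV k z) = exp (32 * \<alpha>) * (\<Sum>es\<in>Jset. IT (\<lambda>z. m1 R z * (D es k z)\<^sup>2)) + exp (8 * \<alpha>) * (\<Sum>es\<in>Jset. IT (\<lambda>z. m2 R z * (D es k z)\<^sup>2))" for k
    unfolding eq using t1(1) t2(1) by (simp add: Bochner_Integration.integral_sum)
  show "(\<lambda>k. IT (\<lambda>z. mreg \<alpha> R z * SV k z)) \<longlonglongrightarrow>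
      exp (32 * \<alpha>) * (\<Sum>es\<in>Jset. stint (m1 R) (d es))
      + exp (8 * \<alpha>) * (\<Sum>es\<in>Jset. stint (m2 R) (d es))"
    unfolding I by (intro tendsto_intros t1(2) t2(2))
qed

text \<open>Applied to f = E V, \<open>carleman\<close> controls d_x f instead of E d_x V. The
  difference is a f plus a cutoff error. On the support a^2 is at most 64 \<alpha>^2 h^2, and the
  coefficient \<alpha>^5 h^6 = \<mu> \<alpha>^2 h^2 of f^2 is exactly large enough to pay for
  this.\<close>

lemma carleman_mollified:
  assumes R: "R \<ge> 2" and \<alpha>: "\<alpha> \<ge> 200" and key: "\<alpha>\<^sup>2 = 10000 * L\<^sup>2 * R^3" and C: "chib C R"
  defines "\<mu> \<equiv> \<alpha>^3 / R^4"
  shows "\<mu> * (IT (\<lambda>z. (Ef \<alpha> R z)\<^sup>2 * (V k z)\<^sup>2) + IT (\<lambda>z. (Ef \<alpha> R z)\<^sup>2 * (D [ex] k z)\<^sup>2))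
    \<le> 62 * IT (\<lambda>z. (Ef \<alpha> R z)\<^sup>2 * (tconv N (moll k) z)\<^sup>2) + (62 * 484 + 3 * \<mu>) * C\<^sup>2 * IT (\<lambda>z. mreg \<alpha> R z * SV k z)"
proof -
  interpret C: carleman_coeffs "kap \<alpha> R" "ca \<alpha> R" "cb \<alpha> R" "tau \<alpha> R" "beta \<alpha> R" by (rule carleman_coeffs_weight)
  define f where "f = (\<lambda>z. Ef \<alpha> R z * V k z)"
  define E where "E = Ef \<alpha> R"
  define Nk where "Nk = tconv N (moll k)"
  define S where "S = (\<lambda>z. mreg \<alpha> R z * SV k z)"
  define h where "h = 1 / R"
  have h0: "h > 0" using R by (simp add: h_def)
  have keyh: "\<alpha>\<^sup>2 * h^3 = 10000 * L\<^sup>2" using key R by (simp add: h_def power_divide)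
  have gf: "good f" unfolding f_def by (rule EV_good[OF R])
  have sf: "smooth sdirs f" and bf: "bsupp f" using gf by (auto simp: good_def)
  have cE: "cc E" unfolding E_def by (rule cc_smooth[OF smooth_Ef[of sdirs] bsupp_Ef[OF R]])
  have cV: "continuous_on UNIV (V k)" "continuous_on UNIV (D [ex] k)" "continuous_on UNIV Nk"
    unfolding Nk_def by (intro tconv_continuous v_cont N_cont d_cont moll_cc; simp)+
  have off: "f z = 0 \<and> dd e f z = 0" if "z \<notin> {z. 1 \<le> Sg R z \<and> z \<notin> Zset R}" for z e
  proof -
    have z: "z \<in> Zset R" using that not_Zset[of z R] by blast
    have "f z = 0" if "z \<in> Zset R" for z unfolding f_def by (simp add: Ef_zero[OF R that])
    then show ?thesis using dd_zero_open[OF open_Zset z, of f 0 e] z by blast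
  qed
  have coef: "8 * \<alpha>^5 * h^6 \<le> kap \<alpha> R * (ca \<alpha> R z)^4 / 2 + 3 * (ca \<alpha> R z)\<^sup>2 * tau \<alpha> R z - 10 * (kap \<alpha> R)\<^sup>2 * (ca \<alpha> R z)\<^sup>2 + beta \<alpha> R z / 2
        - 2 * kap \<alpha> R * tau \<alpha> R z - 15 / 2 * (kap \<alpha> R)^3 - 4 * kap \<alpha> R * ca \<alpha> R z * cb \<alpha> R z"
      "100 * \<alpha>^3 * h^4 \<le> 21 * kap \<alpha> R * (ca \<alpha> R z)\<^sup>2 - 3 * tau \<alpha> R z + 6 * (kap \<alpha> R)\<^sup>2"
      "0 \<le> kap \<alpha> R * (ca \<alpha> R z)\<^sup>2 - tau \<alpha> R z + 2 * (kap \<alpha> R)\<^sup>2"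
    if z: "z \<in> {z. 1 \<le> Sg R z \<and> z \<notin> Zset R}" for z
  proof -
    have t: "fst z \<in> {0..1}" "1 \<le> Sg R z" using z not_Zset by blast+
    note b = coefficient_bounds[OF \<alpha> h0 t(2) \<phi>_d1[OF t(1)] \<phi>_d2[OF t(1)] L1 keyh]
    show "8 * \<alpha>^5 * h^6 \<le> kap \<alpha> R * (ca \<alpha> R z)^4 / 2 + 3 * (ca \<alpha> R z)\<^sup>2 * tau \<alpha> R z - 10 * (kap \<alpha> R)\<^sup>2 * (ca \<alpha> R z)\<^sup>2 + beta \<alpha> R z / 2
        - 2 * kap \<alpha> R * tau \<alpha> R z - 15 / 2 * (kap \<alpha> R)^3 - 4 * kap \<alpha> R * ca \<alpha> R z * cb \<alpha> R z"
      using b(1) unfolding kap_def ca_def tau_def cb_def beta_def h_def .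
    show "100 * \<alpha>^3 * h^4 \<le> 21 * kap \<alpha> R * (ca \<alpha> R z)\<^sup>2 - 3 * tau \<alpha> R z + 6 * (kap \<alpha> R)\<^sup>2"
      using b(2) unfolding kap_def ca_def tau_def cb_def beta_def h_def .
    show "0 \<le> kap \<alpha> R * (ca \<alpha> R z)\<^sup>2 - tau \<alpha> R z + 2 * (kap \<alpha> R)\<^sup>2"
      using b(3) unfolding kap_def ca_def tau_def cb_def beta_def h_def .
  qed
  define Pf where "Pf z = C.opA f z + C.opS f z" for z
  have Pf: "Pf z = wt \<alpha> R z * (Rem R k z - chi R z * Nk z)" for z
    unfolding Pf_def Nk_def f_def by (rule EV_operator[OF R])
  have kap0: "kap \<alpha> R \<ge> 0" using \<alpha> by (simp add: kap_def)
  have carl: "8 * \<alpha>^5 * h^6 * IT (\<lambda>z. (f z)\<^sup>2) + 100 * \<alpha>^3 * h^4 * IT (\<lambda>z. (dX f z)\<^sup>2) \<le> 5 / 4 * IT (\<lambda>z. (Pf z)\<^sup>2)"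
    unfolding Pf_def by (rule C.carleman[OF gf kap0 off coef])
  have iS: "integrable lborel S" unfolding S_def by (rule mreg_SV_limit(1))
  have ccf: "cc f" "cc (dX f)" using sf bf by (auto intro!: cc_smooth[of sdirs] smooth_dd bsupp_dd)
  note i1 = cc_integrable[OF cc_power2[OF ccf(1)]] and i2 = cc_integrable[OF cc_power2[OF ccf(2)]]
  have cEN: "cc (\<lambda>z. E z * Nk z)" "cc (\<lambda>z. E z * D [ex] k z)" using cE cV by (auto intro: cc_mult1)
  note i3 = cc_integrable[OF cc_power2[OF cEN(1)]] and i4 = cc_integrable[OF cc_power2[OF cEN(2)]]
  have sPf: "smooth sdirs Pf"
    using gf C.sa C.sb by (simp add: Pf_def[abs_def] C.opA_def C.opS_def good_def smooth_s_rules smooth_dd)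
  have mPf: "Pf \<in> borel_measurable borel" by (rule borel_measurable_continuous_onI[OF smooth_cont[OF sPf]])
  have Pb: "(Pf z)\<^sup>2 \<le> 2 * (E z * Nk z)\<^sup>2 + 2 * (484 * C\<^sup>2 * S z)" for z
  proof -
    have "Pf z = wt \<alpha> R z * Rem R k z - E z * Nk z" unfolding Pf E_def Ef_def by (simp add: algebra_simps)
    moreover have "(a - b)\<^sup>2 \<le> 2 * b\<^sup>2 + 2 * a\<^sup>2" for a b :: real
      using sum_squares_bound[of a "- b"] by (simp add: power2_diff)
    ultimately have "(Pf z)\<^sup>2 \<le> 2 * (E z * Nk z)\<^sup>2 + 2 * (wt \<alpha> R z * Rem R k z)\<^sup>2" by simp
    moreover have "(wt \<alpha> R z * Rem R k z)\<^sup>2 \<le> 484 * C\<^sup>2 * S z"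
      using error_bounds(1)[OF R _ C, of \<alpha> z k] \<alpha> by (simp add: S_def)
    ultimately show ?thesis by linarith
  qed
  define IN where "IN = IT (\<lambda>z. (E z * Nk z)\<^sup>2)"
  define IS where "IS = IT S"
  define P where "P = IT (\<lambda>z. (Pf z)\<^sup>2)"
  define A0 where "A0 = IT (\<lambda>z. (f z)\<^sup>2)"
  define A1 where "A1 = IT (\<lambda>z. (dX f z)\<^sup>2)"
  define AX where "AX = IT (\<lambda>z. (E z * D [ex] k z)\<^sup>2)"
  have P_le: "P \<le> 2 * IN + 968 * C\<^sup>2 * IS"
  proof -
    have "P \<le> IT (\<lambda>z. 2 * (E z * Nk z)\<^sup>2 + 2 * (484 * C\<^sup>2 * S z))"
      unfolding P_def
    proof (rule integral_mono)
      show ib: "integrable lborel (\<lambda>z. 2 * (E z * Nk z)\<^sup>2 + 2 * (484 * C\<^sup>2 * S z))" using i3 iS by simp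
      show "integrable lborel (\<lambda>z. (Pf z)\<^sup>2)"
      proof (rule Bochner_Integration.integrable_bound[OF ib])
        show "(\<lambda>z. (Pf z)\<^sup>2) \<in> borel_measurable lborel" using mPf by simp
        have "norm ((Pf z)\<^sup>2) \<le> norm (2 * (E z * Nk z)\<^sup>2 + 2 * (484 * C\<^sup>2 * S z))" for z
          using Pb[of z] by simp
        then show "AE z in lborel. norm ((Pf z)\<^sup>2) \<le> norm (2 * (E z * Nk z)\<^sup>2 + 2 * (484 * C\<^sup>2 * S z))" by (rule AE_I2)
      qed
    qed (rule Pb)
    also have "\<dots> = 2 * IN + 968 * C\<^sup>2 * IS" unfolding IN_def IS_def using i3 iS by simp
    finally show ?thesis .
  qed
  \<comment> \<open>E d_x V is a sum of three terms, which costs a factor 3; 192 is 3 times the 64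
    from the bound for a^2 with s \<le> 4.\<close>
  have X_le: "AX \<le> 3 * A1 + 192 * (\<alpha>\<^sup>2 * h\<^sup>2) * A0 + 3 * C\<^sup>2 * IS"
  proof -
    have "AX \<le> IT (\<lambda>z. 3 * (dX f z)\<^sup>2 + 192 * (\<alpha>\<^sup>2 * h\<^sup>2) * (f z)\<^sup>2 + 3 * C\<^sup>2 * S z)"
      unfolding AX_def
    proof (rule integral_mono[OF i4])
      show "integrable lborel (\<lambda>z. 3 * (dX f z)\<^sup>2 + 192 * (\<alpha>\<^sup>2 * h\<^sup>2) * (f z)\<^sup>2 + 3 * C\<^sup>2 * S z)" using i1 i2 iS by simp
      fix z
      have dXE: "dX E = (\<lambda>z. ca \<alpha> R z * wt \<alpha> R z * chi R z + wt \<alpha> R z * dX (chi R) z)"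
        unfolding E_def Ef_def[abs_def] by (subst dd_mult[of sdirs]) (auto intro: smooth_wt smooth_chi simp: wt_dd)
      have "dX f = (\<lambda>z. dX E z * V k z + E z * D [ex] k z)"
        unfolding f_def E_def by (subst dd_mult[of sdirs]) (auto intro: smooth_Ef smooth_V simp: V_dd1)
      from fun_cong[OF this, of z]
      have "dX f z = (ca \<alpha> R z * wt \<alpha> R z * chi R z + wt \<alpha> R z * dX (chi R) z) * V k z + E z * D [ex] k z"
        by (simp only: dXE)
      moreover have "f z = wt \<alpha> R z * chi R z * V k z" by (simp add: f_def Ef_def)
      ultimately have eq: "E z * D [ex] k z = dX f z - ca \<alpha> R z * f z - wt \<alpha> R z * (dX (chi R) z * V k z)"
        by (simp add: algebra_simps)
      have af: "(ca \<alpha> R z * f z)\<^sup>2 \<le> 64 * (\<alpha>\<^sup>2 * h\<^sup>2) * (f z)\<^sup>2"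
      proof (cases "z \<in> Zset R")
        case True
        then show ?thesis by (simp add: f_def Ef_zero[OF R])
      next
        case False
        then have s: "1 \<le> Sg R z" "Sg R z \<le> 4" using not_Zset[of z R] Sg_le[OF R] by auto
        then have "(Sg R z)\<^sup>2 \<le> 4\<^sup>2" by (intro power_mono) auto
        then have "4 * (\<alpha>\<^sup>2 * h\<^sup>2) * (Sg R z)\<^sup>2 \<le> 4 * (\<alpha>\<^sup>2 * h\<^sup>2) * 16" by (intro mult_left_mono) auto
        then have "(ca \<alpha> R z)\<^sup>2 \<le> 64 * (\<alpha>\<^sup>2 * h\<^sup>2)" by (simp add: ca_def h_def power_mult_distrib power_divide)
        then show ?thesis unfolding power_mult_distrib by (intro mult_right_mono) auto
      qed
      have "(a - b - c)\<^sup>2 \<le> 3 * a\<^sup>2 + 3 * b\<^sup>2 + 3 * c\<^sup>2" for a b c :: real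
      proof -
        have "0 \<le> (a + b)\<^sup>2 + (a + c)\<^sup>2 + (b - c)\<^sup>2" by simp
        then show ?thesis by (simp add: power2_eq_square algebra_simps)
      qed
      then have "(E z * D [ex] k z)\<^sup>2 \<le> 3 * (dX f z)\<^sup>2 + 3 * (ca \<alpha> R z * f z)\<^sup>2 + 3 * (wt \<alpha> R z * (dX (chi R) z * V k z))\<^sup>2"
        unfolding eq .
      moreover have "(wt \<alpha> R z * (dX (chi R) z * V k z))\<^sup>2 \<le> C\<^sup>2 * S z"
        using error_bounds(2)[OF R _ C, of \<alpha> z k] \<alpha> by (simp add: S_def)
      ultimately show "(E z * D [ex] k z)\<^sup>2 \<le> 3 * (dX f z)\<^sup>2 + 192 * (\<alpha>\<^sup>2 * h\<^sup>2) * (f z)\<^sup>2 + 3 * C\<^sup>2 * S z"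
        using af by linarith
    qed
    also have "\<dots> = 3 * A1 + 192 * (\<alpha>\<^sup>2 * h\<^sup>2) * A0 + 3 * C\<^sup>2 * IS"
      unfolding A0_def A1_def IS_def using i1 i2 iS by simp
    finally show ?thesis .
  qed
  have \<mu>h: "\<mu> = \<alpha>^3 * h^4" by (simp add: \<mu>_def h_def power_divide)
  have \<mu>0: "\<mu> > 0" using \<alpha> h0 by (simp add: \<mu>h)
  have A0n: "A0 \<ge> 0" "A1 \<ge> 0" by (simp_all add: A0_def A1_def)
  have u: "\<alpha>^5 * h^6 = \<mu> * (\<alpha>\<^sup>2 * h\<^sup>2)" by (simp add: \<mu>h eval_nat_numeral algebra_simps)
  have ah: "1 \<le> \<alpha>\<^sup>2 * h\<^sup>2"
  proof -
    have "\<alpha>\<^sup>2 * h\<^sup>2 = (\<alpha>\<^sup>2 * h^3) * R" using R by (simp add: h_def eval_nat_numeral)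
    also have "\<dots> = 10000 * L\<^sup>2 * R" using keyh by simp
    also have "\<dots> \<ge> 1 * 1 * 1" using R L1 by (intro mult_mono) auto
    finally show ?thesis by simp
  qed
  have carl': "8 * (\<mu> * (\<alpha>\<^sup>2 * h\<^sup>2) * A0) + 100 * (\<mu> * A1) \<le> 5 / 4 * P"
  proof -
    have "8 * \<alpha>^5 * h^6 = 8 * (\<mu> * (\<alpha>\<^sup>2 * h\<^sup>2))" "100 * \<alpha>^3 * h^4 = 100 * \<mu>" using u by (simp_all add: \<mu>h)
    then show ?thesis using carl[folded A0_def A1_def P_def] by (simp add: mult.assoc)
  qed
  define Y where "Y = \<mu> * (\<alpha>\<^sup>2 * h\<^sup>2) * A0"
  have Y0: "\<mu> * A0 \<le> Y" unfolding Y_def using mult_right_mono[OF mult_left_mono[OF ah, of \<mu>], of A0] \<mu>0 A0n by simp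
  have Yn: "0 \<le> \<mu> * A0" "0 \<le> \<mu> * A1" using \<mu>0 A0n by auto
  have "\<mu> * AX \<le> \<mu> * (3 * A1 + 192 * (\<alpha>\<^sup>2 * h\<^sup>2) * A0 + 3 * C\<^sup>2 * IS)" using X_le \<mu>0 by (intro mult_left_mono) auto
  also have "\<dots> = 3 * (\<mu> * A1) + 192 * Y + 3 * \<mu> * C\<^sup>2 * IS" by (simp add: Y_def algebra_simps)
  finally have "\<mu> * (A0 + AX) \<le> 3 * (\<mu> * A1) + 193 * Y + 3 * \<mu> * C\<^sup>2 * IS"
    using Y0 by (simp add: distrib_left)
  \<comment> \<open>The terms in A1 and Y are at most 193/8 times the left side of
    \<open>carl'\<close>, and 193/8 * 5/4 is below 31.\<close>
  also have "\<dots> \<le> 31 * P + 3 * \<mu> * C\<^sup>2 * IS" using carl' Yn Y0 unfolding Y_def[symmetric] by linarith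
  also have "\<dots> \<le> 62 * IN + (62 * 484 + 3 * \<mu>) * C\<^sup>2 * IS" using P_le by (simp add: algebra_simps)
  finally have "\<mu> * (A0 + AX) \<le> 62 * IN + (62 * 484 + 3 * \<mu>) * C\<^sup>2 * IS" .
  then show ?thesis
    unfolding A0_def AX_def IN_def IS_def f_def E_def Nk_def S_def by (simp add: power_mult_distrib)
qed

lemma Ef_slice_measurable: "(\<lambda>p. (Ef \<alpha> R (t, p))\<^sup>2) \<in> borel_measurable borel"
proof -
  have "Ef \<alpha> R \<in> borel_measurable borel"
    by (rule borel_measurable_continuous_onI[OF smooth_cont[OF smooth_Ef[where B = "{}"]]])
  then show ?thesis by measurable
qed

text \<open>The mollification is removed and N is absorbed. As N is at most M (|v| + |d_x v|), its
  weighted norm costs 62 * 2 * M^2 = 124 M^2, which is at most \<mu> / 2, so half of the left side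
  survives. Moreover 62 * 484 = 30008 is at most \<mu>, so the error factor 62 * 484 + 3 \<mu> is at
  most 4 \<mu>. Dividing by \<mu> / 2 leaves 8 C^2.\<close>

theorem carleman_pair:
  assumes R: "R \<ge> 2" and \<alpha>: "\<alpha> \<ge> 200" and key: "\<alpha>\<^sup>2 = 10000 * L\<^sup>2 * R^3" and C: "chib C R"
  defines "\<mu> \<equiv> \<alpha>^3 / R^4"
  assumes \<mu>: "\<mu> \<ge> 30008 + 248 * M\<^sup>2"
  shows "exp (25 / 2 * \<alpha>) * stint mq v
    \<le> 8 * C\<^sup>2 * (exp (32 * \<alpha>) * (\<Sum>es\<in>Jset. stint (m1 R) (d es))
      + exp (8 * \<alpha>) * (\<Sum>es\<in>Jset. stint (m2 R) (d es)))"
proof -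
  define m where "m z = (Ef \<alpha> R z)\<^sup>2" for z
  have cE: "cc m" unfolding m_def[abs_def]
    by (intro cc_power2 cc_smooth[OF smooth_Ef[of sdirs] bsupp_Ef[OF R]])
  obtain B where B: "\<And>z. \<bar>m z\<bar> \<le> B" using cc_bounded[OF cE] by blast
  have mm: "m \<in> borel_measurable borel" by (rule cc_measurable[OF cE])
  have ms: "t \<in> {0..1} \<and> norm p \<le> R" if "m (t, p) \<noteq> 0" for t p
    using that Ef_zero[OF R, of "(t, p)" \<alpha>] not_Zset[of "(t, p)" R] by (auto simp: m_def)
  have m0: "m z \<ge> 0" for z by (simp add: m_def)
  have dX: "l2_cont_UNIV (d [ex])" by (rule d_cont) auto
  note lV = tconv_weighted_tendsto[OF v_cont mm B ms]
  note lX = tconv_weighted_tendsto[OF dX mm B ms]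
  note lN = tconv_weighted_tendsto[OF N_cont mm B ms]
  let ?J = "\<lambda>F. stint m F"
  let ?S = "exp (32 * \<alpha>) * (\<Sum>es\<in>Jset. stint (m1 R) (d es))
      + exp (8 * \<alpha>) * (\<Sum>es\<in>Jset. stint (m2 R) (d es))"
  have lim: "\<mu> * (?J v + ?J (d [ex])) \<le> 62 * ?J N + (62 * 484 + 3 * \<mu>) * C\<^sup>2 * ?S"
  proof (rule LIMSEQ_le)
    show "(\<lambda>k. \<mu> * (IT (\<lambda>z. m z * (V k z)\<^sup>2) + IT (\<lambda>z. m z * (D [ex] k z)\<^sup>2))) \<longlonglongrightarrow> \<mu> * (?J v + ?J (d [ex]))"
      by (intro tendsto_intros lV(2) lX(2))
    show "(\<lambda>k. 62 * IT (\<lambda>z. m z * (tconv N (moll k) z)\<^sup>2) + (62 * 484 + 3 * \<mu>) * C\<^sup>2 * IT (\<lambda>z. mreg \<alpha> R z * SV k z))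
       \<longlonglongrightarrow> 62 * ?J N + (62 * 484 + 3 * \<mu>) * C\<^sup>2 * ?S"
      by (intro tendsto_add tendsto_mult tendsto_const lN(2) mreg_SV_limit(2))
    show "\<exists>K. \<forall>k\<ge>K. \<mu> * (IT (\<lambda>z. m z * (V k z)\<^sup>2) + IT (\<lambda>z. m z * (D [ex] k z)\<^sup>2))
       \<le> 62 * IT (\<lambda>z. m z * (tconv N (moll k) z)\<^sup>2) + (62 * 484 + 3 * \<mu>) * C\<^sup>2 * IT (\<lambda>z. mreg \<alpha> R z * SV k z)"
      using carleman_mollified[OF R \<alpha> key C] unfolding m_def \<mu>_def by blast
  qed
  have sq: "sq_int (v t)" "sq_int (d [ex] t)" "sq_int (N t)" for t
    using v_cont dX N_cont by (auto simp: l2_cont_UNIV_def)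
  have mt: "(\<lambda>p. m (t, p)) \<in> borel_measurable borel" for t unfolding m_def by (rule Ef_slice_measurable)
  have iv: "integrable lborel (\<lambda>p. m (t, p) * (v t p)\<^sup>2)" "integrable lborel (\<lambda>p. m (t, p) * (d [ex] t p)\<^sup>2)" "integrable lborel (\<lambda>p. m (t, p) * (N t p)\<^sup>2)" for t
    using weighted_sq_integrable[OF _ mt B] sq by auto
  have JN: "?J N \<le> 2 * M\<^sup>2 * (?J v + ?J (d [ex]))"
  proof -
    have "?J N \<le> (\<integral>t. 2 * M\<^sup>2 * ((\<integral>p. m (t, p) * (v t p)\<^sup>2 \<partial>lborel) + (\<integral>p. m (t, p) * (d [ex] t p)\<^sup>2 \<partial>lborel)) \<partial>lborel)"
    proof (rule integral_mono)
      fix t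
      have "(\<integral>p. m (t, p) * (N t p)\<^sup>2 \<partial>lborel) \<le> (\<integral>p. 2 * M\<^sup>2 * (m (t, p) * (v t p)\<^sup>2 + m (t, p) * (d [ex] t p)\<^sup>2) \<partial>lborel)"
      proof (rule integral_mono_AE)
        show "AE p in lborel. m (t, p) * (N t p)\<^sup>2 \<le> 2 * M\<^sup>2 * (m (t, p) * (v t p)\<^sup>2 + m (t, p) * (d [ex] t p)\<^sup>2)"
          using N_bound[of t]
        proof eventually_elim
          fix p assume "\<bar>N t p\<bar> \<le> M * (\<bar>d [ex] t p\<bar> + \<bar>v t p\<bar>)"
          then have "(N t p)\<^sup>2 \<le> (M * (\<bar>d [ex] t p\<bar> + \<bar>v t p\<bar>))\<^sup>2"
            using M0 by (intro abs_le_square_iff[THEN iffD1]) simp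
          also have "\<dots> = M\<^sup>2 * (\<bar>d [ex] t p\<bar> + \<bar>v t p\<bar>)\<^sup>2" by (simp add: power_mult_distrib)
          also have "\<dots> \<le> M\<^sup>2 * (2 * (v t p)\<^sup>2 + 2 * (d [ex] t p)\<^sup>2)"
            using sum_squares_bound[of "\<bar>d [ex] t p\<bar>" "\<bar>v t p\<bar>"] by (intro mult_left_mono) (auto simp: power2_sum)
          finally have "m (t, p) * (N t p)\<^sup>2 \<le> m (t, p) * (M\<^sup>2 * (2 * (v t p)\<^sup>2 + 2 * (d [ex] t p)\<^sup>2))"
            by (intro mult_left_mono m0)
          then show "m (t, p) * (N t p)\<^sup>2 \<le> 2 * M\<^sup>2 * (m (t, p) * (v t p)\<^sup>2 + m (t, p) * (d [ex] t p)\<^sup>2)"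
            by (simp add: algebra_simps)
        qed
      qed (use iv in simp_all)
      also have "\<dots> = 2 * M\<^sup>2 * ((\<integral>p. m (t, p) * (v t p)\<^sup>2 \<partial>lborel) + (\<integral>p. m (t, p) * (d [ex] t p)\<^sup>2 \<partial>lborel))"
        using iv by simp
      finally show "(\<integral>p. m (t, p) * (N t p)\<^sup>2 \<partial>lborel) \<le> 2 * M\<^sup>2 * ((\<integral>p. m (t, p) * (v t p)\<^sup>2 \<partial>lborel) + (\<integral>p. m (t, p) * (d [ex] t p)\<^sup>2 \<partial>lborel))" .
    qed (use lV(3) lX(3) lN(3) in simp_all)
    also have "\<dots> = 2 * M\<^sup>2 * (?J v + ?J (d [ex]))" using lV(3) lX(3) by simp
    finally show ?thesis .
  qed
  have Jn: "?J v \<ge> 0" "?J (d [ex]) \<ge> 0" by (auto intro!: Bochner_Integration.integral_nonneg mult_nonneg_nonneg m0)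
  have Sn: "?S \<ge> 0"
    using masks_bounds(4,5) by (auto intro!: add_nonneg_nonneg mult_nonneg_nonneg sum_nonneg Bochner_Integration.integral_nonneg)
  have \<mu>0: "\<mu> > 0" using \<mu> zero_le_power2[of M] by linarith
  have main: "?J v \<le> 8 * C\<^sup>2 * ?S"
  proof -
    define X where "X = ?J v + ?J (d [ex])"
    have X: "X \<ge> ?J v" "X \<ge> 0" using Jn by (auto simp: X_def)
    have "62 * ?J N \<le> 124 * M\<^sup>2 * X" using JN by (simp add: X_def)
    also have "\<dots> \<le> \<mu> / 2 * X" using \<mu> X by (intro mult_right_mono) auto
    finally have 1: "62 * ?J N \<le> \<mu> / 2 * X" .
    have "(62 * 484 + 3 * \<mu>) * (C\<^sup>2 * ?S) \<le> (4 * \<mu>) * (C\<^sup>2 * ?S)"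
    proof (intro mult_right_mono mult_nonneg_nonneg Sn)
      show "62 * 484 + 3 * \<mu> \<le> 4 * \<mu>" using \<mu> zero_le_power2[of M] by linarith
    qed simp
    then have "\<mu> * X \<le> \<mu> / 2 * X + 4 * \<mu> * (C\<^sup>2 * ?S)" using lim 1 unfolding X_def[symmetric] mult.assoc[of _ "C\<^sup>2"] by linarith
    then have "\<mu> * X \<le> \<mu> * (8 * (C\<^sup>2 * ?S))" by simp
    then have "X \<le> 8 * (C\<^sup>2 * ?S)" using \<mu>0 by simp
    then show ?thesis using X by simp
  qed
  note lq = tconv_weighted_tendsto[OF v_cont measurable_masks(3) masks_bounds(3) masks_support(3)]
  have "exp (25 / 2 * \<alpha>) * stint mq v =
      (\<integral>t. exp (25 / 2 * \<alpha>) * (\<integral>p. mq (t, p) * (v t p)\<^sup>2 \<partial>lborel) \<partial>lborel)" by simp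
  also have "\<dots> \<le> ?J v"
  proof (rule integral_mono)
    show "integrable lborel (\<lambda>t. exp (25 / 2 * \<alpha>) * (\<integral>p. mq (t, p) * (v t p)\<^sup>2 \<partial>lborel))"
      using r0 lq(3) by simp
    fix t
    have mqm: "(\<lambda>p. mq (t, p)) \<in> borel_measurable borel" by measurable
    have iq: "integrable lborel (\<lambda>p. mq (t, p) * (v t p)\<^sup>2)"
      by (rule weighted_sq_integrable[OF sq(1) mqm masks_bounds(3)])
    have "exp (25 / 2 * \<alpha>) * (\<integral>p. mq (t, p) * (v t p)\<^sup>2 \<partial>lborel) = (\<integral>p. exp (25 / 2 * \<alpha>) * (mq (t, p) * (v t p)\<^sup>2) \<partial>lborel)" by simp
    also have "\<dots> \<le> (\<integral>p. m (t, p) * (v t p)\<^sup>2 \<partial>lborel)"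
    proof (rule integral_mono)
      fix p
      \<comment> \<open>On Q the point lies where chi = 1, and s is at least 3 - 1/R, hence at least
        5/2; the exponent is 2 * (5/2)^2 = 25/2.\<close>
      have "exp (25 / 2 * \<alpha>) * mq (t, p) \<le> m (t, p)"
      proof (cases "t \<in> {r..1-r} \<and> norm p \<le> 1")
        case True
        have p1: "\<bar>p $ 1\<bar> \<le> 1" using component_le_norm_cart[of p 1] True by linarith
        have "\<bar>p $ 1 / R\<bar> \<le> 1 / 2" using p1 R by (simp add: abs_divide divide_le_eq)
        moreover have "Sg R (t, p) = p $ 1 / R + 3" using \<phi>_three[of t] True by (simp add: Sg_def)
        ultimately have s: "Sg R (t, p) \<ge> 5 / 2" by linarith
        have "chi R (t, p) = 1" by (rule chi_one[OF R]) (use True R s in auto)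
        moreover have "(5 / 2)\<^sup>2 \<le> (Sg R (t, p))\<^sup>2" using s by (intro power_mono) auto
        then have "\<alpha> * (25 / 4) \<le> \<alpha> * (Sg R (t, p))\<^sup>2" using \<alpha> by (intro mult_left_mono) (auto simp: power2_eq_square)
        then have "exp (25 / 2 * \<alpha>) \<le> (wt \<alpha> R (t, p))\<^sup>2" by (simp add: wt_def flip: exp_double)
        ultimately show ?thesis using True by (simp add: m_def Ef_def mq_def)
      next
        case False
        then have "mq (t, p) = 0" by (auto simp: mq_def)
        then show ?thesis by (simp add: m0)
      qed
      from mult_right_mono[OF this, of "(v t p)\<^sup>2"]
      show "exp (25 / 2 * \<alpha>) * (mq (t, p) * (v t p)\<^sup>2) \<le> m (t, p) * (v t p)\<^sup>2" by (simp add: mult.assoc)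
    qed (use iq iv in simp_all)
    finally show "exp (25 / 2 * \<alpha>) * (\<integral>p. mq (t, p) * (v t p)\<^sup>2 \<partial>lborel) \<le> (\<integral>p. m (t, p) * (v t p)\<^sup>2 \<partial>lborel)" .
  qed (rule lV(3))
  also note main
  finally show ?thesis .
qed

text \<open>Each derivative has an L^2 norm over all of space that is bounded on [0, 1], so the
  bound for the slab does not grow with R. This is what makes the part with the smaller weight
  negligible.\<close>

lemma slab_energy_bounded:
  obtains B where "B \<ge> 0" "\<And>R. (\<Sum>es\<in>Jset. stint (m2 R) (d es)) \<le> B"
proof -
  have "\<exists>B\<ge>0. \<forall>t\<in>{0..1}. nsq (d es t) \<le> B" if "es \<in> Jset" for es
    by (rule l2_cont_nsq_bounded[OF d_cont_J[OF that]])
  then obtain b where b: "\<And>es. es \<in> Jset \<Longrightarrow> b es \<ge> 0" "\<And>es t. es \<in> Jset \<Longrightarrow> t \<in> {0..1} \<Longrightarrow> nsq (d es t) \<le> b es"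
    by metis
  have "(stint (m2 R) (d es)) \<le> b es" if es: "es \<in> Jset" for es R
  proof -
    note l = tconv_weighted_tendsto[OF d_cont_J[OF es] measurable_masks(2) masks_bounds(2) masks_support(2)]
    have "(stint (m2 R) (d es)) \<le> (\<integral>t. b es * indicator {0..1::real} t \<partial>lborel)"
    proof (rule integral_mono)
      show "integrable lborel (\<lambda>t. b es * indicator {0..1::real} t)"
        by (intro integrable_mult_right integrable_real_indicator) auto
      fix t :: real
      show "(\<integral>p. m2 R (t, p) * (d es t p)\<^sup>2 \<partial>lborel) \<le> b es * indicator {0..1} t"
      proof (cases "t \<in> {0..1}")
        case True
        have mm: "(\<lambda>p. m2 R (t, p)) \<in> borel_measurable borel" by measurable
        have "(\<integral>p. m2 R (t, p) * (d es t p)\<^sup>2 \<partial>lborel) \<le> nsq (d es t)"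
        proof (rule integral_mono)
          show "integrable lborel (\<lambda>p. m2 R (t, p) * (d es t p)\<^sup>2)"
            by (rule weighted_sq_integrable[OF d_sq[OF es] mm masks_bounds(2)])
          show "integrable lborel (\<lambda>p. (d es t p)\<^sup>2)" using d_sq[OF es] by (simp add: sq_int_def)
          fix p
          have "m2 R (t, p) \<le> 1" using masks_bounds(2)[of R "(t, p)"] by linarith
          then show "m2 R (t, p) * (d es t p)\<^sup>2 \<le> (d es t p)\<^sup>2" using mult_right_mono[of "m2 R (t, p)" 1 "(d es t p)\<^sup>2"] by simp
        qed
        then show ?thesis using b(2)[OF es True] True by simp
      next
        case False
        then have "m2 R (t, p) = 0" for p using masks_support(2) by blast
        then show ?thesis using False by simp
      qed
    qed (rule l(3))
    then show ?thesis by simp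
  qed
  then have "(\<Sum>es\<in>Jset. stint (m2 R) (d es)) \<le> (\<Sum>es\<in>Jset. b es)" for R
    by (rule sum_mono)
  moreover have "(\<Sum>es\<in>Jset. b es) \<ge> 0" using b(1) by (rule sum_nonneg)
  ultimately show ?thesis using that by blast
qed

section \<open>Identification of the norms and choice of the parameters\<close>

lemma normQ_eq:
  assumes v: "\<And>t. t \<in> {0..1} \<Longrightarrow> v' t = v t"
  shows "(normQ r v')\<^sup>2 = stint mq v"
proof -
  have "(LINT t:{r..1-r}|lborel. (LINT p:cball 0 1|lborel. (v' t p)\<^sup>2)) = stint mq v"
    unfolding set_lebesgue_integral_def
  proof (rule Bochner_Integration.integral_cong[OF refl])
    fix t
    show "indicator {r..1-r} t *\<^sub>R (\<integral>p. indicator (cball 0 1) p *\<^sub>R (v' t p)\<^sup>2 \<partial>lborel) = (\<integral>p. mq (t, p) * (v t p)\<^sup>2 \<partial>lborel)"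
    proof (cases "t \<in> {r..1-r}")
      case True
      then have "v' t = v t" using v[of t] r0 by auto
      then show ?thesis using True by (simp add: mq_def indicator_times)
    next
      case False
      then show ?thesis by (simp add: mq_def indicator_times)
    qed
  qed
  moreover have "0 \<le> stint mq v"
    using masks_bounds(6) by (intro Bochner_Integration.integral_nonneg mult_nonneg_nonneg) auto
  ultimately show ?thesis by (simp add: normQ_def)
qed

text \<open>\<open>A_R\<close> contains \<open>wd\<close> of the difference, while
  \<open>d es t\<close> is another weak derivative of the same function. By uniqueness they agree
  almost everywhere, for all ten lists at once, and the integrals coincide.\<close>

lemma A_R_eq:
  assumes v: "\<And>t. t \<in> {0..1} \<Longrightarrow> v' t = v t"
  shows "(A_R R v')\<^sup>2 = (\<Sum>es\<in>Jset. stint (m1 R) (d es))"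
proof -
  let ?A = "{p::real^3. R - 1 \<le> norm p \<and> norm p \<le> R}"
  have m1m: "(\<lambda>p. m1 R (t, p)) \<in> borel_measurable borel" for t by measurable
  have i: "integrable lborel (\<lambda>p. m1 R (t, p) * (d es t p)\<^sup>2)" if "es \<in> Jset" for es t
    by (rule weighted_sq_integrable[OF d_sq[OF that] m1m masks_bounds(1)])
  have "(LINT t:{0..1}|lborel. (LINT p:?A|lborel. (\<Sum>k\<le>2. \<Sum>l\<le>2-k. \<Sum>n\<le>2-k-l. (wd (mi k l n) (v' t) p)\<^sup>2)))
     = (\<integral>t. (\<Sum>es\<in>Jset. \<integral>p. m1 R (t, p) * (d es t p)\<^sup>2 \<partial>lborel) \<partial>lborel)"
    unfolding set_lebesgue_integral_def
  proof (rule Bochner_Integration.integral_cong[OF refl])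
    fix t :: real
    show "indicator {0..1} t *\<^sub>R (\<integral>p. indicator ?A p *\<^sub>R (\<Sum>k\<le>2. \<Sum>l\<le>2-k. \<Sum>n\<le>2-k-l. (wd (mi k l n) (v' t) p)\<^sup>2) \<partial>lborel)
       = (\<Sum>es\<in>Jset. \<integral>p. m1 R (t, p) * (d es t p)\<^sup>2 \<partial>lborel)"
    proof (cases "t \<in> {0..1}")
      case True
      have w: "weak_deriv es (v t) (wd es (v t))" "AE p in lborel. wd es (v t) p = d es t p" if "es \<in> Jset" for es
      proof -
        have dw: "weak_deriv es (v t) (d es t)" using d_weak Jset_dirs[OF that] by blast
        then show wk: "weak_deriv es (v t) (wd es (v t))" unfolding wd_def by (rule someI[where P = "weak_deriv es (v t)"])
        show "AE p in lborel. wd es (v t) p = d es t p"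
          by (rule weak_deriv_unique[OF wk dw]) (use Jset_dirs[OF that] in blast)
      qed
      have "AE p in lborel. \<forall>es\<in>Jset. wd es (v t) p = d es t p"
        using w(2) by (intro AE_finite_allI finite_Jset)
      then have ae: "AE p in lborel. indicator ?A p *\<^sub>R (\<Sum>es\<in>Jset. (wd es (v t) p)\<^sup>2) = (\<Sum>es\<in>Jset. m1 R (t, p) * (d es t p)\<^sup>2)"
      proof eventually_elim
        fix p assume *: "\<forall>es\<in>Jset. wd es (v t) p = d es t p"
        have "indicator ?A p = m1 R (t, p)" using True by (simp add: m1_def indicator_def)
        moreover have "(\<Sum>es\<in>Jset. (wd es (v t) p)\<^sup>2) = (\<Sum>es\<in>Jset. (d es t p)\<^sup>2)" using * by (intro sum.cong) auto
        ultimately show "indicator ?A p *\<^sub>R (\<Sum>es\<in>Jset. (wd es (v t) p)\<^sup>2) = (\<Sum>es\<in>Jset. m1 R (t, p) * (d es t p)\<^sup>2)"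
          by (simp add: sum_distrib_left)
      qed
      have wm: "wd es (v t) \<in> borel_measurable borel" if "es \<in> Jset" for es
        using w(1)[OF that] by (intro sq_int_measurable) (simp add: weak_deriv_def)
      have dm: "d es t \<in> borel_measurable borel" if "es \<in> Jset" for es by (rule sq_int_measurable[OF d_sq[OF that]])
      have "closed ?A" by (intro closed_Collect_conj closed_Collect_le continuous_intros)
      then have Am: "(indicator ?A :: real^3 \<Rightarrow> real) \<in> borel_measurable borel" by (intro borel_measurable_indicator borel_closed)
      have "(\<integral>p. indicator ?A p *\<^sub>R (\<Sum>es\<in>Jset. (wd es (v t) p)\<^sup>2) \<partial>lborel) = (\<integral>p. (\<Sum>es\<in>Jset. m1 R (t, p) * (d es t p)\<^sup>2) \<partial>lborel)"
        by (rule integral_cong_AE)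
           (use ae wm dm Am m1m in \<open>auto intro!: borel_measurable_sum borel_measurable_times borel_measurable_power borel_measurable_scaleR\<close>)
      also have "\<dots> = (\<Sum>es\<in>Jset. \<integral>p. m1 R (t, p) * (d es t p)\<^sup>2 \<partial>lborel)"
        by (rule Bochner_Integration.integral_sum) (rule i)
      finally show ?thesis using True v[OF True] mi_sum[of "\<lambda>es. (wd es (v t) p)\<^sup>2" for p] by simp
    next
      case False
      then have "m1 R (t, p) = 0" for p using masks_support(1) by blast
      then show ?thesis using False by simp
    qed
  qed
  also have "\<dots> = (\<Sum>es\<in>Jset. stint (m1 R) (d es))"
    by (rule Bochner_Integration.integral_sum)
       (rule tconv_weighted_tendsto(3)[OF d_cont_J measurable_masks(1) masks_bounds(1) masks_support(1)])
  finally have eq: "(LINT t:{0..1}|lborel. (LINT p:?A|lborel. (\<Sum>k\<le>2. \<Sum>l\<le>2-k. \<Sum>n\<le>2-k-l. (wd (mi k l n) (v' t) p)\<^sup>2)))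
     = (\<Sum>es\<in>Jset. stint (m1 R) (d es))" .
  have "0 \<le> (\<Sum>es\<in>Jset. stint (m1 R) (d es))"
    using masks_bounds(4) by (intro sum_nonneg Bochner_Integration.integral_nonneg mult_nonneg_nonneg) auto
  then show ?thesis unfolding A_R_def eq by simp
qed

theorem lower_bound:
  assumes v: "\<And>t. t \<in> {0..1} \<Longrightarrow> v' t = v t" and \<delta>: "\<delta> > 0" "normQ r v' \<ge> \<delta>"
  shows "\<exists>C>0. \<exists>R0\<ge>2. \<forall>R\<ge>R0. normQ r v' \<le> C * exp (1000 * L * R powr (3/2)) * A_R R v'"
proof -
  obtain C where C: "\<And>R. R \<ge> 2 \<Longrightarrow> chib C R" and C0: "C \<ge> 0"
    using chi_bounds unfolding chib_def by metis
  obtain B where B: "B \<ge> 0" "\<And>R. (\<Sum>es\<in>Jset. stint (m2 R) (d es)) \<le> B"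
    using slab_energy_bounded by blast
  \<comment> \<open>The three lower bounds make sqrt R at least 2, make sqrt R (hence \<mu>) large
    enough for \<open>carleman_pair\<close>, and let the bounded energy be absorbed with the help of
    \<delta>.\<close>
  define R0 where "R0 = max 4 (max ((30008 + 248 * M\<^sup>2)\<^sup>2) (16 * C\<^sup>2 * B / \<delta>\<^sup>2))"
  have "\<exists>R0\<ge>2. \<forall>R\<ge>R0. normQ r v' \<le> 4 * (C + 1) * exp (1000 * L * R powr (3/2)) * A_R R v'"
  proof (intro exI[of _ R0] conjI allI impI)
    show "2 \<le> R0" by (simp add: R0_def)
    fix R assume R: "R \<ge> R0"
    have R4: "R \<ge> 4" using R by (simp add: R0_def)
    define \<rho> where "\<rho> = sqrt R"
    have \<rho>: "\<rho>\<^sup>2 = R" "\<rho> \<ge> 2" "\<rho> > 0" using R4 real_le_rsqrt[of 2 R] by (auto simp: \<rho>_def)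
    have pw: "R powr (3/2) = \<rho>^3"
    proof -
      have "R powr (3/2) = R powr (1 + 1/2)" by simp
      also have "\<dots> = R * sqrt R" using R4 by (subst powr_add) (simp add: powr_half_sqrt)
      finally show ?thesis using \<rho>(1) by (simp add: \<rho>_def power3_eq_cube power2_eq_square)
    qed
    \<comment> \<open>The choice that makes \<alpha>^2 = 10000 L^2 R^3, that is
      \<open>key\<close>.\<close>
    define \<alpha> where "\<alpha> = 100 * L * \<rho>^3"
    have \<rho>3: "\<rho>^3 \<ge> 8" using power_mono[OF \<rho>(2), of 3] by simp
    have \<alpha>: "\<alpha> \<ge> 200"
    proof -
      have "100 * 1 * 8 \<le> 100 * L * \<rho>^3" using L1 \<rho>3 by (intro mult_mono) auto
      then show ?thesis by (simp add: \<alpha>_def)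
    qed
    have key: "\<alpha>\<^sup>2 = 10000 * L\<^sup>2 * R^3"
      unfolding \<alpha>_def \<rho>(1)[symmetric] by (simp add: power_mult_distrib flip: power_mult)
    have mu: "\<alpha>^3 / R^4 = 1000000 * L^3 * \<rho>"
      unfolding \<alpha>_def \<rho>(1)[symmetric] using \<rho>(3) by (simp add: power_mult_distrib field_simps flip: power_mult) (simp add: eval_nat_numeral)
    have \<mu>: "\<alpha>^3 / R^4 \<ge> 30008 + 248 * M\<^sup>2"
    proof -
      have "(30008 + 248 * M\<^sup>2)\<^sup>2 \<le> R" using R by (simp add: R0_def)
      then have "30008 + 248 * M\<^sup>2 \<le> \<rho>" unfolding \<rho>_def by (rule real_le_rsqrt)
      also have "\<dots> \<le> 1000000 * L^3 * \<rho>"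
      proof -
        have "1 * 1 * \<rho> \<le> 1000000 * L^3 * \<rho>" using L1 \<rho> one_le_power[OF L1, of 3] by (intro mult_right_mono mult_mono) auto
        then show ?thesis by simp
      qed
      finally show ?thesis by (simp add: mu)
    qed
    have nq: "(normQ r v')\<^sup>2 = stint mq v"
      by (rule normQ_eq) (rule v)
    have ar: "(A_R R v')\<^sup>2 = (\<Sum>es\<in>Jset. stint (m1 R) (d es))"
      by (rule A_R_eq) (rule v)
    define A where "A = A_R R v'"
    define Q where "Q = normQ r v'"
    have A0: "A \<ge> 0" unfolding A_def A_R_def
      by (auto simp: set_lebesgue_integral_def intro!: Bochner_Integration.integral_nonneg sum_nonneg mult_nonneg_nonneg)
    have Q0: "Q \<ge> \<delta>" "Q > 0" using \<delta> by (auto simp: Q_def)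
    have "exp (25 / 2 * \<alpha>) * Q\<^sup>2 \<le> 8 * C\<^sup>2 * (exp (32 * \<alpha>) * A\<^sup>2
       + exp (8 * \<alpha>) * (\<Sum>es\<in>Jset. stint (m2 R) (d es)))"
      unfolding Q_def A_def nq ar
      by (rule carleman_pair[OF _ \<alpha> key C \<mu>]) (use R4 in auto)
    also have "\<dots> \<le> 8 * C\<^sup>2 * (exp (32 * \<alpha>) * A\<^sup>2 + exp (8 * \<alpha>) * B)"
      using B(2)[of R] by (intro mult_left_mono add_left_mono) auto
    finally have 1: "exp (25 / 2 * \<alpha>) * Q\<^sup>2 \<le> 8 * C\<^sup>2 * exp (32 * \<alpha>) * A\<^sup>2 + 8 * C\<^sup>2 * B * exp (8 * \<alpha>)"
      by (simp add: algebra_simps)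
    \<comment> \<open>Half of the left side absorbs the part with the smaller weight. The exponents
      differ by 25/2 - 8 = 9/2, and exp (9/2 \<alpha>) is at least \<alpha>, hence at least R; the
      lower bound \<delta> for Q replaces the missing smallness of B.\<close>
    have 2: "8 * C\<^sup>2 * B * exp (8 * \<alpha>) \<le> exp (25 / 2 * \<alpha>) * (Q\<^sup>2 / 2)"
    proof -
      have "16 * C\<^sup>2 * B / \<delta>\<^sup>2 \<le> R" using R by (simp add: R0_def)
      also have "R \<le> \<alpha>"
      proof -
        have "R = 1 * 1 * \<rho>\<^sup>2" using \<rho> by simp
        also have "\<dots> \<le> 100 * L * \<rho>^3"
          using L1 \<rho> power_increasing[of 2 3 \<rho>] by (intro mult_mono) auto
        finally show ?thesis by (simp add: \<alpha>_def)
      qed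
      also have "\<alpha> \<le> exp (9 / 2 * \<alpha>)" using exp_ge_add_one_self[of "9 / 2 * \<alpha>"] \<alpha> by linarith
      finally have "16 * C\<^sup>2 * B \<le> \<delta>\<^sup>2 * exp (9 / 2 * \<alpha>)" using \<delta>(1) by (simp add: divide_le_eq mult.commute)
      also have "\<dots> \<le> Q\<^sup>2 * exp (9 / 2 * \<alpha>)" using Q0 \<delta>(1) by (intro mult_right_mono power_mono) auto
      finally have "16 * C\<^sup>2 * B * exp (8 * \<alpha>) \<le> Q\<^sup>2 * exp (9 / 2 * \<alpha>) * exp (8 * \<alpha>)" by (intro mult_right_mono) auto
      also have "\<dots> = Q\<^sup>2 * exp (25 / 2 * \<alpha>)" by (simp add: mult.assoc flip: exp_add)
      finally show ?thesis by (simp add: mult_ac)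
    qed
    have "exp (25 / 2 * \<alpha>) * (Q\<^sup>2 / 2) \<le> 8 * C\<^sup>2 * exp (32 * \<alpha>) * A\<^sup>2" using 1 2 by simp
    also have "\<dots> = exp (25 / 2 * \<alpha>) * (8 * C\<^sup>2 * exp (39 / 2 * \<alpha>) * A\<^sup>2)"
      by (simp add: mult.left_commute mult.assoc flip: exp_add)
    finally have "Q\<^sup>2 / 2 \<le> 8 * C\<^sup>2 * exp (39 / 2 * \<alpha>) * A\<^sup>2" by simp
    \<comment> \<open>39/2 = 32 - 25/2 is rounded up to 20, so that the square root has the exponent
      10 \<alpha> = 1000 L R^(3/2).\<close>
    also have "\<dots> \<le> 8 * C\<^sup>2 * exp (20 * \<alpha>) * A\<^sup>2" using \<alpha> by (intro mult_right_mono mult_left_mono) auto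
    finally have "Q\<^sup>2 \<le> 16 * C\<^sup>2 * exp (20 * \<alpha>) * A\<^sup>2" by simp
    also have "\<dots> = (4 * C * exp (10 * \<alpha>) * A)\<^sup>2"
      by (simp add: power_mult_distrib flip: exp_double)
    finally have "Q \<le> 4 * C * exp (10 * \<alpha>) * A"
      using C0 A0 by (intro power2_le_imp_le[of Q]) auto
    also have "\<dots> \<le> 4 * (C + 1) * exp (10 * \<alpha>) * A" using A0 C0 by (intro mult_right_mono) auto
    also have "10 * \<alpha> = 1000 * L * R powr (3/2)" by (simp add: \<alpha>_def pw)
    finally show "normQ r v' \<le> 4 * (C + 1) * exp (1000 * L * R powr (3/2)) * A_R R v'"
      by (simp add: Q_def A_def)
  qed
  moreover have "0 < 4 * (C + 1)" using C0 by simp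
  ultimately show ?thesis by blast
qed

end

theorem theorem1p3:
  fixes r :: real
  assumes "0 < r" "r < 1/2"
  shows "\<exists>Cbar>0. \<forall>(u1 :: real \<Rightarrow> real^3 \<Rightarrow> real) u2 (\<delta>::real).
     zk_solution u1 \<and> zk_solution u2 \<and> \<delta> > 0 \<and>
     normQ r (\<lambda>t x. u1 t x - u2 t x) \<ge> \<delta> \<longrightarrow>
     (\<exists>C>0. \<exists>R0\<ge>2. \<forall>R\<ge>R0.
        normQ r (\<lambda>t x. u1 t x - u2 t x)
          \<le> C * exp (14 * Cbar * R powr (3/2)) * A_R R (\<lambda>t x. u1 t x - u2 t x))"
proof -
  obtain \<phi> L where w: "zk_weight r \<phi> L" using zk_weight_exists[OF assms] .
  show ?thesis
  \<comment> \<open>L was obtained from r before any solution is introduced, so the constant depends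
    on r alone; the division by 14 matches the 14 in the statement.\<close>
  proof (rule exI[of _ "1000 * L / 14"], intro conjI allI impI; (elim conjE)?)
    show "0 < 1000 * L / 14" using zk_weight.L1[OF w] by simp
    fix u1 u2 :: "real \<Rightarrow> real^3 \<Rightarrow> real" and \<delta> :: real
    assume u: "zk_solution u1" "zk_solution u2" and \<delta>: "0 < \<delta>" "\<delta> \<le> normQ r (\<lambda>t x. u1 t x - u2 t x)"
    obtain d w' N M where "zk_pair (\<lambda>t x. u1 (clamp01 t) x - u2 (clamp01 t) x) d w' N M"
      using zk_pair_exists[OF u] .
    then interpret zk_main r \<phi> L "\<lambda>t x. u1 (clamp01 t) x - u2 (clamp01 t) x" d w' N M
      using w by (intro zk_main.intro)
    have "\<exists>C>0. \<exists>R0\<ge>2. \<forall>R\<ge>R0. normQ r (\<lambda>t x. u1 t x - u2 t x)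
          \<le> C * exp (1000 * L * R powr (3/2)) * A_R R (\<lambda>t x. u1 t x - u2 t x)"
      by (rule lower_bound[OF _ \<delta>]) (simp add: clamp01_id)
    then show "\<exists>C>0. \<exists>R0\<ge>2. \<forall>R\<ge>R0. normQ r (\<lambda>t x. u1 t x - u2 t x)
          \<le> C * exp (14 * (1000 * L / 14) * R powr (3/2)) * A_R R (\<lambda>t x. u1 t x - u2 t x)"
      by simp
  qed
qed

end
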